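(* Let $A\in\mathbb{R}^{n\times m}$, $p=\max\{m,n\}$, $r:=\operatorname{rank}(A)$, and let $k$ be an integer with $1\le k\le \min\{n,m\}$. Then the following hold. (1) Suppose $k<r$. If $B\in\mathbb{R}^{n\times m}$ fulfills $C_k(A)=C_k(B)$, then $A=B$ if $k$ is odd, and $A=\pm B$ if $k$ is even. Moreover, there exists an algorithm whose input is $C_k(A)$ and which returns as output $cA$ for any $c\in\{-1,1\}$ fulfilling $c^k=1$. The time complexity of the algorithm is (a) $O\!\left(\binom{p}{k}^3 pk+\binom{r}{k}2^r\right)$ if $k\le\lceil r/2\rceil$; (b) $O\!\left(\binom{p}{k}^3 pk+\binom{r}{k}2^r+\binom{r}{\lceil r/2\rceil}^2 p k^2\log r\right)$ if $\lceil r/2\rceil<k<r$. (2) Suppose $k=r$, and let $A=UV^\top$ with $U\in\mathbb{R}^{n\times r}$, $V\in\mathbb{R}^{m\times r}$ of full column rank. Then there exists an algorithm that, given $C_k(A)$, determines an element of the set of inverse-compounds $\{UTV^\top : T\in\mathbb{R}^{r\times r},\ \det(T)=1\}$ (which is the set of all $B\in\mathbb{R}^{n\times m}$ with $C_k(B)=C_k(A)$) in time complexity $O\!\left(\binom{p}{k}p^2\right)$.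
   Context: For a matrix $X\in\mathbb{R}^{n\times m}$ and $1\le k\le\min\{n,m\}$, the $k$th multiplicative compound $C_k(X)\in\mathbb{R}^{\binom nk\times\binom mk}$ is the matrix whose $(i,j)$ entry is $\det(X_{I,J})$, where $I$ is the $i$th increasing $k$-tuple of elements of $\{1,\dots,n\}$ and $J$ is the $j$th increasing $k$-tuple of elements of $\{1,\dots,m\}$, both in lexicographic order, and $X_{I,J}$ is the submatrix with rows $I$ and columns $J$. An inverse-compound of $M\in\mathbb{R}^{\binom nk\times\binom mk}$ is a matrix $A\in\mathbb{R}^{n\times m}$ with $C_k(A)=M$. Time complexity counts real arithmetic operations, with the usual dense linear-algebra costs: a $k\times k$ determinant costs $O(k^3)$, a singular value decomposition (and hence a null space basis) of an $a\times b$ matrix with $a\ge b$ costs $O(ab^2)$, and a reduced singular value decomposition of an $a\times b$ matrix of rank $\rho$ costs $O(ab\rho)$. The integers $n,m,k$ are known to the algorithm. *)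

theory Defs
  imports
    "Jordan_Normal_Form.DL_Rank"
    "Jordan_Normal_Form.DL_Submatrix"
    "HOL-Library.List_Lexorder"
begin

section \<open>Multiplicative compound matrices\<close>

text \<open>Indices are counted from 0. The order on lists that underlies
  \<^const>\<open>sorted_list_of_set\<close> is the lexicographic one.\<close>

definition ktuples :: "nat \<Rightarrow> nat \<Rightarrow> nat list list" where
  "ktuples n k =
     sorted_list_of_set {I. sorted_wrt (<) I \<and> length I = k \<and> set I \<subseteq> {..<n}}"

definition compound :: "nat \<Rightarrow> real mat \<Rightarrow> real mat" where
  "compound k X = mat (dim_row X choose k) (dim_col X choose k)
     (\<lambda>(i, j). det (submatrix X (set (ktuples (dim_row X) k ! i))
                                (set (ktuples (dim_col X) k ! j))))"

abbreviation mrank :: "real mat \<Rightarrow> nat" where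
  "mrank X \<equiv> vec_space.rank (dim_row X) X"

definition inverse_compounds :: "nat \<Rightarrow> nat \<Rightarrow> nat \<Rightarrow> real mat \<Rightarrow> real mat set" where
  "inverse_compounds n m k M = {B \<in> carrier_mat n m. compound k B = M}"


section \<open>Singular value decompositions\<close>

text \<open>With \<open>q = min (dim_row X) (dim_col X)\<close> this is the thin decomposition; if
  \<open>dim_row X \<ge> dim_col X\<close> then \<open>V\<close> is square, and its last columns span the null space
  of \<open>X\<close>. With \<open>q = mrank X\<close> it is the reduced decomposition, whose singular values
  are then automatically positive.\<close>

definition is_svd :: "nat \<Rightarrow> real mat \<Rightarrow> real mat \<times> real mat \<times> real mat \<Rightarrow> bool" where
  "is_svd q X = (\<lambda>(U, S, V).
     U \<in> carrier_mat (dim_row X) q \<and> S \<in> carrier_mat q q \<and> V \<in> carrier_mat (dim_col X) q \<and>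
     transpose_mat U * U = 1\<^sub>m q \<and> transpose_mat V * V = 1\<^sub>m q \<and>
     diagonal_mat S \<and>
     (\<forall>i<q. 0 \<le> S $$ (i, i)) \<and>
     (\<forall>i j. i \<le> j \<and> j < q \<longrightarrow> S $$ (j, j) \<le> S $$ (i, i)) \<and>
     X = U * S * transpose_mat V)"

type_synonym svd_routine = "real mat \<Rightarrow> real mat \<times> real mat \<times> real mat"

definition thin_svd_routine :: "svd_routine \<Rightarrow> bool" where
  "thin_svd_routine f \<longleftrightarrow> (\<forall>X. is_svd (min (dim_row X) (dim_col X)) X (f X))"

definition reduced_svd_routine :: "svd_routine \<Rightarrow> bool" where
  "reduced_svd_routine f \<longleftrightarrow> (\<forall>X. is_svd (mrank X) X (f X))"


section \<open>Algorithms over the reals and their cost\<close>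

text \<open>An algorithm is one finite program, the same for all inputs and all dimensions. It
  has integer variables and two-dimensional arrays of reals, both named by numbers.
  The arrays can be inspected only by comparing two entries, and the integer variables hold
  no reals.

  The cost counts arithmetic operations on reals. Arithmetic on integers (indices and loop
  bounds), copying, loading an integer literal and comparisons are therefore free.
  Extraction of a root is an arithmetic operation of cost 1: the matrix \<open>t \<cdot>\<^sub>m 1\<^sub>m (k + 1)\<close>
  cannot be found from its compound \<open>t ^ k \<cdot>\<^sub>m 1\<^sub>m (k + 1)\<close> without one.\<close>

datatype iexp =
    INum nat
  | IVar nat
  | IAdd iexp iexp
  | ISub iexp iexp
  | IMul iexp iexp
  | IDiv iexp iexp
  | IMod iexp iexp
  | ISum nat iexp iexp
  | IProd nat iexp iexp

primrec ival :: "iexp \<Rightarrow> (nat \<Rightarrow> nat) \<Rightarrow> nat" where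
  "ival (INum c) s = c"
| "ival (IVar x) s = s x"
| "ival (IAdd e f) s = ival e s + ival f s"
| "ival (ISub e f) s = ival e s - ival f s"
| "ival (IMul e f) s = ival e s * ival f s"
| "ival (IDiv e f) s = ival e s div ival f s"
| "ival (IMod e f) s = ival e s mod ival f s"
| "ival (ISum x e f) s = (\<Sum>i<ival e s. ival f (s(x := i)))"
| "ival (IProd x e f) s = (\<Prod>i<ival e s. ival f (s(x := i)))"

text \<open>\<open>Ref a e f\<close> is the entry of array \<open>a\<close> in row \<open>e\<close> and column \<open>f\<close>.\<close>

datatype ref = Ref nat iexp iexp

datatype arith = Add | Sub | Mul | Div

primrec aval :: "arith \<Rightarrow> real \<Rightarrow> real \<Rightarrow> real" where
  "aval Add x y = x + y"
| "aval Sub x y = x - y"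
| "aval Mul x y = x * y"
| "aval Div x y = x / y"

text \<open>Destinations come first: \<open>Op f d x y\<close> sets \<open>d\<close> to \<open>f x y\<close>; \<open>Root d e x\<close> sets \<open>d\<close> to
  the root of order \<open>e\<close> of \<open>x\<close>; \<open>Det d a e\<close> sets \<open>d\<close> to the determinant of the leading
  \<open>e \<times> e\<close> block of array \<open>a\<close>. \<open>ThinSVD u s v a e f\<close> and \<open>ReducedSVD x u s v a e f\<close>
  decompose the leading \<open>e \<times> f\<close> block of array \<open>a\<close> into blocks of the arrays \<open>u\<close>, \<open>s\<close> and
  \<open>v\<close>; the latter also assigns the rank to the integer variable \<open>x\<close>.
  \<open>For x e c\<close> runs \<open>c\<close> for \<open>x = 0, \<dots>, e - 1\<close>, with \<open>e\<close> evaluated once.\<close>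

datatype prog =
    Skip
  | Seq prog prog
  | IAssign nat iexp
  | For nat iexp prog
  | IfILess iexp iexp prog prog
  | IfRLess ref ref prog prog
  | Literal ref int
  | Copy ref ref
  | Op arith ref ref ref
  | Root ref iexp ref
  | Det ref nat iexp
  | ThinSVD nat nat nat nat iexp iexp
  | ReducedSVD nat nat nat nat nat iexp iexp

record state =
  ivars :: "nat \<Rightarrow> nat"
  arrays :: "nat \<Rightarrow> nat \<Rightarrow> nat \<Rightarrow> real"
  cost :: nat

primrec get :: "ref \<Rightarrow> state \<Rightarrow> real" where
  "get (Ref a e f) s = arrays s a (ival e (ivars s)) (ival f (ivars s))"

definition put_array :: "nat \<Rightarrow> (nat \<Rightarrow> nat \<Rightarrow> real) \<Rightarrow> state \<Rightarrow> state" where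
  "put_array a g s = s\<lparr>arrays := (arrays s)(a := g)\<rparr>"

primrec put :: "ref \<Rightarrow> real \<Rightarrow> state \<Rightarrow> state" where
  "put (Ref a e f) v s =
     put_array a (\<lambda>i j. if i = ival e (ivars s) \<and> j = ival f (ivars s) then v
                        else arrays s a i j) s"

definition get_block :: "nat \<Rightarrow> nat \<Rightarrow> nat \<Rightarrow> state \<Rightarrow> real mat" where
  "get_block a p q s = mat p q (\<lambda>(i, j). arrays s a i j)"

definition put_block :: "nat \<Rightarrow> real mat \<Rightarrow> state \<Rightarrow> state" where
  "put_block a X s =
     put_array a (\<lambda>i j. if i < dim_row X \<and> j < dim_col X then X $$ (i, j)
                        else arrays s a i j) s"

definition set_ivar :: "nat \<Rightarrow> nat \<Rightarrow> state \<Rightarrow> state" where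
  "set_ivar x i s = s\<lparr>ivars := (ivars s)(x := i)\<rparr>"

definition charge :: "nat \<Rightarrow> state \<Rightarrow> state" where
  "charge t s = s\<lparr>cost := cost s + t\<rparr>"

text \<open>The parameters \<open>thin\<close> and \<open>red\<close> are the subroutines for the two decompositions, which
  are not unique.\<close>

primrec exec :: "svd_routine \<Rightarrow> svd_routine \<Rightarrow> prog \<Rightarrow> state \<Rightarrow> state" where
  "exec thin red Skip s = s"
| "exec thin red (Seq c d) s = exec thin red d (exec thin red c s)"
| "exec thin red (IAssign x e) s = set_ivar x (ival e (ivars s)) s"
| "exec thin red (For x e c) s =
     fold (\<lambda>i s'. exec thin red c (set_ivar x i s')) [0..<ival e (ivars s)] s"
| "exec thin red (IfILess e f c d) s =
     (if ival e (ivars s) < ival f (ivars s) then exec thin red c s else exec thin red d s)"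
| "exec thin red (IfRLess x y c d) s =
     (if get x s < get y s then exec thin red c s else exec thin red d s)"
| "exec thin red (Literal d z) s = put d (of_int z) s"
| "exec thin red (Copy d x) s = put d (get x s) s"
| "exec thin red (Op f d x y) s = charge 1 (put d (aval f (get x s) (get y s)) s)"
| "exec thin red (Root d e x) s = charge 1 (put d (root (ival e (ivars s)) (get x s)) s)"
| "exec thin red (Det d a e) s =
     (let p = ival e (ivars s)
      in charge (p ^ 3) (put d (det (get_block a p p s)) s))"
| "exec thin red (ThinSVD u l v a e f) s =
     (let p = ival e (ivars s); q = ival f (ivars s); (U, S, V) = thin (get_block a p q s)
      in charge (max p q * (min p q)\<^sup>2) (put_block v V (put_block l S (put_block u U s))))"
| "exec thin red (ReducedSVD x u l v a e f) s =
     (let p = ival e (ivars s); q = ival f (ivars s); (U, S, V) = red (get_block a p q s)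
      in charge (p * q * dim_row S)
           (set_ivar x (dim_row S) (put_block v V (put_block l S (put_block u U s)))))"

text \<open>Initially array 0 contains the input matrix and the integer variables 0, 1 and 2 contain
  \<open>n\<close>, \<open>m\<close> and \<open>k\<close>. The output is the list of the leading \<open>n \<times> m\<close> blocks of the arrays
  1, 2, \dots; its length is the final value of the integer variable 0.\<close>

definition initial :: "nat \<Rightarrow> nat \<Rightarrow> nat \<Rightarrow> real mat \<Rightarrow> state" where
  "initial n m k M = put_block 0 M
     \<lparr>ivars = (\<lambda>x. 0)(0 := n, 1 := m, 2 := k), arrays = (\<lambda>a i j. 0), cost = 0\<rparr>"

definition outputs :: "nat \<Rightarrow> nat \<Rightarrow> state \<Rightarrow> real mat list" where
  "outputs n m s = map (\<lambda>t. get_block (Suc t) n m s) [0..<ivars s 0]"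

text \<open>\<open>returns P n m k M Q t\<close>: for whichever decompositions the subroutines return, \<open>P\<close> outputs
  a list satisfying \<open>Q\<close> at a cost of at most \<open>t\<close>.\<close>

definition returns ::
    "prog \<Rightarrow> nat \<Rightarrow> nat \<Rightarrow> nat \<Rightarrow> real mat \<Rightarrow> (real mat list \<Rightarrow> bool) \<Rightarrow> real \<Rightarrow> bool" where
  "returns P n m k M Q t \<longleftrightarrow>
     (\<forall>thin red. thin_svd_routine thin \<and> reduced_svd_routine red \<longrightarrow>
        (let s = exec thin red P (initial n m k M)
         in Q (outputs n m s) \<and> real (cost s) \<le> t))"

end

theory Submission
  imports Defs "HOL-Library.Nat_Bijection"
begin

text \<open>Fix \<open>k\<close>-subsets \<open>S\<close>, \<open>D\<close> of the row and column indices with \<open>det A[S,D] \<noteq> 0\<close>. Laplace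
  expansions whose cofactors are \<open>k\<close>-minors are linear equations that determine all of \<open>A\<close>
  from \<open>A[S,D]\<close> and the compound: first the columns in \<open>D\<close> and the rows in \<open>S\<close>
  (expansions with a repeated line vanish), then the remaining entries \<open>(i, j)\<close>, by comparing the
  expansions of \<open>det A[S \<union> {i}, D \<union> {j}]\<close> along row \<open>i\<close> and along a row of \<open>S\<close>. So only
  the block \<open>A[S,D]\<close> has to be found.

  If \<open>k < rank A\<close>, some submatrix \<open>X\<close> of size \<open>k + 1\<close> is regular. Its cofactor matrix \<open>Y\<close>
  consists of signed entries of the compound, \<open>det Y = (det X) ^ k\<close>, and the cofactor matrix of
  \<open>Y\<close> is \<open>(det X) ^ (k - 1)\<close> times \<open>X\<close>. Hence \<open>X\<close> is known up to the choice of a \<open>k\<close>-th root of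
  \<open>det Y\<close>. If \<open>k = rank A\<close>, every block with the determinant \<open>det A[S,D]\<close> belongs to
  an inverse compound, and a diagonal one is taken.

  All pairs of \<open>(k + 1)\<close>-subsets can be tried, since \<open>(k + 1) (p choose (k + 1))\<close> is
  \<open>(p - k) (p choose k)\<close>, and \<open>p \<le> p choose k\<close> for \<open>1 \<le> k < p\<close>. No singular value
  decomposition is needed.\<close>

section \<open>Minors and their expansions\<close>

text \<open>In each of the linear equations the coefficient of the sought entry is, up to sign, the
  minor on \<open>S\<close> and \<open>D\<close>, so one nonzero minor justifies all divisions. None
  of them involves the value of a minor of size \<open>k + 1\<close>, which the compound does not
  contain.

  Regularity of \<open>X\<close> is tested on \<open>det Y\<close>, which is computable and vanishes
  exactly when \<open>det X\<close> does. For even \<open>k\<close> the root yields only the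
  absolute value of \<open>det X\<close>, so the algorithm recovers \<open>c\<close> times
  \<open>A\<close> for a sign \<open>c\<close> that it never learns. Correctness is therefore proved
  for that multiple, which has the same \<open>k\<close>-minors. The case \<open>k = rank A\<close>
  works alike: the chosen block extends to some \<open>U T V^T\<close> with the given compound, and
  the completion is verified as if that matrix were the input.

  Lexicographic positions are integer expressions in bit masks, so enumerating subsets costs
  nothing; only signs, sums, products, quotients, roots and determinants are charged. If
  \<open>k = p\<close>, the bound in the full-rank case shrinks to a multiple of
  \<open>p ^ 2\<close>; then the block is the whole matrix and nothing is completed.\<close>

declare pick.simps [simp del]

text \<open>On \<open>K\<close> this inverts \<open>pick K\<close>. For \<open>x\<close> outside
  \<open>K\<close> it is the slot that \<open>x\<close> would take, so an index beyond all elements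
  gets the slot after the last one.\<close>

definition pos :: "nat set \<Rightarrow> nat \<Rightarrow> nat" where
  "pos K x = card {t \<in> K. t < x}"

definition minor :: "real mat \<Rightarrow> nat set \<Rightarrow> nat set \<Rightarrow> real" where
  "minor A K L = det (submatrix A K L)"

text \<open>Removing a nonmember removes nothing: \<open>y = m\<close> (or \<open>x = n\<close>), an index outside the matrix, is
  used when a \<open>k\<close>-set is to be kept on one side.\<close>

definition cof :: "real mat \<Rightarrow> nat set \<Rightarrow> nat \<Rightarrow> nat set \<Rightarrow> nat \<Rightarrow> real" where
  "cof A K x L y = (- 1) ^ (pos K x + pos L y) * minor A (K - {x}) (L - {y})"

lemma pos_pick: "a < card K \<Longrightarrow> pos K (pick K a) = a"
  unfolding pos_def by (rule card_pick) simp

lemma pick_pos: "x \<in> K \<Longrightarrow> pick K (pos K x) = x"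
  unfolding pos_def by (rule pick_card_in_set)

lemma pos_less: "finite K \<Longrightarrow> x \<in> K \<Longrightarrow> pos K x < card K"
  unfolding pos_def by (rule psubset_card_mono) auto

lemma pos_eq_card: "(\<And>x. x \<in> K \<Longrightarrow> x < y) \<Longrightarrow> pos K y = card K"
  unfolding pos_def by (rule arg_cong[where f = card]) auto

lemma pick_in: "a < card K \<Longrightarrow> pick K a \<in> K"
  by (rule pick_in_set) simp

lemma pick_eq_iff: "a < card K \<Longrightarrow> b < card K \<Longrightarrow> pick K a = pick K b \<longleftrightarrow> a = b"
  by (metis pos_pick)

lemma bij_betw_pick: "finite K \<Longrightarrow> bij_betw (pick K) {..<card K} K"
  by (rule bij_betw_byWitness[where f' = "pos K"])
     (auto simp: pos_pick pick_pos pos_less pick_in)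

text \<open>An element is determined by how many smaller ones there are, and dropping
  \<open>pick K a\<close> lowers this count exactly for the later elements. The resulting shift is
  that of \<open>mat_delete\<close>.\<close>

lemma pick_remove:
  assumes K: "finite K" and a: "a < card K" and i: "i < card K - 1"
  shows "pick (K - {pick K a}) i = pick K (if i < a then i else Suc i)"
proof -
  define b where "b = (if i < a then i else Suc i)"
  have b: "b < card K" "b \<noteq> a" using a i by (auto simp: b_def)
  then have x: "pick K b \<in> K - {pick K a}" using a pick_in pick_eq_iff by auto
  have "{t \<in> K - {pick K a}. t < pick K b} = {t \<in> K. t < pick K b} - {pick K a}" by auto
  moreover have "pick K a < pick K b \<longleftrightarrow> a < b"
    using a b pick_mono[of b K a] pick_mono[of a K b] by (metis linorder_neqE_nat order_less_asym)
  ultimately have "pos (K - {pick K a}) (pick K b) = (if a < b then b - 1 else b)"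
    using pos_pick[OF b(1)] K pick_in[OF a] unfolding pos_def by (auto simp: card_Diff_singleton_if)
  also have "\<dots> = i" using b by (auto simp: b_def split: if_splits)
  finally have "pos (K - {pick K a}) (pick K b) = i" .
  then show ?thesis using pick_pos[OF x] unfolding b_def by simp
qed

lemma submatrix_dims:
  assumes "A \<in> carrier_mat n m" "K \<subseteq> {..<n}" "L \<subseteq> {..<m}"
  shows "submatrix A K L \<in> carrier_mat (card K) (card L)"
proof -
  have "{i. i < n \<and> i \<in> K} = K" "{i. i < m \<and> i \<in> L} = L" using assms by auto
  then show ?thesis using assms(1) unfolding submatrix_def by auto
qed

lemma submatrix_nth:
  assumes "A \<in> carrier_mat n m" "K \<subseteq> {..<n}" "L \<subseteq> {..<m}" "a < card K" "b < card L"
  shows "submatrix A K L $$ (a, b) = A $$ (pick K a, pick L b)"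
proof -
  have "{i. i < n \<and> i \<in> K} = K" "{i. i < m \<and> i \<in> L} = L" using assms by auto
  then show ?thesis using assms unfolding submatrix_def by auto
qed

section \<open>Cofactors of submatrices and Laplace expansion\<close>

lemma mat_delete_submatrix:
  assumes A: "A \<in> carrier_mat n m" and K: "K \<subseteq> {..<n}" and L: "L \<subseteq> {..<m}"
    and a: "a < card K" and b: "b < card L"
  shows "mat_delete (submatrix A K L) a b = submatrix A (K - {pick K a}) (L - {pick L b})"
proof -
  have fin: "finite K" "finite L" using K L finite_subset by auto
  have K': "K - {pick K a} \<subseteq> {..<n}" "card (K - {pick K a}) = card K - 1"
    using K a fin pick_in by auto
  have L': "L - {pick L b} \<subseteq> {..<m}" "card (L - {pick L b}) = card L - 1"
    using L b fin pick_in by auto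
  note S = submatrix_dims[OF A K L] submatrix_dims[OF A K'(1) L'(1)]
  show ?thesis
  proof (rule eq_matI)
    fix i j
    assume "i < dim_row (submatrix A (K - {pick K a}) (L - {pick L b}))"
      "j < dim_col (submatrix A (K - {pick K a}) (L - {pick L b}))"
    then have i: "i < card K - 1" and j: "j < card L - 1" using S(2) K'(2) L'(2) by auto
    let ?i = "if i < a then i else Suc i" and ?j = "if j < b then j else Suc j"
    have "?i < card K" "?j < card L" using i j by auto
    then have "submatrix A K L $$ (?i, ?j) = A $$ (pick K ?i, pick L ?j)"
      by (rule submatrix_nth[OF A K L])
    also have "\<dots> = submatrix A (K - {pick K a}) (L - {pick L b}) $$ (i, j)"
      using submatrix_nth[OF A K'(1) L'(1)] K'(2) L'(2) i j
        pick_remove[OF fin(1) a i] pick_remove[OF fin(2) b j] by simp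
    finally show "mat_delete (submatrix A K L) a b $$ (i, j) =
        submatrix A (K - {pick K a}) (L - {pick L b}) $$ (i, j)"
      using S(1) i j by (simp add: mat_delete_def)
  qed (use S K' L' in \<open>auto simp: mat_delete_def\<close>)
qed

lemma cofactor_submatrix:
  assumes A: "A \<in> carrier_mat n m" and K: "K \<subseteq> {..<n}" and L: "L \<subseteq> {..<m}"
    and a: "a < card K" and b: "b < card L"
  shows "cofactor (submatrix A K L) a b = cof A K (pick K a) L (pick L b)"
  unfolding cofactor_def cof_def minor_def mat_delete_submatrix[OF assms]
  by (simp add: pos_pick a b)

lemma sum_pick: "finite K \<Longrightarrow> (\<Sum>a<card K. f (pick K a)) = (\<Sum>x\<in>K. f x)"
  by (rule sum.reindex_bij_betw[OF bij_betw_pick])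

lemma minor_row_expansion:
  assumes A: "A \<in> carrier_mat n m" and K: "K \<subseteq> {..<n}" and L: "L \<subseteq> {..<m}"
    and KL: "card K = card L" and x: "x \<in> K"
  shows "minor A K L = (\<Sum>c\<in>L. A $$ (x, c) * cof A K x L c)"
proof -
  have fin: "finite K" "finite L" using K L finite_subset by auto
  note p = pos_less[OF fin(1) x]
  have "minor A K L = (\<Sum>b<card L. submatrix A K L $$ (pos K x, b) * cofactor (submatrix A K L) (pos K x) b)"
    unfolding minor_def by (rule laplace_expansion_row) (use submatrix_dims[OF A K L] KL p in auto)
  also have "\<dots> = (\<Sum>b<card L. A $$ (x, pick L b) * cof A K x L (pick L b))"
    by (rule sum.cong)
       (use p in \<open>auto simp: submatrix_nth[OF A K L] cofactor_submatrix[OF A K L] pick_pos[OF x]\<close>)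
  also have "\<dots> = (\<Sum>c\<in>L. A $$ (x, c) * cof A K x L c)"
    by (rule sum_pick[OF fin(2)])
  finally show ?thesis .
qed

lemma submatrix_transpose:
  "submatrix (transpose_mat A) L K = transpose_mat (submatrix A K L)"
proof (rule eq_matI)
  fix i j
  assume "i < dim_row (transpose_mat (submatrix A K L))" "j < dim_col (transpose_mat (submatrix A K L))"
  then have i: "i < card {l. l < dim_col A \<and> l \<in> L}" and j: "j < card {l. l < dim_row A \<and> l \<in> K}"
    by (simp_all add: dim_submatrix)
  show "submatrix (transpose_mat A) L K $$ (i, j) = transpose_mat (submatrix A K L) $$ (i, j)"
    using i j pick_le[OF i] pick_le[OF j] by (simp add: submatrix_def)
qed (simp_all add: dim_submatrix)

lemma minor_transpose:
  assumes "A \<in> carrier_mat n m" "K \<subseteq> {..<n}" "L \<subseteq> {..<m}" "card K = card L"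
  shows "minor (transpose_mat A) L K = minor A K L"
  unfolding minor_def submatrix_transpose
  by (rule det_transpose) (use submatrix_dims[OF assms(1-3)] assms(4) in simp)

text \<open>Expansion of a determinant in which the column \<open>c\<close> is appended to the columns \<open>L \<ni> c\<close>.\<close>

lemma sum_col_cof_eq_0:
  assumes A: "A \<in> carrier_mat n m" and K: "K \<subseteq> {..<n}" and L: "L \<subseteq> {..<m}"
    and KL: "card K = Suc (card L)" and c: "c \<in> L"
  shows "(\<Sum>x\<in>K. A $$ (x, c) * cof A K x L m) = 0"
proof -
  have fin: "finite K" "finite L" using K L finite_subset by auto
  define k where "k = card L"
  define Z where "Z = mat (Suc k) (Suc k)
    (\<lambda>(a, b). if b < k then A $$ (pick K a, pick L b) else A $$ (pick K a, c))"
  have Z: "Z \<in> carrier_mat (Suc k) (Suc k)" by (simp add: Z_def)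
  have p: "pos L c < k" using pos_less[OF fin(2) c] by (simp add: k_def)
  have "det Z = 0"
  proof (rule det_identical_columns[OF Z])
    show "pos L c \<noteq> k" using p by simp
    show "col Z (pos L c) = col Z k"
      by (rule eq_vecI) (use p c in \<open>auto simp: Z_def pick_pos\<close>)
  qed (use p in auto)
  have minor: "det (mat_delete Z a k) = minor A (K - {pick K a}) (L - {m})" if a: "a < Suc k" for a
  proof -
    have Lm: "L - {m} = L" using L by auto
    have K': "K - {pick K a} \<subseteq> {..<n}" "card (K - {pick K a}) = k"
      using K a fin pick_in[of a K] KL by (auto simp: k_def)
    note S = submatrix_dims[OF A K'(1) L]
    have "mat_delete Z a k = submatrix A (K - {pick K a}) L"
    proof (rule eq_matI)
      fix i j
      assume "i < dim_row (submatrix A (K - {pick K a}) L)"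
        "j < dim_col (submatrix A (K - {pick K a}) L)"
      then have i: "i < k" and j: "j < k" using S K'(2) by (auto simp: k_def)
      have "a < card K" "i < card K - 1" using a i KL by (auto simp: k_def)
      then have "pick (K - {pick K a}) i = pick K (if i < a then i else Suc i)"
        by (rule pick_remove[OF fin(1)])
      then show "mat_delete Z a k $$ (i, j) = submatrix A (K - {pick K a}) L $$ (i, j)"
        using submatrix_nth[OF A K'(1) L] K'(2) i j by (simp add: mat_delete_def Z_def k_def)
    qed (use S K' in \<open>auto simp: mat_delete_def Z_def k_def\<close>)
    then show ?thesis by (simp add: minor_def Lm)
  qed
  \<comment> \<open>The index \<open>m\<close> lies beyond \<open>L\<close>, so its sign is that of
    the last column of \<open>Z\<close>.\<close>
  have posm: "pos L m = k" unfolding k_def by (rule pos_eq_card) (use L in auto)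
  have Zk: "Z $$ (a, k) = A $$ (pick K a, c)" if "a < Suc k" for a
    using that by (simp add: Z_def)
  have "det Z = (\<Sum>a<Suc k. Z $$ (a, k) * cofactor Z a k)"
    by (rule laplace_expansion_column[OF Z]) simp
  also have "\<dots> = (\<Sum>a<Suc k. A $$ (pick K a, c) * cof A K (pick K a) L m)"
    by (rule sum.cong) (auto simp: cofactor_def cof_def minor posm KL k_def[symmetric] pos_pick Zk)
  also have "\<dots> = (\<Sum>x\<in>K. A $$ (x, c) * cof A K x L m)"
    using sum_pick[OF fin(1), of "\<lambda>x. A $$ (x, c) * cof A K x L m"] KL by (simp add: k_def)
  finally show ?thesis using \<open>det Z = 0\<close> by simp
qed

lemma sum_row_cof_eq_0:
  assumes A: "A \<in> carrier_mat n m" and K: "K \<subseteq> {..<n}" and L: "L \<subseteq> {..<m}"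
    and KL: "card L = Suc (card K)" and i: "i \<in> K"
  shows "(\<Sum>c\<in>L. A $$ (i, c) * cof A K n L c) = 0"
proof -
  have fin: "finite K" "finite L" using K L finite_subset by auto
  have "(\<Sum>c\<in>L. A $$ (i, c) * cof A K n L c) =
    (\<Sum>c\<in>L. transpose_mat A $$ (c, i) * cof (transpose_mat A) L c K n)"
  proof (rule sum.cong[OF refl])
    fix c assume c: "c \<in> L"
    have "K - {n} = K" "card (L - {c}) = card K" using K c KL fin by auto
    moreover have "L - {c} \<subseteq> {..<m}" using L by auto
    ultimately have "minor (transpose_mat A) (L - {c}) (K - {n}) = minor A (K - {n}) (L - {c})"
      using minor_transpose[OF A, of K "L - {c}"] K by simp
    moreover have "A $$ (i, c) = transpose_mat A $$ (c, i)"
    proof -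
      have "i < n" "c < m" using K L i c by auto
      then show ?thesis using A by auto
    qed
    ultimately show "A $$ (i, c) * cof A K n L c = transpose_mat A $$ (c, i) * cof (transpose_mat A) L c K n"
      by (simp only: cof_def add.commute[of "pos K n"])
  qed
  also have "\<dots> = 0"
    by (rule sum_col_cof_eq_0[OF _ L K KL i]) (use A in simp)
  finally show ?thesis .
qed

lemma minor_empty: "minor A {} {} = 1"
  unfolding minor_def by (rule det_dim_zero) (auto simp: dim_submatrix)


text \<open>Equating two expansions of one determinant eliminates its value, which in the
  application is a minor too large to be read from the compound.\<close>

lemma sum_row_cof_eq:
  assumes "A \<in> carrier_mat n m" "K \<subseteq> {..<n}" "L \<subseteq> {..<m}" "card K = card L"
    and "x \<in> K" "y \<in> K"
  shows "(\<Sum>c\<in>L. A $$ (x, c) * cof A K x L c) = (\<Sum>c\<in>L. A $$ (y, c) * cof A K y L c)"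
  using minor_row_expansion[OF assms(1-4)] assms(5,6) by metis

section \<open>Rank and nonzero minors\<close>

lemma rank_sum_products_le:
  assumes "finite L"
  shows "vec_space.rank n (mat n m (\<lambda>(i, j). \<Sum>c\<in>L. f i c * g c j :: real)) \<le> card L"
  using assms
proof induction
  case empty
  have "mat n m (\<lambda>(i, j). \<Sum>c\<in>{}. f i c * g c j) = (0\<^sub>m n m :: real mat)"
    by (rule eq_matI) auto
  then show ?case by (simp only: vec_space.rank_0I card.empty)
next
  case (insert c L)
  let ?A = "mat n m (\<lambda>(i, j). f i c * g c j)" and ?B = "mat n m (\<lambda>(i, j). \<Sum>c\<in>L. f i c * g c j)"
  have "mat n m (\<lambda>(i, j). \<Sum>c\<in>insert c L. f i c * g c j) = ?A + ?B"
    by (rule eq_matI) (use insert in auto)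
  moreover have "vec_space.rank n (?A + ?B) \<le> vec_space.rank n ?A + vec_space.rank n ?B"
    by (rule vec_space.rank_subadditive[where nc = m]) auto
  moreover have "vec_space.rank n ?A \<le> 1"
    by (rule vec_space.rank_le_1_product_entries[where nc = m and f = "\<lambda>r. f r c" and g = "g c"]) auto
  ultimately show ?case using insert by simp
qed

text \<open>This is the bordering criterion. Vanishing bordered minors make every column
  \<open>j\<close> a combination of the columns in \<open>L\<close>, with coefficients
  \<open>g c j\<close> that do not depend on the row.\<close>

lemma rank_le_of_minors:
  assumes A: "A \<in> carrier_mat n m" and K: "K \<subseteq> {..<n}" and L: "L \<subseteq> {..<m}"
    and KL: "card K = card L" and nz: "minor A K L \<noteq> 0"
    and zero: "\<And>i j. i < n \<Longrightarrow> j < m \<Longrightarrow> i \<notin> K \<Longrightarrow> j \<notin> L \<Longrightarrow> minor A (insert i K) (insert j L) = 0"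
  shows "mrank A \<le> card L"
proof -
  have fin: "finite K" "finite L" using K L finite_subset by auto
  have dims: "dim_row A = n" "dim_col A = m" using A by auto
  \<comment> \<open>Comes from solving the expansion along an appended row \<open>i\<close> for the
    entry in column \<open>j\<close>. The cofactors belong to the rows \<open>K\<close> alone, hence
    are the same for all \<open>i\<close>, and the pivot at \<open>j\<close> is
    \<open>minor A K L\<close> up to sign.\<close>
  define g where "g c j = (if j \<in> L then (if c = j then 1 else 0)
    else - cof A K n (insert j L) c / cof A K n (insert j L) j)" for c j
  have entry: "A $$ (i, j) = (\<Sum>c\<in>L. A $$ (i, c) * g c j)" if i: "i < n" and j: "j < m" for i j
  proof (cases "j \<in> L")
    case True
    then have "(\<Sum>c\<in>L. A $$ (i, c) * g c j) = (\<Sum>c\<in>L. if c = j then A $$ (i, c) else 0)"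
      by (intro sum.cong) (auto simp: g_def)
    then show ?thesis using True fin by simp
  next
    case False
    define p where "p = cof A K n (insert j L) j"
    have "insert j L - {j} = L" "K - {n} = K" using False K by auto
    then have p: "p \<noteq> 0" using nz by (simp add: p_def cof_def)
    \<comment> \<open>A row \<open>i\<close> of \<open>K\<close> is repeated in the bordered matrix;
      for any other row the sum is, up to sign, a bordered minor and vanishes by assumption.\<close>
    have "(\<Sum>c\<in>insert j L. A $$ (i, c) * cof A K n (insert j L) c) = 0"
    proof (cases "i \<in> K")
      case True
      show ?thesis
        by (rule sum_row_cof_eq_0[OF A K _ _ True]) (use L j KL fin False in auto)
    next
      case iK: False
      have "minor A (insert i K) (insert j L) =
          (\<Sum>c\<in>insert j L. A $$ (i, c) * cof A (insert i K) i (insert j L) c)"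
        by (rule minor_row_expansion[OF A]) (use i j K L KL fin iK False in auto)
      moreover have "minor A (insert i K) (insert j L) = 0"
        using zero i j iK False by simp
      moreover have "cof A (insert i K) i (insert j L) c =
          (- 1) ^ (pos (insert i K) i + pos K n) * cof A K n (insert j L) c" for c
      proof -
        have "insert i K - {i} = K - {n}" using iK K by auto
        moreover have "(- 1 :: real) ^ (a + b) = (- 1) ^ (a + d) * (- 1) ^ (d + b)" for a b d
          by (simp add: power_add mult.assoc[symmetric])
        ultimately show ?thesis by (simp add: cof_def)
      qed
      ultimately have "0 = (- 1) ^ (pos (insert i K) i + pos K n) *
          (\<Sum>c\<in>insert j L. A $$ (i, c) * cof A K n (insert j L) c)"
        unfolding sum_distrib_left by (simp only: mult.left_commute)
      then show ?thesis by simp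
    qed
    then have "A $$ (i, j) * p = - (\<Sum>c\<in>L. A $$ (i, c) * cof A K n (insert j L) c)"
      using False fin by (simp add: p_def add_eq_0_iff2)
    then have "A $$ (i, j) = - (\<Sum>c\<in>L. A $$ (i, c) * cof A K n (insert j L) c) / p"
      using p by (simp add: field_simps)
    also have "\<dots> = (\<Sum>c\<in>L. A $$ (i, c) * g c j)"
      by (simp add: g_def False p_def sum_divide_distrib sum_negf[symmetric])
    finally show ?thesis .
  qed
  have "A = mat n m (\<lambda>(i, j). \<Sum>c\<in>L. A $$ (i, c) * g c j)"
    by (rule eq_matI) (use entry A in auto)
  then have "vec_space.rank n A \<le> card L"
    using rank_sum_products_le[OF fin(2), of n m "\<lambda>i c. A $$ (i, c)" g] by simp
  then show ?thesis by (simp add: dims)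
qed

text \<open>A nonzero minor whose size is below the rank has a nonzero bordering minor, so nonzero
  minors grow one line at a time from the empty one.\<close>

lemma exists_nonzero_minor:
  assumes A: "A \<in> carrier_mat n m" and j: "j \<le> mrank A"
  shows "\<exists>K L. K \<subseteq> {..<n} \<and> L \<subseteq> {..<m} \<and> card K = j \<and> card L = j \<and> minor A K L \<noteq> 0"
  using j
proof (induction j)
  case 0
  show ?case by (intro exI[of _ "{}"]) (simp add: minor_empty)
next
  case (Suc j)
  then obtain K L where KL: "K \<subseteq> {..<n}" "L \<subseteq> {..<m}" "card K = j" "card L = j" "minor A K L \<noteq> 0"
    by auto
  then have fin: "finite K" "finite L" using finite_subset by auto
  have "\<not> mrank A \<le> card L" using Suc.prems KL by simp
  then obtain x y where "x < n" "y < m" "x \<notin> K" "y \<notin> L" "minor A (insert x K) (insert y L) \<noteq> 0"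
    using rank_le_of_minors[OF A KL(1,2) _ KL(5)] KL(3,4) by auto
  then show ?case using KL fin
    by (intro exI[of _ "insert x K"] exI[of _ "insert y L"]) auto
qed

section \<open>Compound matrices\<close>

text \<open>Everything follows from the adjugate identity: \<open>X\<close> times the transpose of
  \<open>Y\<close> is \<open>det X\<close> times the unit matrix. The second claim makes the
  regularity of \<open>X\<close> testable on \<open>Y\<close>.\<close>

lemma cofactor_matrix:
  fixes X :: "real mat"
  assumes X: "X \<in> carrier_mat (Suc k) (Suc k)" and k: "1 \<le> k"
    and Y: "Y = mat (Suc k) (Suc k) (\<lambda>(a, b). cofactor X a b)"
  shows "det X \<noteq> 0 \<Longrightarrow> det Y = det X ^ k"
    and "det Y \<noteq> 0 \<Longrightarrow> det X \<noteq> 0"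
    and "det X \<noteq> 0 \<Longrightarrow> a < Suc k \<Longrightarrow> b < Suc k \<Longrightarrow> cofactor Y a b = det X ^ (k - 1) * X $$ (a, b)"
proof -
  let ?d = "det X" and ?I = "1\<^sub>m (Suc k) :: real mat"
  have Yc: "Y \<in> carrier_mat (Suc k) (Suc k)" by (simp add: Y)
  have YT: "adj_mat X = transpose_mat Y"
    by (rule eq_matI) (use X in \<open>auto simp: Y adj_mat_def\<close>)
  have XY: "X * transpose_mat Y = ?d \<cdot>\<^sub>m ?I"
    using adj_mat(2)[OF X] YT by simp
  have "transpose_mat (X * transpose_mat Y) = transpose_mat (?d \<cdot>\<^sub>m ?I)"
    using XY by simp
  moreover have "transpose_mat (?d \<cdot>\<^sub>m ?I) = ?d \<cdot>\<^sub>m ?I"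
    by (rule eq_matI) auto
  ultimately have YX: "Y * transpose_mat X = ?d \<cdot>\<^sub>m ?I"
    using transpose_mult[OF X, of "transpose_mat Y" "Suc k"] Yc by simp
  have "?d * det Y = det (X * transpose_mat Y)"
    using det_mult[OF X, of "transpose_mat Y"] Yc det_transpose[OF Yc] by simp
  also have "\<dots> = ?d ^ Suc k" unfolding XY by simp
  finally show detY: "det X \<noteq> 0 \<Longrightarrow> det Y = det X ^ k" by simp
  show "det X \<noteq> 0" if "det Y \<noteq> 0"
  proof
    assume "?d = 0"
    then have XY0: "X * transpose_mat Y = 0\<^sub>m (Suc k) (Suc k)"
      unfolding XY by (intro eq_matI) auto
    have Yt: "transpose_mat Y \<in> carrier_mat (Suc k) (Suc k)" using Yc by simp
    \<comment> \<open>If \<open>det X = 0\<close> although \<open>det Y \<noteq> 0\<close>,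
      cancelling the regular factor leaves \<open>X = 0\<close>; the adjugate takes the place of an
      inverse.\<close>
    have "X * (transpose_mat Y * adj_mat (transpose_mat Y)) = 0\<^sub>m (Suc k) (Suc k)"
      using assoc_mult_mat[OF X Yt adj_mat(1)[OF Yt]] XY0 left_mult_zero_mat[OF adj_mat(1)[OF Yt]]
      by simp
    then have "X * (det Y \<cdot>\<^sub>m ?I) = 0\<^sub>m (Suc k) (Suc k)"
      using adj_mat(2)[OF Yt] det_transpose[OF Yc] by simp
    then have "det Y \<cdot>\<^sub>m X = 0\<^sub>m (Suc k) (Suc k)"
      using X mult_smult_distrib[OF X, of ?I "Suc k" "det Y"] by simp
    then have "det Y * X $$ (a, b) = 0" if "a < Suc k" "b < Suc k" for a b
      using that X by (metis index_smult_mat(1) index_zero_mat(1) carrier_matD)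
    then have "X $$ (a, b) = 0" if "a < Suc k" "b < Suc k" for a b
      using that \<open>det Y \<noteq> 0\<close> by simp
    \<comment> \<open>Written as a multiple of the unit matrix, it has determinant
      \<open>0 ^ k\<close>, which is 0 because \<open>1 \<le> k\<close>.\<close>
    then have "mat_delete X a b = 0 \<cdot>\<^sub>m 1\<^sub>m k" if "a < Suc k" "b < Suc k" for a b
      by (intro eq_matI) (use X in \<open>auto simp: mat_delete_def\<close>)
    then have "cofactor X a b = 0" if "a < Suc k" "b < Suc k" for a b
      using that k by (simp add: cofactor_def)
    then have "Y = 0 \<cdot>\<^sub>m ?I" by (intro eq_matI) (auto simp: Y)
    then have "det Y = 0" by simp
    then show False using that by simp
  qed
  show "cofactor Y a b = ?d ^ (k - 1) * X $$ (a, b)" if "?d \<noteq> 0" "a < Suc k" "b < Suc k"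
  proof -
    note aY = adj_mat[OF Yc]
    have Xt: "transpose_mat X \<in> carrier_mat (Suc k) (Suc k)" using X by simp
    have "adj_mat Y * Y * transpose_mat X = adj_mat Y * (Y * transpose_mat X)"
      by (rule assoc_mult_mat[OF aY(1) Yc Xt])
    \<comment> \<open>\<open>adj_mat Y * Y\<close> is \<open>det Y = det X ^ k\<close> times the
      unit matrix, while \<open>Y * transpose_mat X\<close> is \<open>det X\<close> times
      it.\<close>
    then have "?d ^ k \<cdot>\<^sub>m transpose_mat X = ?d \<cdot>\<^sub>m adj_mat Y"
      using aY Xt detY[OF that(1)] YX mult_smult_distrib[OF aY(1), of ?I "Suc k" ?d]
        mult_smult_assoc_mat[of ?I "Suc k" "Suc k" "transpose_mat X" "Suc k" "?d ^ k"]
      by simp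
    then have "(?d ^ k \<cdot>\<^sub>m transpose_mat X) $$ (b, a) = (?d \<cdot>\<^sub>m adj_mat Y) $$ (b, a)" by simp
    then have "?d ^ k * X $$ (a, b) = ?d * cofactor Y a b"
      using that X Yc aY(1) by (simp add: adj_mat_def)
    moreover have "?d ^ k = ?d * ?d ^ (k - 1)" using k by (cases k) auto
    ultimately show ?thesis using that(1) by simp
  qed
qed

section \<open>Lexicographic order on index sets\<close>

definition lexless :: "nat set \<Rightarrow> nat set \<Rightarrow> bool" where
  "lexless S T \<longleftrightarrow> (\<exists>e\<in>S. e \<notin> T \<and> (\<forall>u<e. u \<in> S \<longleftrightarrow> u \<in> T))"

definition lex_rank :: "nat \<Rightarrow> nat set \<Rightarrow> nat" where
  "lex_rank n T = card {S. S \<subseteq> {..<n} \<and> card S = card T \<and> lexless S T}"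

lemma lexless_insert:
  assumes "x \<notin> S" "x \<notin> T"
  shows "lexless (insert x S) (insert x T) \<longleftrightarrow> lexless S T"
proof
  assume "lexless (insert x S) (insert x T)"
  then obtain e where e: "e \<in> insert x S" "e \<notin> insert x T"
      "\<forall>u<e. u \<in> insert x S \<longleftrightarrow> u \<in> insert x T"
    unfolding lexless_def by blast
  then have "\<forall>u<e. u \<in> S \<longleftrightarrow> u \<in> T" using assms by (metis insert_iff)
  then show "lexless S T" unfolding lexless_def using e by blast
next
  assume "lexless S T"
  then obtain e where "e \<in> S" "e \<notin> T" "\<forall>u<e. u \<in> S \<longleftrightarrow> u \<in> T"
    unfolding lexless_def by blast
  then show "lexless (insert x S) (insert x T)"
    unfolding lexless_def using assms by (intro bexI[of _ e]) auto
qed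

text \<open>The first place where two increasing tuples of equal length differ shows the least
  element of the symmetric difference of their sets, and the smaller tuple owns it.\<close>

lemma less_list_iff_lexless:
  fixes xs ys :: "nat list"
  assumes "sorted_wrt (<) xs" "sorted_wrt (<) ys" "length xs = length ys"
  shows "xs < ys \<longleftrightarrow> lexless (set xs) (set ys)"
  using assms
proof (induction xs arbitrary: ys)
  case Nil
  then show ?case by (simp add: lexless_def)
next
  case (Cons x xs)
  then obtain y zs where ys: "ys = y # zs" by (cases ys) auto
  show ?case
  proof (cases x y rule: linorder_cases)
    case less
    then have "lexless (set (x # xs)) (set (y # zs))"
      unfolding lexless_def using Cons.prems ys by (intro bexI[of _ x]) auto
    then show ?thesis using less ys by simp
  next
    case equal
    have "x \<notin> set xs" "x \<notin> set zs" using Cons.prems ys equal by auto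
    then have "lexless (insert x (set xs)) (insert x (set zs)) \<longleftrightarrow> lexless (set xs) (set zs)"
      by (rule lexless_insert)
    then show ?thesis using Cons equal ys by simp
  next
    case greater
    \<comment> \<open>Every element of \<open>x # xs\<close> exceeds \<open>y\<close>, so agreement
      below a witness \<open>e\<close> would put \<open>y\<close> into a list whose entries are all
      larger.\<close>
    have "\<not> lexless (set (x # xs)) (set (y # zs))"
    proof
      assume "lexless (set (x # xs)) (set (y # zs))"
      then obtain e where e: "e \<in> set (x # xs)" "\<forall>u<e. u \<in> set (x # xs) \<longleftrightarrow> u \<in> set (y # zs)"
        unfolding lexless_def by blast
      have "x \<le> e" using e(1) Cons.prems by auto
      then have "y < e" using greater by simp
      then have "y \<in> set (x # xs)" using e(2) by (metis list.set_intros(1))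
      then show False using Cons.prems greater by auto
    qed
    then show ?thesis using greater ys by simp
  qed
qed

lemma card_less_nth:
  fixes xs :: "'a::linorder list"
  assumes "sorted_wrt (<) xs" "i < length xs"
  shows "card {y \<in> set xs. y < xs ! i} = i"
proof -
  have "{y \<in> set xs. y < xs ! i} = set (take i xs)"
  proof (intro equalityI subsetI)
    fix y assume "y \<in> {y \<in> set xs. y < xs ! i}"
    then obtain j where "j < length xs" "y = xs ! j" "xs ! j < xs ! i"
      by (auto simp: in_set_conv_nth)
    moreover have "\<not> i \<le> j"
    proof
      assume "i \<le> j"
      then have "xs ! i \<le> xs ! j"
        using assms sorted_wrt_nth_less[OF assms(1), of i j] \<open>j < length xs\<close>
        by (cases "i = j") (auto simp: less_imp_le)
      then show False using \<open>xs ! j < xs ! i\<close> by simp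
    qed
    ultimately show "y \<in> set (take i xs)" by (auto simp: in_set_conv_nth)
  next
    fix y assume "y \<in> set (take i xs)"
    then obtain j where "j < i" "y = xs ! j" using assms by (auto simp: in_set_conv_nth)
    then show "y \<in> {y \<in> set xs. y < xs ! i}"
      using assms sorted_wrt_nth_less[OF assms(1), of j i] by auto
  qed
  moreover have "distinct (take i xs)"
    using assms(1) by (simp add: strict_sorted_iff)
  ultimately show ?thesis using assms(2) by (simp add: distinct_card)
qed

lemma ktuples:
  shows set_ktuples: "set (ktuples n k) = {I. sorted_wrt (<) I \<and> length I = k \<and> set I \<subseteq> {..<n}}"
    and sorted_ktuples: "sorted_wrt (<) (ktuples n k)"
    and bij_betw_ktuples: "bij_betw set (set (ktuples n k)) {S. S \<subseteq> {..<n} \<and> card S = k}"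
    and length_ktuples: "length (ktuples n k) = n choose k"
proof -
  let ?A = "{I. sorted_wrt (<) I \<and> length I = k \<and> set I \<subseteq> {..<n}}"
  \<comment> \<open>\<open>sorted_list_of_set\<close> of an infinite set would be empty.\<close>
  have fin: "finite ?A"
    by (rule finite_subset[OF _ finite_lists_length_eq[of "{..<n}" k]]) auto
  have bij: "bij_betw set ?A {S. S \<subseteq> {..<n} \<and> card S = k}"
  proof (rule bij_betw_byWitness[where f' = sorted_list_of_set])
    show "\<forall>I\<in>?A. sorted_list_of_set (set I) = I"
      by (auto simp: strict_sorted_iff sorted_list_of_set.idem_if_sorted_distinct)
    show "\<forall>S\<in>{S. S \<subseteq> {..<n} \<and> card S = k}. set (sorted_list_of_set S) = S"
      using finite_subset by fastforce
    show "set ` ?A \<subseteq> {S. S \<subseteq> {..<n} \<and> card S = k}"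
      by (auto simp: strict_sorted_iff distinct_card)
    show "sorted_list_of_set ` {S. S \<subseteq> {..<n} \<and> card S = k} \<subseteq> ?A"
      using finite_subset[OF _ finite_lessThan[of n]]
      by (auto simp: strict_sorted_iff sorted_list_of_set.length_sorted_key_list_of_set)
  qed
  show *: "set (ktuples n k) = ?A" "sorted_wrt (<) (ktuples n k)"
    using fin by (auto simp: ktuples_def)
  show "bij_betw set (set (ktuples n k)) {S. S \<subseteq> {..<n} \<and> card S = k}"
    using bij *(1) by simp
  have "length (ktuples n k) = card ?A"
    using fin by (simp add: ktuples_def)
  then show "length (ktuples n k) = n choose k"
    using bij_betw_same_card[OF bij] n_subsets[of "{..<n}" k] by simp
qed

lemma ktuples_nth:
  assumes "i < n choose k"
  shows "set (ktuples n k ! i) \<subseteq> {..<n}" "card (set (ktuples n k ! i)) = k"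
proof -
  have "ktuples n k ! i \<in> set (ktuples n k)" using assms by (simp add: length_ktuples)
  then show "set (ktuples n k ! i) \<subseteq> {..<n}" "card (set (ktuples n k ! i)) = k"
    by (auto simp: set_ktuples strict_sorted_iff distinct_card)
qed

text \<open>The position in a strictly increasing list is the number of smaller entries, and
  \<open>set\<close> carries the tuples below the one of \<open>T\<close> injectively onto the sets
  counted by \<open>lex_rank\<close>.\<close>

lemma ktuples_lex_rank:
  assumes T: "T \<subseteq> {..<n}" and k: "card T = k"
  shows "lex_rank n T < n choose k" "set (ktuples n k ! lex_rank n T) = T"
proof -
  let ?xs = "ktuples n k"
  note bij = bij_betw_ktuples[of n k]
  have "T \<in> set ` set ?xs" using bij T k by (auto simp: bij_betw_def)
  then obtain I where I: "I \<in> set ?xs" "set I = T" by auto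
  then obtain i where i: "i < length ?xs" "?xs ! i = I" by (metis in_set_conv_nth)
  have less: "J < I \<longleftrightarrow> lexless (set J) T" if "J \<in> set ?xs" for J
    using that I less_list_iff_lexless[of J I] by (auto simp: set_ktuples)
  have "set ` {J \<in> set ?xs. J < I} = {S. S \<subseteq> {..<n} \<and> card S = card T \<and> lexless S T}"
  proof -
    have "set ` set ?xs = {S. S \<subseteq> {..<n} \<and> card S = k}" using bij by (simp add: bij_betw_def)
    then have "{S. S \<subseteq> {..<n} \<and> card S = k \<and> lexless S T} = {S \<in> set ` set ?xs. lexless S T}" by auto
    then show ?thesis using less k by auto
  qed
  moreover have "inj_on set {J \<in> set ?xs. J < I}"
    by (rule inj_on_subset[of set "set ?xs"]) (use bij in \<open>auto simp: bij_betw_def\<close>)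
  ultimately have "lex_rank n T = card {J \<in> set ?xs. J < I}"
    unfolding lex_rank_def using card_image[of set "{J \<in> set ?xs. J < I}"] by simp
  also have "\<dots> = i" using card_less_nth[OF sorted_ktuples i(1)] i(2) by simp
  finally have "lex_rank n T = i" .
  then show "lex_rank n T < n choose k" "set (?xs ! lex_rank n T) = T"
    using i I by (auto simp: length_ktuples)
qed

lemma compound_minor:
  assumes "A \<in> carrier_mat n m" "K \<subseteq> {..<n}" "L \<subseteq> {..<m}" "card K = k" "card L = k"
  shows "compound k A $$ (lex_rank n K, lex_rank m L) = minor A K L"
  using assms ktuples_lex_rank[OF assms(2,4)] ktuples_lex_rank[OF assms(3,5)]
  by (auto simp: compound_def minor_def)


lemma compound_eq_iff:
  assumes A: "A \<in> carrier_mat n m" and B: "B \<in> carrier_mat n m"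
  shows "compound k A = compound k B \<longleftrightarrow>
    (\<forall>K L. K \<subseteq> {..<n} \<and> L \<subseteq> {..<m} \<and> card K = k \<and> card L = k \<longrightarrow> minor A K L = minor B K L)"
proof
  assume "compound k A = compound k B"
  then show "\<forall>K L. K \<subseteq> {..<n} \<and> L \<subseteq> {..<m} \<and> card K = k \<and> card L = k \<longrightarrow> minor A K L = minor B K L"
    using compound_minor[OF A] compound_minor[OF B] by metis
next
  assume *: "\<forall>K L. K \<subseteq> {..<n} \<and> L \<subseteq> {..<m} \<and> card K = k \<and> card L = k \<longrightarrow> minor A K L = minor B K L"
  show "compound k A = compound k B"
  proof (rule eq_matI)
    fix i j assume "i < dim_row (compound k B)" "j < dim_col (compound k B)"
    then have ij: "i < n choose k" "j < m choose k" using B by (auto simp: compound_def)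
    then show "compound k A $$ (i, j) = compound k B $$ (i, j)"
      using *[rule_format, of "set (ktuples n k ! i)" "set (ktuples m k ! j)"] A B
        ktuples_nth[of i n k] ktuples_nth[of j m k]
      by (simp add: compound_def minor_def)
  qed (use A B in \<open>auto simp: compound_def\<close>)
qed

lemma minor_smult:
  assumes "A \<in> carrier_mat n m" "K \<subseteq> {..<n}" "L \<subseteq> {..<m}"
  shows "minor (c \<cdot>\<^sub>m A) K L = c ^ card L * minor A K L"
proof -
  have "submatrix (c \<cdot>\<^sub>m A) K L = c \<cdot>\<^sub>m submatrix A K L"
  proof (rule eq_matI)
    fix i j assume "i < dim_row (c \<cdot>\<^sub>m submatrix A K L)" "j < dim_col (c \<cdot>\<^sub>m submatrix A K L)"
    then have ij: "i < card K" "j < card L" using submatrix_dims[OF assms] by auto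
    then have "pick K i < n" "pick L j < m" using pick_in assms(2,3) by blast+
    then show "submatrix (c \<cdot>\<^sub>m A) K L $$ (i, j) = (c \<cdot>\<^sub>m submatrix A K L) $$ (i, j)"
      using submatrix_nth[OF assms ij] submatrix_nth[of "c \<cdot>\<^sub>m A" n m K L i j] assms ij
        submatrix_dims[OF assms] by simp
  qed (simp_all add: dim_submatrix)
  then show ?thesis
    using submatrix_dims[OF assms] by (simp add: minor_def)
qed

section \<open>Minors of a product with small inner dimension\<close>

definition rowsel :: "real mat \<Rightarrow> nat set \<Rightarrow> real mat" where
  "rowsel W K = mat (card K) (dim_col W) (\<lambda>(a, j). W $$ (pick K a, j))"

lemma rowsel_carrier: "W \<in> carrier_mat n r \<Longrightarrow> rowsel W K \<in> carrier_mat (card K) r"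
  by (simp add: rowsel_def)

lemma rowsel_mult:
  assumes U: "U \<in> carrier_mat n r" and T: "T \<in> carrier_mat r q" and K: "K \<subseteq> {..<n}"
  shows "rowsel (U * T) K = rowsel U K * T"
proof (rule eq_matI)
  fix a j assume "a < dim_row (rowsel U K * T)" "j < dim_col (rowsel U K * T)"
  then have a: "a < card K" "j < q" using T by (auto simp: rowsel_def)
  then have "pick K a < n" using pick_in K by blast
  moreover have "row (rowsel U K) a = row U (pick K a)"
    by (rule eq_vecI) (use a U \<open>pick K a < n\<close> in \<open>auto simp: rowsel_def\<close>)
  ultimately show "rowsel (U * T) K $$ (a, j) = (rowsel U K * T) $$ (a, j)"
    using a U T by (simp add: rowsel_def)
qed (use U T in \<open>auto simp: rowsel_def\<close>)

lemma submatrix_mult_transpose: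
  assumes W: "W \<in> carrier_mat n r" and V: "V \<in> carrier_mat m r" and K: "K \<subseteq> {..<n}" and L: "L \<subseteq> {..<m}"
  shows "submatrix (W * transpose_mat V) K L = rowsel W K * transpose_mat (rowsel V L)"
proof (rule eq_matI)
  have WV: "W * transpose_mat V \<in> carrier_mat n m" using W V by simp
  note S = submatrix_dims[OF WV K L]
  note R = rowsel_carrier[OF W, of K] rowsel_carrier[OF V, of L]
  fix a b assume "a < dim_row (rowsel W K * transpose_mat (rowsel V L))"
    "b < dim_col (rowsel W K * transpose_mat (rowsel V L))"
  then have a: "a < card K" "b < card L" using R by auto
  then have p: "pick K a < n" "pick L b < m" using pick_in K L by blast+
  have "row (rowsel W K) a = row W (pick K a)"
    by (rule eq_vecI) (use a W p in \<open>auto simp: rowsel_def\<close>)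
  moreover have "row (rowsel V L) b = row V (pick L b)"
    by (rule eq_vecI) (use a V p in \<open>auto simp: rowsel_def\<close>)
  ultimately show "submatrix (W * transpose_mat V) K L $$ (a, b) =
      (rowsel W K * transpose_mat (rowsel V L)) $$ (a, b)"
    using a p W V R submatrix_nth[OF WV K L a] by simp
next
  have WV: "W * transpose_mat V \<in> carrier_mat n m" using W V by simp
  show "dim_row (submatrix (W * transpose_mat V) K L) = dim_row (rowsel W K * transpose_mat (rowsel V L))"
    "dim_col (submatrix (W * transpose_mat V) K L) = dim_col (rowsel W K * transpose_mat (rowsel V L))"
    using submatrix_dims[OF WV K L] rowsel_carrier[OF W, of K] rowsel_carrier[OF V, of L] by auto
qed

text \<open>Cauchy-Binet with a single summand, the inner dimension being the size of the
  minor.\<close>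

lemma minor_mult_transpose:
  assumes "W \<in> carrier_mat n r" "V \<in> carrier_mat m r" "K \<subseteq> {..<n}" "L \<subseteq> {..<m}"
    and KL: "card K = r" "card L = r"
  shows "minor (W * transpose_mat V) K L = det (rowsel W K) * det (rowsel V L)"
proof -
  have R: "rowsel W K \<in> carrier_mat r r" "rowsel V L \<in> carrier_mat r r"
    using rowsel_carrier[OF assms(1), of K] rowsel_carrier[OF assms(2), of L] KL by auto
  show ?thesis
    unfolding minor_def submatrix_mult_transpose[OF assms(1-4)]
    using det_mult[OF R(1), of "transpose_mat (rowsel V L)"] R(2) det_transpose[OF R(2)] by simp
qed

lemma exists_inverse_mat:
  assumes X: "(X :: real mat) \<in> carrier_mat r r" and d: "det X \<noteq> 0"
  obtains P where "P \<in> carrier_mat r r" "X * P = 1\<^sub>m r" "P * X = 1\<^sub>m r" "det P = 1 / det X"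
proof -
  let ?P = "(1 / det X) \<cdot>\<^sub>m adj_mat X"
  note a = adj_mat[OF X]
  have 1: "?P \<in> carrier_mat r r" using a(1) by simp
  have unit: "(1 / det X) \<cdot>\<^sub>m (det X \<cdot>\<^sub>m 1\<^sub>m r) = 1\<^sub>m r"
    by (rule eq_matI) (use d in auto)
  have 2: "X * ?P = 1\<^sub>m r"
    unfolding mult_smult_distrib[OF X a(1)] a(2) by (rule unit)
  have 3: "?P * X = 1\<^sub>m r"
    unfolding mult_smult_assoc_mat[OF a(1) X] a(3) by (rule unit)
  have "det X * det ?P = 1"
    using det_mult[OF X 1] 2 by simp
  then have "det ?P = 1 / det X" using d by (metis nonzero_mult_div_cancel_left)
  then show ?thesis using 1 2 3 that by blast
qed

text \<open>Both selected factors are regular, so \<open>T\<close> is solved from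
  \<open>X T Y = B\<close>. The condition on \<open>det B\<close> is what gives
  \<open>det T = 1\<close>.\<close>

lemma exists_factor:
  assumes U: "U \<in> carrier_mat n r" and V: "V \<in> carrier_mat m r" and S: "S \<subseteq> {..<n}" and D: "D \<subseteq> {..<m}"
    and c: "card S = r" "card D = r" and nz: "minor (U * transpose_mat V) S D \<noteq> 0"
    and B: "B \<in> carrier_mat r r" "det B = minor (U * transpose_mat V) S D"
  obtains T where "T \<in> carrier_mat r r" "det T = 1" "submatrix (U * T * transpose_mat V) S D = B"
proof -
  let ?X = "rowsel U S" and ?Y = "transpose_mat (rowsel V D)"
  have X: "?X \<in> carrier_mat r r" and Y: "?Y \<in> carrier_mat r r" and Y': "rowsel V D \<in> carrier_mat r r"
    using rowsel_carrier[OF U, of S] rowsel_carrier[OF V, of D] c by auto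
  have d: "minor (U * transpose_mat V) S D = det ?X * det ?Y"
    using minor_mult_transpose[OF U V S D c] det_transpose[OF Y'] by simp
  then have "det ?X \<noteq> 0" "det ?Y \<noteq> 0" using nz by auto
  then obtain P Q where P: "P \<in> carrier_mat r r" "?X * P = 1\<^sub>m r" "det P = 1 / det ?X"
    and Q: "Q \<in> carrier_mat r r" "Q * ?Y = 1\<^sub>m r" "det Q = 1 / det ?Y"
    using exists_inverse_mat[OF X] exists_inverse_mat[OF Y] by metis
  let ?T = "P * B * Q"
  have T: "?T \<in> carrier_mat r r" using P B Q by simp
  have PB: "P * B \<in> carrier_mat r r" using P B by simp
  have "det ?T = det P * det B * det Q"
    using det_mult[OF PB Q(1)] det_mult[OF P(1) B(1)] by simp
  then have 1: "det ?T = 1" using P Q B d nz by simp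
  have UT: "U * ?T \<in> carrier_mat n r" using U T by simp
  have "submatrix (U * ?T * transpose_mat V) S D = ?X * ?T * ?Y"
    unfolding submatrix_mult_transpose[OF UT V S D] rowsel_mult[OF U T S] ..
  also have "?X * ?T = ?X * (P * B) * Q"
    by (rule assoc_mult_mat[OF X PB Q(1), symmetric])
  also have "?X * (P * B) = ?X * P * B"
    by (rule assoc_mult_mat[OF X P(1) B(1), symmetric])
  also have "\<dots> = B" using P(2) B(1) by simp
  also have "B * Q * ?Y = B * (Q * ?Y)"
    by (rule assoc_mult_mat[OF B(1) Q(1) Y])
  also have "\<dots> = B" using Q(2) B(1) by simp
  finally show ?thesis using that[OF T 1] by simp
qed

lemma minor_factor:
  assumes U: "U \<in> carrier_mat n r" and V: "V \<in> carrier_mat m r" and T: "T \<in> carrier_mat r r"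
    and K: "K \<subseteq> {..<n}" and L: "L \<subseteq> {..<m}" and c: "card K = r" "card L = r"
  shows "minor (U * T * transpose_mat V) K L = det T * minor (U * transpose_mat V) K L"
proof -
  have UT: "U * T \<in> carrier_mat n r" using U T by simp
  have X: "rowsel U K \<in> carrier_mat r r" using rowsel_carrier[OF U, of K] c by simp
  show ?thesis
    unfolding minor_mult_transpose[OF UT V K L c] minor_mult_transpose[OF U V K L c]
      rowsel_mult[OF U T K] det_mult[OF X T] by simp
qed

section \<open>Recovering a matrix from its minors\<close>

lemma cof_ne_0: "minor A (K - {x}) (L - {y}) \<noteq> 0 \<Longrightarrow> cof A K x L y \<noteq> 0"
  by (simp add: cof_def)

context
  fixes A :: "real mat" and n m k :: nat and S D :: "nat set"
  assumes A: "A \<in> carrier_mat n m" and S: "S \<subseteq> {..<n}" and D: "D \<subseteq> {..<m}"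
    and cS: "card S = k" and cD: "card D = k" and nz: "minor A S D \<noteq> 0"
begin

lemma fin_SD: "finite S" "finite D"
  using S D finite_subset by auto

text \<open>Column \<open>j\<close> already occurs in \<open>D\<close>, hence the expansion
  vanishes. The divisor equals \<open>minor A S D\<close> up to sign, here and in the next two
  lemmas.\<close>

lemma entry_column:
  assumes i: "i < n" "i \<notin> S" and j: "j \<in> D"
  shows "A $$ (i, j) = - (\<Sum>x\<in>S. A $$ (x, j) * cof A (insert i S) x D m) / cof A (insert i S) i D m"
proof -
  have "insert i S - {i} = S" "D - {m} = D" using i D by auto
  then have p: "cof A (insert i S) i D m \<noteq> 0" using nz by (intro cof_ne_0) simp
  have "(\<Sum>x\<in>insert i S. A $$ (x, j) * cof A (insert i S) x D m) = 0"
    by (rule sum_col_cof_eq_0[OF A _ D _ j]) (use i S cS cD fin_SD in auto)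
  then have "A $$ (i, j) * cof A (insert i S) i D m = - (\<Sum>x\<in>S. A $$ (x, j) * cof A (insert i S) x D m)"
    using i fin_SD by simp
  then show ?thesis using p by (metis nonzero_mult_div_cancel_right)
qed

lemma entry_row:
  assumes i: "i \<in> S" and j: "j < m" "j \<notin> D"
  shows "A $$ (i, j) = - (\<Sum>c\<in>D. A $$ (i, c) * cof A S n (insert j D) c) / cof A S n (insert j D) j"
proof -
  have "insert j D - {j} = D" "S - {n} = S" using j S by auto
  then have p: "cof A S n (insert j D) j \<noteq> 0" using nz by (intro cof_ne_0) simp
  have "(\<Sum>c\<in>insert j D. A $$ (i, c) * cof A S n (insert j D) c) = 0"
    by (rule sum_row_cof_eq_0[OF A S _ _ i]) (use j D cS cD fin_SD in auto)
  then have "A $$ (i, j) * cof A S n (insert j D) j = - (\<Sum>c\<in>D. A $$ (i, c) * cof A S n (insert j D) c)"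
    using j fin_SD by simp
  then show ?thesis using p by (metis nonzero_mult_div_cancel_right)
qed

text \<open>On the right only the row \<open>a\<close> and the columns of \<open>D\<close> occur, so
  the entries needed are in the block or covered by the two preceding lemmas.\<close>

lemma entry_corner:
  assumes i: "i < n" "i \<notin> S" and j: "j < m" "j \<notin> D" and a: "a \<in> S"
  shows "A $$ (i, j) = ((\<Sum>c\<in>insert j D. A $$ (a, c) * cof A (insert i S) a (insert j D) c)
    - (\<Sum>c\<in>D. A $$ (i, c) * cof A (insert i S) i (insert j D) c)) / cof A (insert i S) i (insert j D) j"
proof -
  have "insert j D - {j} = D" "insert i S - {i} = S" using i j by auto
  then have p: "cof A (insert i S) i (insert j D) j \<noteq> 0" using nz by (intro cof_ne_0) simp
  have "(\<Sum>c\<in>insert j D. A $$ (i, c) * cof A (insert i S) i (insert j D) c) =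
      (\<Sum>c\<in>insert j D. A $$ (a, c) * cof A (insert i S) a (insert j D) c)"
    by (rule sum_row_cof_eq[OF A]) (use i j a S D cS cD fin_SD in auto)
  then have "A $$ (i, j) * cof A (insert i S) i (insert j D) j =
      (\<Sum>c\<in>insert j D. A $$ (a, c) * cof A (insert i S) a (insert j D) c)
      - (\<Sum>c\<in>D. A $$ (i, c) * cof A (insert i S) i (insert j D) c)"
    using j fin_SD by simp
  then show ?thesis using p by (metis nonzero_mult_div_cancel_right)
qed

end

text \<open>The three formulas express all entries by the block and the \<open>k\<close>-minors, and
  these are common to \<open>A\<close> and \<open>B\<close>.\<close>

lemma eq_of_minors_eq:
  assumes A: "A \<in> carrier_mat n m" and B: "B \<in> carrier_mat n m" and k: "1 \<le> k"
    and S: "S \<subseteq> {..<n}" and D: "D \<subseteq> {..<m}" and cS: "card S = k" and cD: "card D = k"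
    and nz: "minor A S D \<noteq> 0"
    and minors: "\<And>K L. K \<subseteq> {..<n} \<Longrightarrow> L \<subseteq> {..<m} \<Longrightarrow> card K = k \<Longrightarrow> card L = k \<Longrightarrow> minor A K L = minor B K L"
    and base: "\<And>x c. x \<in> S \<Longrightarrow> c \<in> D \<Longrightarrow> A $$ (x, c) = B $$ (x, c)"
  shows "A = B"
proof -
  have fin: "finite S" "finite D" using S D finite_subset by auto
  have nzB: "minor B S D \<noteq> 0" using minors[OF S D cS cD] nz by simp
  note eA = A S D cS cD nz and eB = B S D cS cD nzB
  have cof: "cof A K x L y = cof B K x L y"
    if "K \<subseteq> {..<n}" "L \<subseteq> {..<m}" "card (K - {x}) = k" "card (L - {y}) = k" for K x L y
  proof -
    have "K - {x} \<subseteq> {..<n}" "L - {y} \<subseteq> {..<m}" using that by auto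
    then show ?thesis unfolding cof_def using minors that(3,4) by simp
  qed
  have cn: "card (insert i S - {x}) = k" if "i \<notin> S" "x \<in> insert i S" for i x
    using that fin cS by (simp add: card_Diff_singleton)
  have cm: "card (insert j D - {c}) = k" if "j \<notin> D" "c \<in> insert j D" for j c
    using that fin cD by (simp add: card_Diff_singleton)
  have Dm: "D - {m} = D" and Sn: "S - {n} = S" using S D by auto
  have col: "A $$ (i, j) = B $$ (i, j)" if "i < n" "j \<in> D" for i j
  proof (cases "i \<in> S")
    case False
    have "cof A (insert i S) x D m = cof B (insert i S) x D m" if "x \<in> insert i S" for x
      by (rule cof) (use S D cD that False cn[of i x] \<open>i < n\<close> Dm in auto)
    then show ?thesis
      unfolding entry_column[OF eA that(1) False that(2)] entry_column[OF eB that(1) False that(2)]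
      using base that(2) by simp
  qed (use base that in auto)
  have row: "A $$ (i, j) = B $$ (i, j)" if "i \<in> S" "j < m" for i j
  proof (cases "j \<in> D")
    case False
    have "cof A S n (insert j D) c = cof B S n (insert j D) c" if "c \<in> insert j D" for c
      by (rule cof) (use S D cS that False cm[of j c] \<open>j < m\<close> Sn in auto)
    then show ?thesis
      unfolding entry_row[OF eA that(1,2) False] entry_row[OF eB that(1,2) False]
      using base that(1) by simp
  qed (use base that in auto)
  \<comment> \<open>Since \<open>1 \<le> k\<close>, there is a row of the block to compare
    with.\<close>
  obtain a where a: "a \<in> S" using cS k by fastforce
  have "A $$ (i, j) = B $$ (i, j)" if ij: "i < n" "j < m" for i j
  proof (cases "i \<in> S \<or> j \<in> D")
    case False
    then have F: "i \<notin> S" "j \<notin> D" by auto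
    have "cof A (insert i S) x (insert j D) c = cof B (insert i S) x (insert j D) c"
      if "x \<in> insert i S" "c \<in> insert j D" for x c
      by (rule cof) (use S D that F cn[of i x] cm[of j c] ij in auto)
    moreover have "A $$ (a, c) = B $$ (a, c)" if "c \<in> insert j D" for c
      using row[OF a, of c] that D ij by auto
    ultimately show ?thesis
      unfolding entry_corner[OF eA ij(1) F(1) ij(2) F(2) a] entry_corner[OF eB ij(1) F(1) ij(2) F(2) a]
      using col[OF ij(1)] a by simp
  qed (use row col that in auto)
  then show ?thesis using A B by (intro eq_matI) auto
qed

section \<open>Recovering a regular submatrix from its cofactors\<close>

lemma submatrix_cofactor_matrix:
  assumes A: "A \<in> carrier_mat n m" and R: "R \<subseteq> {..<n}" "card R = Suc k"
    and C: "C \<subseteq> {..<m}" "card C = Suc k"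
  shows "mat (Suc k) (Suc k) (\<lambda>(a, b). cofactor (submatrix A R C) a b) =
    mat (Suc k) (Suc k) (\<lambda>(a, b). cof A R (pick R a) C (pick C b))"
  by (rule eq_matI) (auto simp: cofactor_submatrix[OF A R(1) C(1)] R C)

text \<open>A root of odd order also exists for negative numbers and returns \<open>x\<close>, while
  a root of even order returns the absolute value. The sign is lost only for even \<open>k\<close>,
  hence \<open>c ^ k = 1\<close>.\<close>

lemma root_power:
  assumes "1 \<le> k"
  obtains c :: real where "c \<in> {-1, 1}" "c ^ k = 1" "root k (x ^ k) = c * x"
proof (cases "odd k \<or> x \<ge> 0")
  case True
  then have "root k (x ^ k) = x"
    using assms odd_real_root_power_cancel[of k x] real_root_power_cancel[of k x] by auto
  then show ?thesis using that[of 1] by simp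
next
  case False
  then have "x ^ k = (- x) ^ k" by simp
  then have "root k (x ^ k) = - x" using real_root_power_cancel[of k "- x"] assms False by simp
  then show ?thesis using that[of "-1"] False by simp
qed

text \<open>With \<open>d\<close> the determinant of the submatrix, \<open>cofactor Y a b\<close> is
  \<open>d ^ (k - 1)\<close> times its entry, \<open>det Y\<close> is \<open>d ^ k\<close>, and the
  root is \<open>c * d\<close>; the powers of \<open>d\<close> cancel. One sign \<open>c\<close>
  serves all entries.\<close>

lemma recover_submatrix:
  assumes A: "A \<in> carrier_mat n m" and R: "R \<subseteq> {..<n}" "card R = Suc k"
    and C: "C \<subseteq> {..<m}" "card C = Suc k" and k: "1 \<le> k"
    and Y: "Y = mat (Suc k) (Suc k) (\<lambda>(a, b). cof A R (pick R a) C (pick C b))"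
    and dY: "det Y \<noteq> 0"
  obtains c where "c \<in> {-1, 1}" "c ^ k = 1"
    "\<And>a b. a < Suc k \<Longrightarrow> b < Suc k \<Longrightarrow>
      cofactor Y a b * root k (det Y) / det Y = c * A $$ (pick R a, pick C b)"
proof -
  let ?X = "submatrix A R C"
  have X: "?X \<in> carrier_mat (Suc k) (Suc k)" using submatrix_dims[OF A R(1) C(1)] R C by simp
  have Y': "Y = mat (Suc k) (Suc k) (\<lambda>(a, b). cofactor ?X a b)"
    unfolding Y submatrix_cofactor_matrix[OF A R C] ..
  note cm = cofactor_matrix[OF X k Y']
  have d: "det ?X \<noteq> 0" by (rule cm(2)[OF dY])
  obtain c where c: "c \<in> {-1, 1}" "c ^ k = 1" "root k (det ?X ^ k) = c * det ?X"
    using root_power[OF k] by blast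
  have pw: "det ?X ^ k = det ?X ^ (k - 1) * det ?X" using k by (cases k) auto
  have "cofactor Y a b * root k (det Y) / det Y = c * A $$ (pick R a, pick C b)"
    if "a < Suc k" "b < Suc k" for a b
  proof -
    have "cofactor Y a b * root k (det Y) / det Y =
        det ?X ^ (k - 1) * ?X $$ (a, b) * (c * det ?X) / (det ?X ^ (k - 1) * det ?X)"
      using cm(1)[OF d] cm(3)[OF d that] c(3) pw by simp
    also have "\<dots> = c * ?X $$ (a, b)" using d by simp
    finally show ?thesis using submatrix_nth[OF A R(1) C(1)] R C that by simp
  qed
  then show ?thesis using that c by blast
qed

lemma exists_regular_cofactor_matrix:
  assumes A: "A \<in> carrier_mat n m" and k: "1 \<le> k" "k < mrank A"
  obtains R C where "R \<subseteq> {..<n}" "card R = Suc k" "C \<subseteq> {..<m}" "card C = Suc k"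
    "det (mat (Suc k) (Suc k) (\<lambda>(a, b). cof A R (pick R a) C (pick C b))) \<noteq> 0"
proof -
  obtain R C where RC: "R \<subseteq> {..<n}" "C \<subseteq> {..<m}" "card R = Suc k" "card C = Suc k" "minor A R C \<noteq> 0"
    using exists_nonzero_minor[OF A, of "Suc k"] k by auto
  let ?X = "submatrix A R C"
  have X: "?X \<in> carrier_mat (Suc k) (Suc k)" using submatrix_dims[OF A RC(1,2)] RC by simp
  have "det (mat (Suc k) (Suc k) (\<lambda>(a, b). cof A R (pick R a) C (pick C b))) = det ?X ^ k"
    using cofactor_matrix(1)[OF X k(1) refl] RC(5)
      submatrix_cofactor_matrix[OF A RC(1,3,2,4)] by (simp add: minor_def)
  then show ?thesis using that RC by (simp add: minor_def)
qed

section \<open>Index sets as bit masks\<close>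

lemma encode_mem: "finite K \<Longrightarrow> set_encode K div 2 ^ x mod 2 = of_bool (x \<in> K)"
proof -
  assume "finite K"
  then have "x \<in> K \<longleftrightarrow> odd (set_encode K div 2 ^ x)"
    using set_encode_inverse[of K] unfolding set_decode_def by blast
  then show ?thesis by (simp only: mod_2_eq_odd)
qed

lemma encode_remove:
  assumes "finite K"
  shows "set_encode K - of_bool (x \<in> K) * 2 ^ x = set_encode (K - {x})"
proof (cases "x \<in> K")
  case True
  then have "K = insert x (K - {x})" by auto
  then have "set_encode K = 2 ^ x + set_encode (K - {x})"
    using assms set_encode_insert[of "K - {x}" x] by simp
  then show ?thesis using True by simp
qed simp

lemma encode_insert:
  assumes "finite K"
  shows "set_encode K + (1 - of_bool (x \<in> K)) * 2 ^ x = set_encode (insert x K)"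
  using assms by (cases "x \<in> K") (auto simp: insert_absorb)

lemma decode_subset: "t < 2 ^ n \<Longrightarrow> set_decode t \<subseteq> {..<n}"
proof
  fix x assume t: "t < 2 ^ n" and x: "x \<in> set_decode t"
  have "x < n"
  proof (rule ccontr)
    assume "\<not> x < n"
    then have "(2 :: nat) ^ n \<le> 2 ^ x" by (intro power_increasing) auto
    then have "t < 2 ^ x" using t by (rule less_le_trans[rotated])
    then have "t div 2 ^ x = 0" by (rule div_less)
    then show False using x by (simp add: set_decode_def)
  qed
  then show "x \<in> {..<n}" by simp
qed

lemma encode_less:
  assumes "K \<subseteq> {..<n}"
  shows "set_encode K < 2 ^ n"
proof -
  have "set_encode K \<le> sum ((^) 2) {..<n}"
    unfolding set_encode_def by (rule sum_mono2) (use assms in auto)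
  also have "sum ((^) 2) {..<n} < (2 :: nat) ^ n" by (induction n) auto
  finally show ?thesis .
qed

lemma bij_betw_decode: "bij_betw set_decode {..<2 ^ n} (Pow {..<n})"
proof (rule bij_betw_byWitness[where f' = set_encode])
  show "\<forall>K\<in>Pow {..<n}. set_decode (set_encode K) = K"
    using finite_subset[OF _ finite_lessThan[of n]] by auto
  show "set_decode ` {..<2 ^ n} \<subseteq> Pow {..<n}" using decode_subset by auto
  show "set_encode ` Pow {..<n} \<subseteq> {..<2 ^ n}" using encode_less by auto
qed simp

text \<open>Turns the agreement below \<open>e\<close> in \<open>lexless\<close> into one comparison
  of remainders, which an integer expression can state.\<close>

lemma mod_eq_iff_decode:
  "t mod 2 ^ e = t' mod 2 ^ e \<longleftrightarrow> (\<forall>u<e. u \<in> set_decode t \<longleftrightarrow> u \<in> set_decode t')"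
proof -
  have "t mod 2 ^ e = t' mod 2 ^ e \<longleftrightarrow> take_bit e t = take_bit e t'"
    by (simp add: take_bit_eq_mod)
  also have "\<dots> \<longleftrightarrow> (\<forall>u<e. bit t u \<longleftrightarrow> bit t' u)"
    by (auto simp: bit_eq_iff bit_take_bit_iff)
  also have "\<dots> \<longleftrightarrow> (\<forall>u<e. u \<in> set_decode t \<longleftrightarrow> u \<in> set_decode t')"
    by (simp add: set_decode_def bit_iff_odd)
  finally show ?thesis .
qed

section \<open>Set operations as integer expressions\<close>

lemma sum_of_bool: "(\<Sum>t<n. of_bool (P t)) = card {t. t < n \<and> P t}" for n :: nat
proof -
  have "{..<n} \<inter> Collect P = {t. t < n \<and> P t}" by auto
  then show ?thesis by (simp add: of_bool_def sum.If_cases)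
qed

text \<open>The variables 90 to 99 are reserved for the binders inside expressions.\<close>

definition ipow2 :: "iexp \<Rightarrow> iexp" where
  "ipow2 e = IProd 99 e (INum 2)"

definition imem :: "iexp \<Rightarrow> iexp \<Rightarrow> iexp" where
  "imem e f = IMod (IDiv e (ipow2 f)) (INum 2)"

text \<open>With truncated subtraction, comparisons become expressions of value 0 or 1, and products
  of them are conjunctions.\<close>

definition ile :: "iexp \<Rightarrow> iexp \<Rightarrow> iexp" where
  "ile e f = ISub (INum 1) (ISub e f)"

definition ieq :: "iexp \<Rightarrow> iexp \<Rightarrow> iexp" where
  "ieq e f = ISub (INum 1) (IAdd (ISub e f) (ISub f e))"

definition inot :: "iexp \<Rightarrow> iexp" where
  "inot e = ISub (INum 1) e"

definition icount :: "nat \<Rightarrow> iexp \<Rightarrow> iexp" where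
  "icount x e = ISum 98 e (imem (IVar x) (IVar 98))"

text \<open>Counts the \<open>t\<close> such that the set has at most \<open>a\<close> elements up
  to and including \<open>t\<close>. These are exactly the \<open>t\<close> below the element of
  index \<open>a\<close>, counted from 0, so their number is that element.\<close>

definition ipick :: "iexp \<Rightarrow> nat \<Rightarrow> nat \<Rightarrow> iexp" where
  "ipick e x a = ISum 97 e (ile (icount x (IAdd (IVar 97) (INum 1))) (IVar a))"

text \<open>The outer sum runs over all masks, in variable 96, and counts those of equal size that
  precede the given one. The inner sum, over variable 95, counts the witnesses for
  \<open>lexless\<close>.\<close>

definition irank :: "nat \<Rightarrow> nat \<Rightarrow> iexp" where
  "irank N x = ISum 96 (ipow2 (IVar N)) (IMul (ieq (icount 96 (IVar N)) (icount x (IVar N)))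
     (ile (INum 1) (ISum 95 (IVar N)
       (IMul (IMul (imem (IVar 96) (IVar 95)) (inot (imem (IVar x) (IVar 95))))
         (ieq (IMod (IVar 96) (ipow2 (IVar 95))) (IMod (IVar x) (ipow2 (IVar 95))))))))"

definition iremove :: "nat \<Rightarrow> nat \<Rightarrow> iexp" where
  "iremove x y = ISub (IVar x) (IMul (imem (IVar x) (IVar y)) (ipow2 (IVar y)))"

definition iinsert :: "nat \<Rightarrow> nat \<Rightarrow> iexp" where
  "iinsert x y = IAdd (IVar x) (IMul (inot (imem (IVar x) (IVar y))) (ipow2 (IVar y)))"

definition isubset :: "nat \<Rightarrow> nat \<Rightarrow> nat \<Rightarrow> iexp" where
  "isubset N x y = ieq (ISum 94 (IVar N) (IMul (imem (IVar x) (IVar 94)) (inot (imem (IVar y) (IVar 94))))) (INum 0)"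

lemma ival_ipow2 [simp]: "ival (ipow2 e) s = 2 ^ ival e s"
  by (simp add: ipow2_def)

lemma ival_ile [simp]: "ival (ile e f) s = of_bool (ival e s \<le> ival f s)"
  by (simp add: ile_def)

lemma ival_ieq [simp]: "ival (ieq e f) s = of_bool (ival e s = ival f s)"
  by (simp add: ieq_def)

lemma ival_inot [simp]: "ival (inot e) s = 1 - ival e s"
  by (simp add: inot_def)

lemma ival_imem: "finite K \<Longrightarrow> ival e s = set_encode K \<Longrightarrow> ival (imem e f) s = of_bool (ival f s \<in> K)"
  by (simp add: imem_def encode_mem)

lemma ival_icount: "finite K \<Longrightarrow> s x = set_encode K \<Longrightarrow> x \<noteq> 98 \<Longrightarrow> ival (icount x e) s = pos K (ival e s)"
proof -
  assume *: "finite K" "s x = set_encode K" "x \<noteq> 98"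
  have "ival (icount x e) s = (\<Sum>t<ival e s. of_bool (t \<in> K))"
    unfolding icount_def ival.simps
    by (rule sum.cong) (use * in \<open>auto simp: ival_imem[of K]\<close>)
  also have "\<dots> = pos K (ival e s)"
    unfolding sum_of_bool pos_def by (rule arg_cong[where f = card]) auto
  finally show ?thesis .
qed

lemma pos_mono: "finite K \<Longrightarrow> x \<le> y \<Longrightarrow> pos K x \<le> pos K y"
  unfolding pos_def by (rule card_mono) auto

lemma pos_Suc: "finite K \<Longrightarrow> x \<in> K \<Longrightarrow> pos K (Suc x) = Suc (pos K x)"
proof -
  assume *: "finite K" "x \<in> K"
  then have "{t \<in> K. t < Suc x} = insert x {t \<in> K. t < x}" by auto
  then show ?thesis using * by (simp add: pos_def)
qed

lemma pos_eq_card_of_subset: "K \<subseteq> {..<n} \<Longrightarrow> pos K n = card K"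
  by (rule pos_eq_card) auto

lemma ival_ipick:
  assumes K: "K \<subseteq> {..<n}" and x: "s x = set_encode K" "x \<noteq> 98" "x \<noteq> 97"
    and e: "ival e s = n" and a: "a \<noteq> 97" "s a < card K"
  shows "ival (ipick e x a) s = pick K (s a)"
proof -
  have fin: "finite K" using K finite_subset by auto
  have p: "pick K (s a) \<in> K" by (rule pick_in[OF a(2)])
  have "ival (ipick e x a) s = (\<Sum>t<n. of_bool (pos K (Suc t) \<le> s a))"
    unfolding ipick_def ival.simps e
    by (rule sum.cong) (use fin x a in \<open>auto simp: ival_icount[of K]\<close>)
  also have "\<dots> = card {..<pick K (s a)}"
    unfolding sum_of_bool
  proof (rule arg_cong[where f = card], intro equalityI subsetI)
    fix t assume t: "t \<in> {t. t < n \<and> pos K (Suc t) \<le> s a}"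
    show "t \<in> {..<pick K (s a)}"
    proof (rule ccontr)
      assume "t \<notin> {..<pick K (s a)}"
      then have "pos K (Suc (pick K (s a))) \<le> pos K (Suc t)" using fin by (intro pos_mono) auto
      then show False using t pos_Suc[OF fin p] pos_pick[OF a(2)] by simp
    qed
  next
    fix t assume t: "t \<in> {..<pick K (s a)}"
    then have "pos K (Suc t) \<le> pos K (pick K (s a))" using fin by (intro pos_mono) auto
    then show "t \<in> {t. t < n \<and> pos K (Suc t) \<le> s a}"
      using t p K pos_pick[OF a(2)] by auto
  qed
  finally show ?thesis by simp
qed

lemma ival_irank:
  assumes K: "K \<subseteq> {..<n}" and x: "s x = set_encode K" "x < 90" and N: "s N = n" "N < 90"
  shows "ival (irank N x) s = lex_rank n K"
proof -
  have fin: "finite K" using K finite_subset by auto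
  have "ival (irank N x) s =
      (\<Sum>t<2 ^ n. of_bool (card (set_decode t) = card K \<and> lexless (set_decode t) K))"
    unfolding irank_def ival.simps ival_ipow2 N(1)
  proof (rule sum.cong[OF refl])
    fix t :: nat assume "t \<in> {..<2 ^ n}"
    then have t: "set_decode t \<subseteq> {..<n}" using decode_subset by simp
    let ?s = "s(96 := t)"
    let ?f = "IMul (IMul (imem (IVar 96) (IVar 95)) (inot (imem (IVar x) (IVar 95))))
      (ieq (IMod (IVar 96) (ipow2 (IVar 95))) (IMod (IVar x) (ipow2 (IVar 95))))"
    have "(\<Sum>e<n. ival ?f (?s(95 := e))) =
        (\<Sum>e<n. of_bool (e \<in> set_decode t \<and> e \<notin> K \<and> (\<forall>u<e. u \<in> set_decode t \<longleftrightarrow> u \<in> K)))"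
    proof (rule sum.cong[OF refl])
      fix e
      have 1: "ival (imem (IVar 96) (IVar 95)) (?s(95 := e)) = of_bool (e \<in> set_decode t)"
        using ival_imem[of "set_decode t" "IVar 96" "?s(95 := e)" "IVar 95"] by simp
      have 2: "ival (imem (IVar x) (IVar 95)) (?s(95 := e)) = of_bool (e \<in> K)"
        using ival_imem[of K "IVar x" "?s(95 := e)" "IVar 95"] fin x by simp
      have 3: "t mod 2 ^ e = set_encode K mod 2 ^ e \<longleftrightarrow> (\<forall>u<e. u \<in> set_decode t \<longleftrightarrow> u \<in> K)"
        using mod_eq_iff_decode[of t e "set_encode K"] fin by simp
      show "ival ?f (?s(95 := e)) =
          of_bool (e \<in> set_decode t \<and> e \<notin> K \<and> (\<forall>u<e. u \<in> set_decode t \<longleftrightarrow> u \<in> K))"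
        using x by (simp add: 1 2 3)
    qed
    also have "\<dots> = card {e. e < n \<and> e \<in> set_decode t \<and> e \<notin> K \<and> (\<forall>u<e. u \<in> set_decode t \<longleftrightarrow> u \<in> K)}"
      by (rule sum_of_bool)
    \<comment> \<open>A witness lies in \<open>set_decode t\<close> and thus below \<open>n\<close>,
      so the bounded sum finds it.\<close>
    finally have sum: "1 \<le> (\<Sum>e<n. ival ?f (?s(95 := e))) \<longleftrightarrow> lexless (set_decode t) K"
      using t by (auto simp: lexless_def Suc_le_eq card_gt_0_iff)
    have 4: "ival (icount 96 (IVar N)) ?s = card (set_decode t)"
      using ival_icount[of "set_decode t" ?s 96 "IVar N"] N pos_eq_card_of_subset[OF t] by simp
    have 5: "ival (icount x (IVar N)) ?s = card K"
      using ival_icount[of K ?s x "IVar N"] N x fin pos_eq_card_of_subset[OF K] by simp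
    show "ival (ieq (icount 96 (IVar N)) (icount x (IVar N))) ?s * ival (ile (INum 1) (ISum 95 (IVar N) ?f)) ?s =
        of_bool (card (set_decode t) = card K \<and> lexless (set_decode t) K)"
      unfolding ival.simps ival_ieq ival_ile 4 5 using sum N by simp
  qed
  also have "\<dots> = card {t. t < 2 ^ n \<and> card (set_decode t) = card K \<and> lexless (set_decode t) K}"
    by (rule sum_of_bool)
  also have "\<dots> = card (set_decode ` {t. t < 2 ^ n \<and> card (set_decode t) = card K \<and> lexless (set_decode t) K})"
    by (rule card_image[symmetric], rule inj_on_subset[of set_decode "{..<2 ^ n}"])
       (use bij_betw_decode[of n] in \<open>auto simp: bij_betw_def\<close>)
  also have "set_decode ` {t. t < 2 ^ n \<and> card (set_decode t) = card K \<and> lexless (set_decode t) K} =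
      {S. S \<subseteq> {..<n} \<and> card S = card K \<and> lexless S K}"
  proof -
    have img: "set_decode ` {..<2 ^ n} = Pow {..<n}"
      using bij_betw_decode[of n] by (simp add: bij_betw_def)
    have "{S. S \<subseteq> {..<n} \<and> card S = card K \<and> lexless S K} =
        {S \<in> set_decode ` {..<2 ^ n}. card S = card K \<and> lexless S K}"
      unfolding img by auto
    then show ?thesis by auto
  qed
  finally show ?thesis by (simp add: lex_rank_def)
qed

lemma ival_iremove: "finite K \<Longrightarrow> s x = set_encode K \<Longrightarrow> ival (iremove x y) s = set_encode (K - {s y})"
  by (simp add: iremove_def ival_imem[of K] encode_remove)

lemma ival_iinsert: "finite K \<Longrightarrow> s x = set_encode K \<Longrightarrow> ival (iinsert x y) s = set_encode (insert (s y) K)"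
  by (simp only: iinsert_def ival.simps ival_imem[of K] ival_inot ival_ipow2 encode_insert)

lemma ival_isubset:
  assumes "K \<subseteq> {..<n}" "finite L" "s x = set_encode K" "s y = set_encode L" "s N = n" "x < 90" "y < 90"
  shows "ival (isubset N x y) s = of_bool (K \<subseteq> L)"
proof -
  have fin: "finite K" using assms(1) finite_subset by auto
  have "ival (IMul (imem (IVar x) (IVar 94)) (inot (imem (IVar y) (IVar 94)))) (s(94 := t)) =
      of_bool (t \<in> K \<and> t \<notin> L)" for t
    using ival_imem[of K "IVar x" "s(94 := t)"] ival_imem[of L "IVar y" "s(94 := t)"] assms fin by simp
  then have "ival (isubset N x y) s = of_bool ((\<Sum>t<n. of_bool (t \<in> K \<and> t \<notin> L)) = (0 :: nat))"
    unfolding isubset_def ival_ieq ival.simps(8) using assms(5) by simp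
  also have "(\<Sum>t<n. of_bool (t \<in> K \<and> t \<notin> L)) = (0 :: nat) \<longleftrightarrow> K \<subseteq> L"
    unfolding sum_of_bool using assms(1) by auto
  finally show ?thesis .
qed

section \<open>Program logic\<close>

text \<open>Static over-approximations of what a program writes, from which all frame conditions follow.\<close>

primrec wvars :: "prog \<Rightarrow> nat set" where
  "wvars Skip = {}"
| "wvars (Seq c d) = wvars c \<union> wvars d"
| "wvars (IAssign x e) = {x}"
| "wvars (For x e c) = insert x (wvars c)"
| "wvars (IfILess e f c d) = wvars c \<union> wvars d"
| "wvars (IfRLess x y c d) = wvars c \<union> wvars d"
| "wvars (Literal d z) = {}"
| "wvars (Copy d x) = {}"
| "wvars (Op f d x y) = {}"
| "wvars (Root d e x) = {}"
| "wvars (Det d a e) = {}"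
| "wvars (ThinSVD u l v a e f) = {}"
| "wvars (ReducedSVD x u l v a e f) = {x}"

primrec aname :: "ref \<Rightarrow> nat" where
  "aname (Ref a e f) = a"

primrec warrays :: "prog \<Rightarrow> nat set" where
  "warrays Skip = {}"
| "warrays (Seq c d) = warrays c \<union> warrays d"
| "warrays (IAssign x e) = {}"
| "warrays (For x e c) = warrays c"
| "warrays (IfILess e f c d) = warrays c \<union> warrays d"
| "warrays (IfRLess x y c d) = warrays c \<union> warrays d"
| "warrays (Literal d z) = {aname d}"
| "warrays (Copy d x) = {aname d}"
| "warrays (Op f d x y) = {aname d}"
| "warrays (Root d e x) = {aname d}"
| "warrays (Det d a e) = {aname d}"
| "warrays (ThinSVD u l v a e f) = {u, l, v}"
| "warrays (ReducedSVD x u l v a e f) = {u, l, v}"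

lemma set_ivar_simps [simp]:
  "ivars (set_ivar x i s) = (ivars s)(x := i)"
  "arrays (set_ivar x i s) = arrays s"
  "cost (set_ivar x i s) = cost s"
  by (simp_all add: set_ivar_def)

lemma charge_simps [simp]:
  "ivars (charge t s) = ivars s"
  "arrays (charge t s) = arrays s"
  "cost (charge t s) = cost s + t"
  by (simp_all add: charge_def)

lemma put_simps [simp]:
  "ivars (put d v s) = ivars s"
  "cost (put d v s) = cost s"
  by (cases d; simp add: put_array_def)+

lemma put_block_simps [simp]:
  "ivars (put_block a X s) = ivars s"
  "cost (put_block a X s) = cost s"
  by (simp_all add: put_block_def put_array_def)

lemma arrays_put:
  "arrays (put (Ref a e f) v s) b i j =
    (if b = a \<and> i = ival e (ivars s) \<and> j = ival f (ivars s) then v else arrays s b i j)"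
  by (simp add: put_array_def)

lemma arrays_put_other: "b \<noteq> aname d \<Longrightarrow> arrays (put d v s) b = arrays s b"
  by (cases d) (simp add: put_array_def)

lemma arrays_put_block_other: "b \<noteq> a \<Longrightarrow> arrays (put_block a X s) b = arrays s b"
  by (simp add: put_block_def put_array_def)

declare put.simps [simp del]

section \<open>Loop and frame rules\<close>

lemma fold_invariant:
  assumes "P 0 s" "\<And>i s. i < N \<Longrightarrow> P i s \<Longrightarrow> P (Suc i) (f i s)"
  shows "P N (fold f [0..<N] s)"
proof -
  have "i \<le> N \<Longrightarrow> P i (fold f [0..<i] s)" for i
    by (induction i) (use assms in auto)
  then show ?thesis by blast
qed

context
  fixes thin red :: svd_routine
begin

abbreviation run :: "prog \<Rightarrow> state \<Rightarrow> state" where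
  "run \<equiv> exec thin red"

lemma ivars_run: "x \<notin> wvars c \<Longrightarrow> ivars (run c s) x = ivars s x"
proof (induction c arbitrary: s)
  case (For y e c)
  show ?case unfolding exec.simps
    by (rule fold_invariant[where P = "\<lambda>i s'. ivars s' x = ivars s x"]) (use For in auto)
qed (auto simp: Let_def split: prod.splits)

lemma arrays_run: "a \<notin> warrays c \<Longrightarrow> arrays (run c s) a = arrays s a"
proof (induction c arbitrary: s)
  case (For y e c)
  show ?case unfolding exec.simps
    by (rule fold_invariant[where P = "\<lambda>i s'. arrays s' a = arrays s a"]) (use For in auto)
qed (auto simp: Let_def arrays_put_other arrays_put_block_other split: prod.splits)

text \<open>The invariant is indexed by the set of visited pairs, which suits both searches and
  loops that skip pairs. It must survive changes of the counters because the loops set these. The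
  cost bound may depend on the pair, so pairs that are merely skipped need not be charged.\<close>

lemma run_grid:
  fixes P :: "(nat \<times> nat) set \<Rightarrow> state \<Rightarrow> bool"
  assumes init: "P {} s" and uv: "u \<noteq> v" "u \<notin> wvars c"
    and bounds: "\<And>X s. P X s \<Longrightarrow> ival e (ivars s) = N" "\<And>X s. P X s \<Longrightarrow> ival f (ivars s) = M"
    and vars: "\<And>X s i. P X s \<Longrightarrow> P X (set_ivar u i s)" "\<And>X s i. P X s \<Longrightarrow> P X (set_ivar v i s)"
    and step: "\<And>X s i j. P X s \<Longrightarrow> i < N \<Longrightarrow> j < M \<Longrightarrow> ivars s u = i \<Longrightarrow> ivars s v = j \<Longrightarrow>
      P (insert (i, j) X) (run c s) \<and> cost (run c s) \<le> cost s + t i j"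
  shows "P ({..<N} \<times> {..<M}) (run (For u e (For v f c)) s)"
    and "cost (run (For u e (For v f c)) s) \<le> cost s + (\<Sum>i<N. \<Sum>j<M. t i j)"
proof -
  have inner: "P (X \<union> {i} \<times> {..<M}) (run (For v f c) s) \<and>
      cost (run (For v f c) s) \<le> cost s + (\<Sum>j<M. t i j)"
    if s: "P X s" "ivars s u = i" and i: "i < N" for X s i
  proof -
    \<comment> \<open>The body needs the outer counter to be \<open>i\<close>. This survives because
      \<open>c\<close> does not write \<open>u\<close> and the inner counter is another
      variable.\<close>
    have "P (X \<union> {i} \<times> {..<M}) (run (For v f c) s) \<and> ivars (run (For v f c) s) u = i \<and>
      cost (run (For v f c) s) \<le> cost s + (\<Sum>j<M. t i j)"
      unfolding exec.simps bounds(2)[OF s(1)]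
    proof (rule fold_invariant[where P = "\<lambda>j s'. P (X \<union> {i} \<times> {..<j}) s' \<and> ivars s' u = i \<and>
        cost s' \<le> cost s + (\<Sum>j<j. t i j)"])
      fix j s' assume j: "j < M" and s': "P (X \<union> {i} \<times> {..<j}) s' \<and> ivars s' u = i \<and>
        cost s' \<le> cost s + (\<Sum>j<j. t i j)"
      let ?s = "set_ivar v j s'"
      have "P (insert (i, j) (X \<union> {i} \<times> {..<j})) (run c ?s) \<and> cost (run c ?s) \<le> cost ?s + t i j"
        by (rule step) (use s' i j vars uv in auto)
      moreover have "insert (i, j) (X \<union> {i} \<times> {..<j}) = X \<union> {i} \<times> {..<Suc j}" by auto
      moreover have "ivars (run c ?s) u = i" using ivars_run[OF uv(2)] uv(1) s' by simp
      ultimately show "P (X \<union> {i} \<times> {..<Suc j}) (run c ?s) \<and> ivars (run c ?s) u = i \<and>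
          cost (run c ?s) \<le> cost s + (\<Sum>j<Suc j. t i j)"
        using s' by simp
    qed (use s in simp)
    then show ?thesis by simp
  qed
  have "P ({..<N} \<times> {..<M}) (run (For u e (For v f c)) s) \<and>
      cost (run (For u e (For v f c)) s) \<le> cost s + (\<Sum>i<N. \<Sum>j<M. t i j)"
    unfolding exec.simps(4)[of _ _ u] bounds(1)[OF init]
  proof (rule fold_invariant[where P = "\<lambda>i s'. P ({..<i} \<times> {..<M}) s' \<and>
      cost s' \<le> cost s + (\<Sum>i<i. \<Sum>j<M. t i j)"])
    fix i s' assume i: "i < N" and s': "P ({..<i} \<times> {..<M}) s' \<and> cost s' \<le> cost s + (\<Sum>i<i. \<Sum>j<M. t i j)"
    have "P ({..<i} \<times> {..<M} \<union> {i} \<times> {..<M}) (run (For v f c) (set_ivar u i s')) \<and>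
        cost (run (For v f c) (set_ivar u i s')) \<le> cost (set_ivar u i s') + (\<Sum>j<M. t i j)"
      by (rule inner) (use s' i vars in auto)
    moreover have "{..<i} \<times> {..<M} \<union> {i} \<times> {..<M} = {..<Suc i} \<times> {..<M}" by auto
    ultimately show "P ({..<Suc i} \<times> {..<M}) (run (For v f c) (set_ivar u i s')) \<and>
        cost (run (For v f c) (set_ivar u i s')) \<le> cost s + (\<Sum>i<Suc i. \<Sum>j<M. t i j)"
      using s' by simp
  qed (use init in simp)
  then show "P ({..<N} \<times> {..<M}) (run (For u e (For v f c)) s)"
    and "cost (run (For u e (For v f c)) s) \<le> cost s + (\<Sum>i<N. \<Sum>j<M. t i j)" by auto
qed

end

text \<open>Registers. Arrays: 0 input, 1 and 2 outputs, 3 accumulator, 4 temporary, 5 the constant 0 (never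
  written), 6 cofactor matrix, 7 a submatrix of it, 8 its determinant, 9 the scaling factor. Integer
  variables: 3 and 4 masks of \<open>S\<close> and \<open>D\<close>, 5 and 6 masks of the rows and columns of \<open>X\<close>, 7 and 8 the
  current entry, 9 to 12 the arguments \<open>K\<close>, \<open>L\<close>, \<open>x\<close>, \<open>y\<close> of a cofactor, 13 a fixed row in \<open>S\<close>.\<close>

definition cell :: "nat \<Rightarrow> ref" where
  "cell a = Ref a (INum 0) (INum 0)"

text \<open>The minor is read from the input at its lexicographic position. An odd sign is realised
  by subtraction from the zero cell, the only operation charged.\<close>

definition cof_prog :: "nat \<Rightarrow> nat \<Rightarrow> prog" where
  "cof_prog x y = Seq (IAssign 21 (iremove 9 x)) (Seq (IAssign 22 (iremove 10 y))
     (IfILess (IMod (IAdd (icount 9 (IVar x)) (icount 10 (IVar y))) (INum 2)) (INum 1)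
       (Copy (cell 4) (Ref 0 (irank 0 21) (irank 1 22)))
       (Op Sub (cell 4) (cell 5) (Ref 0 (irank 0 21) (irank 1 22)))))"

text \<open>The loop variable is 20. Passed as \<open>p\<close> and \<open>x\<close>, it makes the
  expansion run along a column; passed as \<open>q\<close> and \<open>y\<close>, along a
  row.\<close>

definition dot_prog :: "arith \<Rightarrow> nat \<Rightarrow> nat \<Rightarrow> nat \<Rightarrow> nat \<Rightarrow> nat \<Rightarrow> nat \<Rightarrow> prog" where
  "dot_prog f b M p q x y = For 20 (IVar b) (IfILess (INum 0) (imem (IVar M) (IVar 20))
     (Seq (cof_prog x y) (Seq (Op Mul (cell 4) (cell 4) (Ref 1 (IVar p) (IVar q)))
       (Op f (cell 3) (cell 3) (cell 4)))) Skip)"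

lemma writes_cof_prog [simp]: "wvars (cof_prog x y) = {21, 22}" "warrays (cof_prog x y) = {4}"
  by (auto simp: cof_prog_def cell_def)

lemma writes_dot_prog [simp]: "wvars (dot_prog f b M p q x y) = {20, 21, 22}"
  "warrays (dot_prog f b M p q x y) = {3, 4}"
  by (auto simp: dot_prog_def cell_def)

text \<open>The matrix enters only through its \<open>k\<close>-minors. The predicate therefore
  passes to every matrix with the same compound, which is how programs are verified for a matrix
  that is chosen only in the proof.\<close>

definition ready :: "nat \<Rightarrow> nat \<Rightarrow> nat \<Rightarrow> real mat \<Rightarrow> state \<Rightarrow> bool" where
  "ready n m k A s \<longleftrightarrow> ivars s 0 = n \<and> ivars s 1 = m \<and> ivars s 2 = k \<and> arrays s 5 0 0 = 0 \<and>
    (\<forall>K L. K \<subseteq> {..<n} \<and> L \<subseteq> {..<m} \<and> card K = k \<and> card L = k \<longrightarrow>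
      arrays s 0 (lex_rank n K) (lex_rank m L) = minor A K L)"

lemma ready_set_ivar [simp]: "x > 2 \<Longrightarrow> ready n m k A (set_ivar x i s) = ready n m k A s"
  by (simp add: ready_def)

lemma ready_cong: "(\<And>x. x \<le> 2 \<Longrightarrow> ivars s' x = ivars s x) \<Longrightarrow> arrays s' 0 = arrays s 0 \<Longrightarrow>
    arrays s' 5 = arrays s 5 \<Longrightarrow> ready n m k A s' = ready n m k A s"
  by (simp add: ready_def)

lemma ready_run:
  assumes "{0, 1, 2} \<inter> wvars c = {}" "{0, 5} \<inter> warrays c = {}"
  shows "ready n m k A (exec thin red c s) = ready n m k A s"
  using assms ivars_run[of _ c thin red s] arrays_run[of _ c thin red s] by (simp add: ready_def)

lemma neg1_power_mod2: "(- 1 :: real) ^ a = (if a mod 2 < 1 then 1 else - 1)"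
  by (cases "even a") (auto simp: odd_iff_mod_2_eq_one)

lemma run_cof_prog:
  assumes s: "ready n m k A s" and K: "ivars s 9 = set_encode K" "K \<subseteq> {..<n}"
    and L: "ivars s 10 = set_encode L" "L \<subseteq> {..<m}"
    and xy: "x < 21" "y < 21" and c: "card (K - {ivars s x}) = k" "card (L - {ivars s y}) = k"
  shows "arrays (exec thin red (cof_prog x y) s) 4 0 0 = cof A K (ivars s x) L (ivars s y)"
    and "cost (exec thin red (cof_prog x y) s) \<le> cost s + 1"
proof -
  have fin: "finite K" "finite L" using K L finite_subset by auto
  let ?K = "K - {ivars s x}" and ?L = "L - {ivars s y}"
  let ?t = "set_ivar 22 (set_encode ?L) (set_ivar 21 (set_encode ?K) s)"
  have t1: "exec thin red (IAssign 21 (iremove 9 x)) s = set_ivar 21 (set_encode ?K) s"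
    using ival_iremove[OF fin(1), of "ivars s" 9 x] K by simp
  have t2: "exec thin red (IAssign 22 (iremove 10 y)) (set_ivar 21 (set_encode ?K) s) = ?t"
    using ival_iremove[OF fin(2), of "ivars (set_ivar 21 (set_encode ?K) s)" 10 y] L xy by simp
  have sub: "?K \<subseteq> {..<n}" "?L \<subseteq> {..<m}" using K L by auto
  have i: "ivars s 0 = n" "ivars s 1 = m" using s by (auto simp: ready_def)
  have r1: "ival (irank 0 21) (ivars ?t) = lex_rank n ?K"
    by (rule ival_irank[OF sub(1)]) (use i in auto)
  have r2: "ival (irank 1 22) (ivars ?t) = lex_rank m ?L"
    by (rule ival_irank[OF sub(2)]) (use i in auto)
  have p: "ival (icount 9 (IVar x)) (ivars ?t) = pos K (ivars s x)"
    "ival (icount 10 (IVar y)) (ivars ?t) = pos L (ivars s y)"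
    using ival_icount[OF fin(1), of "ivars ?t" 9 "IVar x"] ival_icount[OF fin(2), of "ivars ?t" 10 "IVar y"] K L xy
    by auto
  have g: "get (Ref 0 (irank 0 21) (irank 1 22)) ?t = minor A ?K ?L"
    unfolding get.simps r1 r2 using s sub c by (simp add: ready_def)
  have z: "get (cell 5) ?t = 0" using s by (simp add: cell_def ready_def)
  let ?c = "(pos K (ivars s x) + pos L (ivars s y)) mod 2 < 1"
  have "exec thin red (cof_prog x y) s = (if ?c then put (cell 4) (minor A ?K ?L) ?t
      else charge 1 (put (cell 4) (- minor A ?K ?L) ?t))"
    unfolding cof_prog_def exec.simps(2) t1 t2
    unfolding exec.simps ival.simps p g z by simp
  then show "arrays (exec thin red (cof_prog x y) s) 4 0 0 = cof A K (ivars s x) L (ivars s y)"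
    and "cost (exec thin red (cof_prog x y) s) \<le> cost s + 1"
    by (auto simp: cell_def arrays_put cof_def neg1_power_mod2)
qed

text \<open>Writing \<open>(ivars s)(20 := t)\<close> for the values in round \<open>t\<close>
  covers expansions along rows and along columns at once. The factor 3 counts the sign, the product
  and the accumulation.\<close>

lemma run_dot_prog:
  assumes s: "ready n m k A s" and K: "ivars s 9 = set_encode K" "K \<subseteq> {..<n}"
    and L: "ivars s 10 = set_encode L" "L \<subseteq> {..<m}"
    and v: "x < 21" "y < 21" "p < 21" "q < 21" "M < 20"
    and b: "ivars s b = N" and W: "ivars s M = set_encode W" "W \<subseteq> {..<N}"
    and c: "\<And>t. t \<in> W \<Longrightarrow> card (K - {((ivars s)(20 := t)) x}) = k"
      "\<And>t. t \<in> W \<Longrightarrow> card (L - {((ivars s)(20 := t)) y}) = k"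
    and f: "f = Add \<and> \<sigma> = 1 \<or> f = Sub \<and> \<sigma> = - 1"
  shows "arrays (exec thin red (dot_prog f b M p q x y) s) 3 0 0 = arrays s 3 0 0 + \<sigma> *
      (\<Sum>t\<in>W. arrays s 1 (((ivars s)(20 := t)) p) (((ivars s)(20 := t)) q) *
        cof A K (((ivars s)(20 := t)) x) L (((ivars s)(20 := t)) y))"
    and "cost (exec thin red (dot_prog f b M p q x y) s) \<le> cost s + 3 * N"
proof -
  have finW: "finite W" using W finite_subset by auto
  define h where "h t = arrays s 1 (((ivars s)(20 := t)) p) (((ivars s)(20 := t)) q) *
        cof A K (((ivars s)(20 := t)) x) L (((ivars s)(20 := t)) y)" for t
  define I where "I i s' \<longleftrightarrow> (\<forall>z<20. ivars s' z = ivars s z) \<and> (\<forall>a. a \<notin> {3, 4} \<longrightarrow> arrays s' a = arrays s a) \<and>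
    arrays s' 3 0 0 = arrays s 3 0 0 + \<sigma> * (\<Sum>t\<in>{t \<in> W. t < i}. h t) \<and> cost s' \<le> cost s + 3 * i" for i and s' :: state
  let ?body = "IfILess (INum 0) (imem (IVar M) (IVar 20))
     (Seq (cof_prog x y) (Seq (Op Mul (cell 4) (cell 4) (Ref 1 (IVar p) (IVar q)))
       (Op f (cell 3) (cell 3) (cell 4)))) Skip"
  have "I N (exec thin red (dot_prog f b M p q x y) s)"
    unfolding dot_prog_def exec.simps(4) ival.simps b
  proof (rule fold_invariant[where P = I])
    show "I 0 s" by (simp add: I_def)
    fix i s' assume i: "i < N" and I: "I i s'"
    let ?s = "set_ivar 20 i s'"
    have e: "ivars ?s z = ((ivars s)(20 := i)) z" if "z < 21" for z
      using I that by (auto simp: I_def less_Suc_eq)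
    have mem: "ival (imem (IVar M) (IVar 20)) (ivars ?s) = of_bool (i \<in> W)"
      using ival_imem[OF finW, of "IVar M" "ivars ?s"] W v I by (simp add: I_def)
    show "I (Suc i) (exec thin red ?body ?s)"
    proof (cases "i \<in> W")
      case False
      then have "{t \<in> W. t < Suc i} = {t \<in> W. t < i}" by (auto simp: less_Suc_eq)
      moreover have "exec thin red ?body ?s = ?s" using False mem by simp
      ultimately show ?thesis using I by (auto simp: I_def)
    next
      case True
      then have W': "{t \<in> W. t < Suc i} = insert i {t \<in> W. t < i}" by auto
      let ?u = "exec thin red (cof_prog x y) ?s"
      have r: "ready n m k A ?s"
        using s ready_cong[of ?s s] I by (simp add: I_def)
      have e9: "ivars ?s 9 = set_encode K" "ivars ?s 10 = set_encode L"
        using e[of 9] e[of 10] K L by simp_all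
      have cc: "card (K - {ivars ?s x}) = k" "card (L - {ivars ?s y}) = k"
        using c True v e by auto
      note cp = run_cof_prog[OF r e9(1) K(2) e9(2) L(2) v(1,2) cc, of thin red]
      have uv: "ivars ?u z = ivars ?s z" if "z < 21" for z
        using ivars_run[of z "cof_prog x y"] that by simp
      have ua: "arrays ?u a = arrays s' a" if "a \<noteq> 4" for a
        using arrays_run[of a "cof_prog x y"] that by simp
      have u1: "arrays ?u 1 (ivars ?u p) (ivars ?u q) * arrays ?u 4 0 0 = h i"
        using cp(1) uv v e I ua[of 1] by (simp add: h_def I_def)
      let ?r = "exec thin red ?body ?s"
      have r_eq: "?r = charge 1 (put (cell 3) (aval f (arrays s' 3 0 0) (h i)) (charge 1 (put (cell 4) (h i) ?u)))"
        using mem True u1 ua[of 3] by (simp add: cell_def arrays_put mult.commute)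
      have "aval f (arrays s' 3 0 0) (h i) = arrays s 3 0 0 + \<sigma> * (\<Sum>t\<in>{t \<in> W. t < Suc i}. h t)"
        unfolding W' using I f finW by (auto simp: I_def algebra_simps)
      then have "arrays ?r 3 0 0 = arrays s 3 0 0 + \<sigma> * (\<Sum>t\<in>{t \<in> W. t < Suc i}. h t)"
        unfolding r_eq by (simp add: cell_def arrays_put)
      moreover have "\<forall>a. a \<notin> {3, 4} \<longrightarrow> arrays ?r a = arrays s a"
        using I ua unfolding r_eq by (auto simp: I_def arrays_put_other cell_def)
      moreover have "\<forall>z<20. ivars ?r z = ivars s z"
        using uv e unfolding r_eq by simp
      moreover have "cost ?r \<le> cost s + 3 * Suc i"
        using cp(2) I unfolding r_eq by (simp add: I_def)
      ultimately show ?thesis unfolding I_def by blast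
    qed
  qed
  moreover have "{t \<in> W. t < N} = W" using W by auto
  ultimately show "arrays (exec thin red (dot_prog f b M p q x y) s) 3 0 0 = arrays s 3 0 0 + \<sigma> *
      (\<Sum>t\<in>W. arrays s 1 (((ivars s)(20 := t)) p) (((ivars s)(20 := t)) q) *
        cof A K (((ivars s)(20 := t)) x) L (((ivars s)(20 := t)) y))"
    and "cost (exec thin red (dot_prog f b M p q x y) s) \<le> cost s + 3 * N"
    by (simp_all add: I_def h_def)
qed

section \<open>Completing a known block\<close>

text \<open>Variables 11 and 12 receive \<open>i\<close> and \<open>j\<close>, or an index outside
  the matrix if \<open>i\<close> is in \<open>S\<close> or \<open>j\<close> is in \<open>D\<close>;
  so the final cofactor is the pivot in all three cases. The entry is first set to 0 so that it
  contributes nothing to the sums over the enlarged index sets.\<close>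

definition step_prog :: prog where
  "step_prog = Seq (IAssign 9 (iinsert 3 7)) (Seq (IAssign 10 (iinsert 4 8))
    (Seq (IAssign 11 (IAdd (IMul (imem (IVar 3) (IVar 7)) (IVar 0)) (IMul (inot (imem (IVar 3) (IVar 7))) (IVar 7))))
    (Seq (IAssign 12 (IAdd (IMul (imem (IVar 4) (IVar 8)) (IVar 1)) (IMul (inot (imem (IVar 4) (IVar 8))) (IVar 8))))
    (Seq (Literal (Ref 1 (IVar 7) (IVar 8)) 0) (Seq (Literal (cell 3) 0)
    (Seq (IfILess (INum 0) (imem (IVar 4) (IVar 8))
        (dot_prog Sub 0 9 20 8 20 12)
        (Seq (IfILess (INum 0) (imem (IVar 3) (IVar 7)) Skip (dot_prog Add 1 10 13 20 13 20))
          (dot_prog Sub 1 10 7 20 11 20)))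
    (Seq (cof_prog 11 12) (Op Div (Ref 1 (IVar 7) (IVar 8)) (cell 3) (cell 4)))))))))"

lemma writes_step_prog [simp]: "wvars step_prog = {9, 10, 11, 12, 20, 21, 22}"
  "warrays step_prog = {1, 3, 4}"
  by (auto simp: step_prog_def cell_def)

text \<open>The number of memberships \<open>i \<in> S\<close>, \<open>j \<in> D\<close> is 1 for the entries solved first, and 0 for the rest.\<close>

definition phase_prog :: "nat \<Rightarrow> prog" where
  "phase_prog q = For 7 (IVar 0) (For 8 (IVar 1)
    (IfILess (INum 0) (ieq (IAdd (imem (IVar 3) (IVar 7)) (imem (IVar 4) (IVar 8))) (INum q)) step_prog Skip))"

text \<open>\<open>n + (m - n)\<close> with truncated subtraction is the maximum. If
  \<open>k\<close> equals it, the block is the whole matrix. This case is split off because the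
  count in \<open>run_phase\<close> charges every entry, in total up to a multiple of
  \<open>p ^ 3\<close>, while the full-rank bound is then only a multiple of
  \<open>p ^ 2\<close>.\<close>

definition complete_prog :: prog where
  "complete_prog = IfILess (IVar 2) (IAdd (IVar 0) (ISub (IVar 1) (IVar 0)))
    (Seq (IAssign 14 (INum 0)) (Seq (IAssign 13 (ipick (IVar 0) 3 14)) (Seq (phase_prog 1) (phase_prog 0)))) Skip"

lemma writes_phase_prog [simp]: "wvars (phase_prog q) = {7, 8, 9, 10, 11, 12, 20, 21, 22}"
  "warrays (phase_prog q) = {1, 3, 4}"
  by (auto simp: phase_prog_def)

lemma writes_complete_prog [simp]: "wvars complete_prog = {7, 8, 9, 10, 11, 12, 13, 14, 20, 21, 22}"
  "warrays complete_prog = {1, 3, 4}"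
  by (auto simp: complete_prog_def)

definition knows :: "real mat \<Rightarrow> (nat \<times> nat) set \<Rightarrow> state \<Rightarrow> bool" where
  "knows A Z s \<longleftrightarrow> (\<forall>(i, j)\<in>Z. arrays s 1 i j = A $$ (i, j))"

context
  fixes thin red :: svd_routine and A :: "real mat" and n m k :: nat and S D :: "nat set"
  assumes A: "A \<in> carrier_mat n m" and S: "S \<subseteq> {..<n}" and D: "D \<subseteq> {..<m}"
    and cS: "card S = k" and cD: "card D = k" and nz: "minor A S D \<noteq> 0"
begin

text \<open>The premises \<open>known\<close> name the entries that the applicable formula reads.
  The cost is that of at most two sums at 3 per index, the sign of the pivot and the
  division.\<close>

lemma run_step_prog:
  assumes s: "ready n m k A s" "ivars s 3 = set_encode S" "ivars s 4 = set_encode D"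
    and ij: "ivars s 7 = i" "ivars s 8 = j" "i < n" "j < m" "i \<notin> S \<or> j \<notin> D" and a: "ivars s 13 \<in> S"
    and known: "j \<in> D \<Longrightarrow> knows A (S \<times> {j}) s" "j \<notin> D \<Longrightarrow> knows A ({i} \<times> D) s"
      "i \<notin> S \<Longrightarrow> j \<notin> D \<Longrightarrow> knows A ({ivars s 13} \<times> insert j D) s"
  shows "arrays (exec thin red step_prog s) 1 = (\<lambda>x y. if x = i \<and> y = j then A $$ (i, j) else arrays s 1 x y)"
    and "cost (exec thin red step_prog s) \<le> cost s + (6 * max n m + 2)"
proof -
  let ?run = "exec thin red"
  note fin = finite_subset[OF S finite_lessThan] finite_subset[OF D finite_lessThan]
  define K where "K = insert i S"
  define L where "L = insert j D"
  define u where "u = (if i \<in> S then n else i)"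
  define v where "v = (if j \<in> D then m else j)"
  define t where "t = put (cell 3) 0 (put (Ref 1 (IVar 7) (IVar 8)) 0
    (set_ivar 12 v (set_ivar 11 u (set_ivar 10 (set_encode L) (set_ivar 9 (set_encode K) s)))))"
  define mid where "mid = IfILess (INum 0) (imem (IVar 4) (IVar 8))
        (dot_prog Sub 0 9 20 8 20 12)
        (Seq (IfILess (INum 0) (imem (IVar 3) (IVar 7)) Skip (dot_prog Add 1 10 13 20 13 20))
          (dot_prog Sub 1 10 7 20 11 20))"
  have i0: "ivars s 0 = n" "ivars s 1 = m" using s by (auto simp: ready_def)
  have mem: "ival (imem (IVar 3) (IVar 7)) x = of_bool (i \<in> S)" "ival (imem (IVar 4) (IVar 8)) x = of_bool (j \<in> D)"
    if "x 3 = set_encode S" "x 4 = set_encode D" "x 7 = i" "x 8 = j" for x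
    using ival_imem[OF fin(1), of "IVar 3" x "IVar 7"] ival_imem[OF fin(2), of "IVar 4" x "IVar 8"] that by auto
  have run_eq: "?run step_prog s = ?run (Seq (cof_prog 11 12) (Op Div (Ref 1 (IVar 7) (IVar 8)) (cell 3) (cell 4))) (?run mid t)"
  proof -
    have 1: "ival (iinsert 3 7) (ivars s) = set_encode K"
      unfolding K_def using ival_iinsert[OF fin(1), of "ivars s" 3 7] s ij by simp
    have 2: "ival (iinsert 4 8) (ivars (set_ivar 9 (set_encode K) s)) = set_encode L"
      unfolding L_def using ival_iinsert[OF fin(2), of "ivars (set_ivar 9 (set_encode K) s)" 4 8] s ij by simp
    show ?thesis
      unfolding step_prog_def mid_def[symmetric] exec.simps(2,3,7) 1 2 t_def
      using s ij i0 by (simp add: mem u_def v_def)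
  qed
  have tv: "ivars t z = (if z = 9 then set_encode K else if z = 10 then set_encode L
      else if z = 11 then u else if z = 12 then v else ivars s z)" for z
    by (simp add: t_def)
  have ta: "arrays t 1 = (\<lambda>x y. if x = i \<and> y = j then 0 else arrays s 1 x y)" "arrays t 3 0 0 = 0"
    "\<And>b. b \<notin> {1, 3} \<Longrightarrow> arrays t b = arrays s b" "cost t = cost s"
    using ij by (auto simp: t_def cell_def arrays_put arrays_put_other fun_eq_iff)
  have tr: "ready n m k A t"
    using s(1) ready_cong[of t s] tv ta(3) by simp
  have K: "K \<subseteq> {..<n}" and L: "L \<subseteq> {..<m}" using S D ij by (auto simp: K_def L_def)
  have cK: "card (K - {x}) = k" if "i \<notin> S" "x \<in> K" for x
    using that fin cS by (simp add: K_def card_Diff_singleton)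
  have cL: "card (L - {x}) = k" if "j \<notin> D" "x \<in> L" for x
    using that fin cD by (simp add: L_def card_Diff_singleton)
  have Dm: "D - {m} = D" and Sn: "S - {n} = S" using S D by auto
  have cu: "card (K - {u}) = k"
    using cK[of i] Sn cS by (auto simp: u_def K_def insert_absorb)
  have cv: "card (L - {v}) = k"
    using cL[of j] Dm cD by (auto simp: v_def L_def insert_absorb)
  \<comment> \<open>The numerator in \<open>entry_column\<close>, \<open>entry_row\<close> or
    \<open>entry_corner\<close>, according to the case.\<close>
  define w where "w = (if j \<in> D then - (\<Sum>x\<in>S. A $$ (x, j) * cof A K x L v)
     else (if i \<in> S then 0 else (\<Sum>c\<in>L. A $$ (ivars s 13, c) * cof A K (ivars s 13) L c))
       - (\<Sum>c\<in>D. A $$ (i, c) * cof A K u L c))"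
  have entry: "A $$ (i, j) = w / cof A K u L v"
  proof (cases "j \<in> D")
    case True
    then have F: "i \<notin> S" using ij by simp
    show ?thesis
      using entry_column[OF A S D cS cD nz ij(3) F True] True F
      by (simp add: w_def K_def L_def u_def v_def insert_absorb)
  next
    case F: False
    show ?thesis
    proof (cases "i \<in> S")
      case True
      show ?thesis
        using entry_row[OF A S D cS cD nz True ij(4) F] True F
        by (simp add: w_def K_def L_def u_def v_def insert_absorb)
    next
      case False
      show ?thesis
        using entry_corner[OF A S D cS cD nz ij(3) False ij(4) F a] F False
        by (simp add: w_def K_def L_def u_def v_def)
    qed
  qed
  have mid: "arrays (?run mid t) 3 0 0 = w \<and> cost (?run mid t) \<le> cost s + 6 * max n m"
  proof (cases "j \<in> D")
    case True
    then have F: "i \<notin> S" using ij by simp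
    then have i: "i \<notin> S" "K = insert i S" "L = D" "v = m" using True by (auto simp: K_def L_def v_def insert_absorb)
    have "?run mid t = ?run (dot_prog Sub 0 9 20 8 20 12) t"
      unfolding mid_def using mem(2)[of "ivars t"] tv s ij True by simp
    note dp = run_dot_prog[OF tr, of K L 20 12 20 8 9 0 n K Sub "- 1" thin red]
    have *: "arrays (?run (dot_prog Sub 0 9 20 8 20 12) t) 3 0 0 = - (\<Sum>x\<in>K. arrays t 1 x j * cof A K x L v)"
      "cost (?run (dot_prog Sub 0 9 20 8 20 12) t) \<le> cost t + 3 * n"
      using dp tv K L i0 cK[OF F] cv ij ta(2) by simp_all
    \<comment> \<open>The summand for \<open>i\<close> is 0 since the entry at \<open>(i, j)\<close>
      has been cleared.\<close>
    have "(\<Sum>x\<in>K. arrays t 1 x j * cof A K x L v) = (\<Sum>x\<in>S. arrays t 1 x j * cof A K x L v)"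
      unfolding i(2) using F fin ta(1) by simp
    also have "\<dots> = (\<Sum>x\<in>S. A $$ (x, j) * cof A K x L v)"
      by (rule sum.cong) (use known(1)[OF True] F ta(1) in \<open>auto simp: knows_def\<close>)
    finally show ?thesis
      using * \<open>?run mid t = _\<close> True ta(4) by (simp add: w_def)
  next
    case F: False
    define t1 where "t1 = (if i \<in> S then t else ?run (dot_prog Add 1 10 13 20 13 20) t)"
    have mid_eq: "?run mid t = ?run (dot_prog Sub 1 10 7 20 11 20) t1"
      unfolding mid_def t1_def using mem[of "ivars t"] tv s ij F by simp
    have t1v: "ivars t1 z = ivars t z" if "z < 20" for z
      using that ivars_run[of z "dot_prog Add 1 10 13 20 13 20" thin red t] by (auto simp: t1_def)
    have t1a: "arrays t1 b = arrays t b" if "b \<noteq> 3" "b \<noteq> 4" for b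
      using that arrays_run[of b "dot_prog Add 1 10 13 20 13 20" thin red t] by (auto simp: t1_def)
    have t1r: "ready n m k A t1"
      using tr ready_cong[of t1 t] t1v t1a by simp
    have t1: "arrays t1 3 0 0 = (if i \<in> S then 0 else (\<Sum>c\<in>L. A $$ (ivars s 13, c) * cof A K (ivars s 13) L c))
      \<and> cost t1 \<le> cost s + 3 * m"
    proof (cases "i \<in> S")
      case True
      then show ?thesis using ta by (simp add: t1_def)
    next
      case False
      note dp = run_dot_prog[OF tr, of K L 13 20 13 20 10 1 m L Add 1 thin red]
      have *: "arrays (?run (dot_prog Add 1 10 13 20 13 20) t) 3 0 0 =
          (\<Sum>c\<in>L. arrays t 1 (ivars s 13) c * cof A K (ivars s 13) L c)"
        "cost (?run (dot_prog Add 1 10 13 20 13 20) t) \<le> cost t + 3 * m"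
        using dp tv K L i0 cL[OF F] cK[OF False, of "ivars s 13"] a ij ta(2) by (simp_all add: K_def)
      have "(\<Sum>c\<in>L. arrays t 1 (ivars s 13) c * cof A K (ivars s 13) L c) =
          (\<Sum>c\<in>L. A $$ (ivars s 13, c) * cof A K (ivars s 13) L c)"
        by (rule sum.cong) (use known(3)[OF False F] a False ta(1) in \<open>auto simp: knows_def L_def\<close>)
      then show ?thesis using * False ta(4) by (simp add: t1_def)
    qed
    note dp = run_dot_prog[OF t1r, of K L 11 20 7 20 10 1 m L Sub "- 1" thin red]
    have *: "arrays (?run (dot_prog Sub 1 10 7 20 11 20) t1) 3 0 0 =
        arrays t1 3 0 0 - (\<Sum>c\<in>L. arrays t 1 i c * cof A K u L c)"
      "cost (?run (dot_prog Sub 1 10 7 20 11 20) t1) \<le> cost t1 + 3 * m"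
      using dp tv t1v t1a K L i0 cL[OF F] cu ij by simp_all
    have "(\<Sum>c\<in>L. arrays t 1 i c * cof A K u L c) = (\<Sum>c\<in>D. arrays t 1 i c * cof A K u L c)"
      unfolding L_def using F fin ta(1) by simp
    also have "\<dots> = (\<Sum>c\<in>D. A $$ (i, c) * cof A K u L c)"
      by (rule sum.cong) (use known(2)[OF F] F ta(1) in \<open>auto simp: knows_def\<close>)
    finally have "arrays (?run mid t) 3 0 0 = w"
      using * mid_eq t1 F by (simp add: w_def)
    moreover have "cost (?run mid t) \<le> cost s + 6 * max n m"
      unfolding mid_eq using *(2) conjunct2[OF t1] max.cobounded2[of m n] by linarith
    ultimately show ?thesis by blast
  qed
  define t2 where "t2 = ?run mid t"
  have wm: "wvars mid = {20, 21, 22}" "warrays mid = {3, 4}" by (auto simp: mid_def)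
  have t2v: "ivars t2 z = ivars t z" if "z < 20" for z
    using that ivars_run[of z mid thin red t] by (auto simp: t2_def wm)
  have t2a: "arrays t2 b = arrays t b" if "b \<noteq> 3" "b \<noteq> 4" for b
    using that arrays_run[of b mid thin red t] by (auto simp: t2_def wm)
  have t2r: "ready n m k A t2"
    using tr ready_cong[of t2 t] t2v t2a by simp
  note cp = run_cof_prog[OF t2r, of K L 11 12 thin red]
  have c: "arrays (?run (cof_prog 11 12) t2) 4 0 0 = cof A K u L v"
    "cost (?run (cof_prog 11 12) t2) \<le> cost t2 + 1"
    using cp t2v tv K L cu cv by simp_all
  let ?t3 = "?run (cof_prog 11 12) t2"
  have t3v: "ivars ?t3 z = ivars t2 z" if "z < 20" for z
    using that ivars_run[of z "cof_prog 11 12" thin red t2] by auto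
  have t3a: "arrays ?t3 b = arrays t2 b" if "b \<noteq> 4" for b
    using that arrays_run[of b "cof_prog 11 12" thin red t2] by auto
  have fin_eq: "?run step_prog s = charge 1 (put (Ref 1 (IVar 7) (IVar 8)) (A $$ (i, j)) ?t3)"
    unfolding run_eq t2_def[symmetric] using c t3a[of 3] mid entry by (simp add: cell_def t2_def)
  show "arrays (?run step_prog s) 1 = (\<lambda>x y. if x = i \<and> y = j then A $$ (i, j) else arrays s 1 x y)"
    unfolding fin_eq using t3v t2v tv t3a t2a ta(1) ij by (auto simp: arrays_put fun_eq_iff)
  show "cost (?run step_prog s) \<le> cost s + (6 * max n m + 2)"
    unfolding fin_eq using c mid by (simp add: t2_def)
qed

text \<open>By \<open>need\<close>, the formulas of one phase read only entries in \<open>Z\<close>,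
  which are known before it starts; hence the entries of a phase may be computed in any
  order.\<close>

lemma run_phase:
  assumes s: "ready n m k A s" "ivars s 3 = set_encode S" "ivars s 4 = set_encode D" "ivars s 13 = a" "a \<in> S"
    and z: "knows A Z s"
    and need: "\<And>i j. i < n \<Longrightarrow> j < m \<Longrightarrow> of_bool (i \<in> S) + of_bool (j \<in> D) = q \<Longrightarrow>
      (i \<notin> S \<or> j \<notin> D) \<and> (j \<in> D \<longrightarrow> S \<times> {j} \<subseteq> Z) \<and> (j \<notin> D \<longrightarrow> {i} \<times> D \<subseteq> Z) \<and>
      (i \<notin> S \<longrightarrow> j \<notin> D \<longrightarrow> {a} \<times> insert j D \<subseteq> Z)"
  shows "knows A (Z \<union> {(i, j). i < n \<and> j < m \<and> of_bool (i \<in> S) + of_bool (j \<in> D) = q})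
      (exec thin red (phase_prog q) s)"
    and "cost (exec thin red (phase_prog q) s) \<le> cost s + n * m * (6 * max n m + 2)"
proof -
  note fin = finite_subset[OF S finite_lessThan] finite_subset[OF D finite_lessThan]
  let ?c = "\<lambda>i j. of_bool (i \<in> S) + of_bool (j \<in> D) = q"
  define P where "P X s' \<longleftrightarrow> ready n m k A s' \<and> ivars s' 3 = set_encode S \<and> ivars s' 4 = set_encode D \<and>
    ivars s' 13 = a \<and> knows A (Z \<union> {(i, j) \<in> X. ?c i j}) s'" for X s'
  let ?body = "IfILess (INum 0) (ieq (IAdd (imem (IVar 3) (IVar 7)) (imem (IVar 4) (IVar 8))) (INum q)) step_prog Skip"
  have step: "P (insert (i, j) X) (exec thin red ?body s') \<and>
      cost (exec thin red ?body s') \<le> cost s' + (6 * max n m + 2)"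
    if P: "P X s'" and ij: "i < n" "j < m" "ivars s' 7 = i" "ivars s' 8 = j" for X s' i j
  proof -
    have mem: "ival (imem (IVar 3) (IVar 7)) (ivars s') = of_bool (i \<in> S)"
      "ival (imem (IVar 4) (IVar 8)) (ivars s') = of_bool (j \<in> D)"
      using ival_imem[OF fin(1), of "IVar 3" "ivars s'" "IVar 7"] ij P
        ival_imem[OF fin(2), of "IVar 4" "ivars s'" "IVar 8"] by (auto simp: P_def)
    show ?thesis
    proof (cases "?c i j")
      case False
      then have "exec thin red ?body s' = s'" using mem by simp
      moreover have "{(i', j') \<in> insert (i, j) X. ?c i' j'} = {(i, j) \<in> X. ?c i j}" using False by auto
      ultimately show ?thesis using P unfolding P_def by simp
    next
      case True
      have body: "exec thin red ?body s' = exec thin red step_prog s'" using True mem by simp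
      note need' = need[OF ij(1,2) True]
      have sub: "knows A Y s'" if "Y \<subseteq> Z" for Y
        using P that by (auto simp: P_def knows_def)
      have p: "ready n m k A s'" "ivars s' 3 = set_encode S" "ivars s' 4 = set_encode D" "ivars s' 13 \<in> S"
        "ivars s' 13 = a"
        using P s(5) by (auto simp: P_def)
      have k1: "j \<in> D \<Longrightarrow> knows A (S \<times> {j}) s'" using need' sub by blast
      have k2: "j \<notin> D \<Longrightarrow> knows A ({i} \<times> D) s'" using need' sub by blast
      have k3: "i \<notin> S \<Longrightarrow> j \<notin> D \<Longrightarrow> knows A ({ivars s' 13} \<times> insert j D) s'"
        using need' sub p(5) by blast
      have 1: "arrays (exec thin red step_prog s') 1 =
          (\<lambda>x y. if x = i \<and> y = j then A $$ (i, j) else arrays s' 1 x y)"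
        "cost (exec thin red step_prog s') \<le> cost s' + (6 * max n m + 2)"
        using run_step_prog[OF p(1-3) ij(3,4,1,2) conjunct1[OF need'] p(4)] k1 k2 k3 by blast+
      have 2: "ready n m k A (exec thin red step_prog s')"
        using P ready_run[of step_prog n m k A thin red s'] by (simp add: P_def)
      have 3: "ivars (exec thin red step_prog s') x = ivars s' x" if "x \<notin> {9, 10, 11, 12, 20, 21, 22}" for x
        using ivars_run[of x step_prog thin red s'] that by simp
      have 4: "arrays (exec thin red step_prog s') 1 x y = A $$ (x, y)"
        if "(x, y) = (i, j) \<or> arrays s' 1 x y = A $$ (x, y)" for x y
        unfolding 1(1) using that by auto
      have "knows A (Z \<union> {(i', j') \<in> insert (i, j) X. ?c i' j'}) (exec thin red step_prog s')"
        unfolding knows_def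
      proof (intro ballI, unfold split_paired_all prod.case)
        fix x y assume "(x, y) \<in> Z \<union> {(i', j') \<in> insert (i, j) X. ?c i' j'}"
        then have "(x, y) = (i, j) \<or> (x, y) \<in> Z \<union> {(i, j) \<in> X. ?c i j}" by blast
        then have "(x, y) = (i, j) \<or> arrays s' 1 x y = A $$ (x, y)"
          using P unfolding P_def knows_def by blast
        then show "arrays (exec thin red step_prog s') 1 x y = A $$ (x, y)" by (rule 4)
      qed
      then show ?thesis using P 1(2) 2 3 unfolding body P_def by simp
    qed
  qed
  have vars: "P X (set_ivar 7 i s')" "P X (set_ivar 8 i s')" if "P X s'" for X s' i
    using that by (auto simp: P_def knows_def)
  have bnd: "ival (IVar 0) (ivars s') = n" "ival (IVar 1) (ivars s') = m" if "P X s'" for X s'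
    using that by (auto simp: P_def ready_def)
  have "P {} s" using s z by (simp add: P_def)
  note g = run_grid[where P = P and u = 7 and v = 8 and c = ?body and e = "IVar 0" and N = n and f = "IVar 1"
    and M = m and t = "\<lambda>_ _. 6 * max n m + 2" and thin = thin and red = red, OF this]
  have "P ({..<n} \<times> {..<m}) (exec thin red (phase_prog q) s)"
    unfolding phase_prog_def
    by (rule g(1), simp, simp, erule bnd(1), erule bnd(2), erule vars(1), erule vars(2), rule step; assumption)
  moreover have "{(i, j) \<in> {..<n} \<times> {..<m}. ?c i j} = {(i, j). i < n \<and> j < m \<and> ?c i j}" by auto
  ultimately show "knows A (Z \<union> {(i, j). i < n \<and> j < m \<and> ?c i j}) (exec thin red (phase_prog q) s)"
    by (simp only: P_def)
  have "cost (exec thin red (phase_prog q) s) \<le> cost s + (\<Sum>i<n. \<Sum>j<m. 6 * max n m + 2)"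
    unfolding phase_prog_def
    by (rule g(2), simp, simp, erule bnd(1), erule bnd(2), erule vars(1), erule vars(2), rule step; assumption)
  then show "cost (exec thin red (phase_prog q) s) \<le> cost s + n * m * (6 * max n m + 2)"
    by (simp add: algebra_simps)
qed

lemma run_complete_prog:
  assumes s: "ready n m k A s" "ivars s 3 = set_encode S" "ivars s 4 = set_encode D"
    and base: "knows A (S \<times> D) s" and k: "1 \<le> k"
  shows "knows A ({..<n} \<times> {..<m}) (exec thin red complete_prog s)"
    and "cost (exec thin red complete_prog s) \<le> cost s +
      (if k < max n m then 2 * (n * m * (6 * max n m + 2)) else 0)"
proof -
  let ?run = "exec thin red"
  let ?p = "ival (IAdd (IVar 0) (ISub (IVar 1) (IVar 0))) (ivars s)"
  have p: "?p = max n m" "ivars s 2 = k" using s by (auto simp: ready_def)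
  have "knows A ({..<n} \<times> {..<m}) (?run complete_prog s) \<and> cost (?run complete_prog s) \<le> cost s +
      (if k < max n m then 2 * (n * m * (6 * max n m + 2)) else 0)"
  proof (cases "k < max n m")
    case False
    \<comment> \<open>Here \<open>k\<close> is at least both dimensions, so \<open>S\<close> and
      \<open>D\<close> are all rows and all columns.\<close>
    have "card S \<le> n" "card D \<le> m" using card_mono[OF _ S] card_mono[OF _ D] by auto
    then have "card S = card {..<n}" "card D = card {..<m}" using False cS cD by auto
    then have "S = {..<n}" "D = {..<m}" using card_subset_eq[OF _ S] card_subset_eq[OF _ D] by auto
    then show ?thesis using base False p by (simp add: complete_prog_def)
  next
    case True
    define a where "a = pick S 0"
    have a: "a \<in> S" unfolding a_def by (rule pick_in) (use cS k in simp)
    let ?s = "set_ivar 13 a (set_ivar 14 0 s)"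
    have "ival (ipick (IVar 0) 3 14) (ivars (set_ivar 14 0 s)) = a"
      unfolding a_def using ival_ipick[OF S, of "ivars (set_ivar 14 0 s)" 3 "IVar 0" 14] s cS k
      by (simp add: ready_def)
    then have eq: "?run complete_prog s = ?run (phase_prog 0) (?run (phase_prog 1) ?s)"
      using True p by (simp add: complete_prog_def)
    let ?t = "?run (phase_prog 1) ?s"
    let ?Z = "S \<times> D \<union> {(i, j). i < n \<and> j < m \<and> of_bool (i \<in> S) + of_bool (j \<in> D) = (1 :: nat)}"
    have s': "ready n m k A ?s" "ivars ?s 3 = set_encode S" "ivars ?s 4 = set_encode D" "ivars ?s 13 = a"
      "knows A (S \<times> D) ?s"
      using s base by (simp_all add: knows_def)
    \<comment> \<open>With exactly one membership, the formula reads nothing outside the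
      block.\<close>
    have need1: "(i \<notin> S \<or> j \<notin> D) \<and> (j \<in> D \<longrightarrow> S \<times> {j} \<subseteq> S \<times> D) \<and> (j \<notin> D \<longrightarrow> {i} \<times> D \<subseteq> S \<times> D) \<and>
      (i \<notin> S \<longrightarrow> j \<notin> D \<longrightarrow> {a} \<times> insert j D \<subseteq> S \<times> D)"
      if "i < n" "j < m" "of_bool (i \<in> S) + of_bool (j \<in> D) = (1 :: nat)" for i j
      using that by (cases "i \<in> S"; cases "j \<in> D") auto
    have 1: "knows A ?Z ?t" "cost ?t \<le> cost ?s + n * m * (6 * max n m + 2)"
      by (rule run_phase[OF s'(1-4) a s'(5) need1]; assumption)+
    have t: "ready n m k A ?t" "ivars ?t 3 = set_encode S" "ivars ?t 4 = set_encode D" "ivars ?t 13 = a"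
      using s ready_run[of "phase_prog 1" n m k A thin red ?s] ivars_run[of _ "phase_prog 1" thin red ?s] by auto
    \<comment> \<open>An entry with no membership uses the row \<open>a\<close> and the columns in
      \<open>D\<close>, which the block and the preceding phase supply.\<close>
    have need: "(i \<notin> S \<or> j \<notin> D) \<and> (j \<in> D \<longrightarrow> S \<times> {j} \<subseteq> ?Z) \<and> (j \<notin> D \<longrightarrow> {i} \<times> D \<subseteq> ?Z) \<and>
      (i \<notin> S \<longrightarrow> j \<notin> D \<longrightarrow> {a} \<times> insert j D \<subseteq> ?Z)"
      if "i < n" "j < m" "of_bool (i \<in> S) + of_bool (j \<in> D) = (0 :: nat)" for i j
      using that a S D by (auto split: if_splits)
    have r: "knows A (?Z \<union> {(i, j). i < n \<and> j < m \<and> of_bool (i \<in> S) + of_bool (j \<in> D) = (0 :: nat)})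
        (?run (phase_prog 0) ?t)"
      "cost (?run (phase_prog 0) ?t) \<le> cost ?t + n * m * (6 * max n m + 2)"
      by (rule run_phase[OF t a 1(1) need]; assumption)+
    have "{..<n} \<times> {..<m} \<subseteq> ?Z \<union> {(i, j). i < n \<and> j < m \<and> of_bool (i \<in> S) + of_bool (j \<in> D) = (0 :: nat)}"
      by auto
    then have "knows A ({..<n} \<times> {..<m}) (?run (phase_prog 0) ?t)"
      using r(1) unfolding knows_def by blast
    then show ?thesis unfolding eq using r(2) 1(2) True by (simp del: writes_phase_prog)
  qed
  then show "knows A ({..<n} \<times> {..<m}) (?run complete_prog s)"
    "cost (?run complete_prog s) \<le> cost s + (if k < max n m then 2 * (n * m * (6 * max n m + 2)) else 0)"
    by auto
qed

end

text \<open>Nonvanishing takes two comparisons with the zero cell, as \<open><\<close> is the only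
  test on reals. No arithmetic on reals occurs, so this exhaustive search is free.\<close>

definition find_prog :: prog where
  "find_prog = For 30 (ipow2 (IVar 0)) (For 31 (ipow2 (IVar 1))
    (IfILess (INum 0)
      (IMul (IMul (isubset 0 30 5) (ieq (icount 30 (IVar 0)) (IVar 2)))
        (IMul (isubset 1 31 6) (ieq (icount 31 (IVar 1)) (IVar 2))))
      (IfRLess (Ref 0 (irank 0 30) (irank 1 31)) (cell 5)
        (Seq (IAssign 3 (IVar 30)) (IAssign 4 (IVar 31)))
        (IfRLess (cell 5) (Ref 0 (irank 0 30) (irank 1 31))
          (Seq (IAssign 3 (IVar 30)) (IAssign 4 (IVar 31))) Skip))
      Skip))"

lemma writes_find_prog [simp]: "wvars find_prog = {3, 4, 30, 31}" "warrays find_prog = {}"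
  by (auto simp: find_prog_def)

lemma run_find_prog:
  assumes s: "ready n m k A s" and R: "R \<subseteq> {..<n}" "ivars s 5 = set_encode R"
    and C: "C \<subseteq> {..<m}" "ivars s 6 = set_encode C"
    and ex: "\<exists>S D. S \<subseteq> R \<and> D \<subseteq> C \<and> card S = k \<and> card D = k \<and> minor A S D \<noteq> 0"
  obtains S D where "S \<subseteq> R" "D \<subseteq> C" "card S = k" "card D = k" "minor A S D \<noteq> 0"
    "ivars (exec thin red find_prog s) 3 = set_encode S" "ivars (exec thin red find_prog s) 4 = set_encode D"
    "cost (exec thin red find_prog s) \<le> cost s"
proof -
  note fin = finite_subset[OF R(1) finite_lessThan] finite_subset[OF C(1) finite_lessThan]
  define good where "good x y \<longleftrightarrow> set_decode x \<subseteq> R \<and> set_decode y \<subseteq> C \<and> card (set_decode x) = k \<and>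
    card (set_decode y) = k \<and> minor A (set_decode x) (set_decode y) \<noteq> 0" for x y
  \<comment> \<open>A later hit may replace an earlier one; the invariant only promises some good
    pair as soon as one has been visited.\<close>
  define P where "P X s' \<longleftrightarrow> ready n m k A s' \<and> ivars s' 5 = set_encode R \<and> ivars s' 6 = set_encode C \<and>
    ((\<exists>(x, y)\<in>X. good x y) \<longrightarrow> good (ivars s' 3) (ivars s' 4))" for X s'
  let ?body = "IfILess (INum 0)
      (IMul (IMul (isubset 0 30 5) (ieq (icount 30 (IVar 0)) (IVar 2)))
        (IMul (isubset 1 31 6) (ieq (icount 31 (IVar 1)) (IVar 2))))
      (IfRLess (Ref 0 (irank 0 30) (irank 1 31)) (cell 5)
        (Seq (IAssign 3 (IVar 30)) (IAssign 4 (IVar 31)))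
        (IfRLess (cell 5) (Ref 0 (irank 0 30) (irank 1 31))
          (Seq (IAssign 3 (IVar 30)) (IAssign 4 (IVar 31))) Skip))
      Skip"
  have step: "P (insert (x, y) X) (exec thin red ?body s') \<and> cost (exec thin red ?body s') \<le> cost s' + 0"
    if P: "P X s'" and xy: "x < 2 ^ n" "y < 2 ^ m" "ivars s' 30 = x" "ivars s' 31 = y" for X s' x y
  proof -
    let ?K = "set_decode x" and ?L = "set_decode y"
    have KL: "?K \<subseteq> {..<n}" "?L \<subseteq> {..<m}" using decode_subset xy by auto
    have i: "ivars s' 0 = n" "ivars s' 1 = m" "ivars s' 2 = k" "arrays s' 5 0 0 = 0"
      using P by (auto simp: P_def ready_def)
    have e: "ivars s' 30 = set_encode ?K" "ivars s' 31 = set_encode ?L" using xy by auto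
    have 1: "ival (isubset 0 30 5) (ivars s') = of_bool (?K \<subseteq> R)"
      "ival (isubset 1 31 6) (ivars s') = of_bool (?L \<subseteq> C)"
      using ival_isubset[OF KL(1) fin(1), of "ivars s'" 30 5 0] ival_isubset[OF KL(2) fin(2), of "ivars s'" 31 6 1]
        P i e by (auto simp: P_def)
    have 2: "ival (icount 30 (IVar 0)) (ivars s') = card ?K" "ival (icount 31 (IVar 1)) (ivars s') = card ?L"
      using ival_icount[of ?K "ivars s'" 30 "IVar 0"] ival_icount[of ?L "ivars s'" 31 "IVar 1"]
        e i pos_eq_card_of_subset[OF KL(1)] pos_eq_card_of_subset[OF KL(2)] by auto
    have 3: "ival (irank 0 30) (ivars s') = lex_rank n ?K" "ival (irank 1 31) (ivars s') = lex_rank m ?L"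
      using ival_irank[OF KL(1), of "ivars s'" 30 0] ival_irank[OF KL(2), of "ivars s'" 31 1] e i by auto
    have 4: "arrays s' 0 (lex_rank n ?K) (lex_rank m ?L) = minor A ?K ?L" if "card ?K = k" "card ?L = k"
      using P KL that by (simp add: P_def ready_def)
    have run: "exec thin red ?body s' = (if good x y then set_ivar 4 y (set_ivar 3 x s') else s')"
      unfolding exec.simps cell_def get.simps ival.simps ival_ieq 1 2 3 i xy
      using 4 by (auto simp: good_def xy i)
    show ?thesis
    proof (cases "good x y")
      case True
      then show ?thesis using P unfolding run by (auto simp: P_def)
    next
      case False
      then show ?thesis using P unfolding run by (auto simp: P_def)
    qed
  qed
  have vars: "P X (set_ivar 30 i s')" "P X (set_ivar 31 i s')" if "P X s'" for X s' i
    using that by (auto simp: P_def)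
  have bnd: "ival (ipow2 (IVar 0)) (ivars s') = 2 ^ n" "ival (ipow2 (IVar 1)) (ivars s') = 2 ^ m" if "P X s'" for X s'
    using that by (auto simp: P_def ready_def)
  have "P {} s" using s R C by (simp add: P_def)
  note g = run_grid[where P = P and u = 30 and v = 31 and c = ?body and e = "ipow2 (IVar 0)" and N = "2 ^ n"
    and f = "ipow2 (IVar 1)" and M = "2 ^ m" and t = "\<lambda>_ _. 0" and thin = thin and red = red, OF this]
  have P: "P ({..<2 ^ n} \<times> {..<2 ^ m}) (exec thin red find_prog s)"
    unfolding find_prog_def
    by (rule g(1), simp, simp, erule bnd(1), erule bnd(2), erule vars(1), erule vars(2), rule step; assumption)
  have "cost (exec thin red find_prog s) \<le> cost s + (\<Sum>i<(2 :: nat) ^ n. \<Sum>j<(2 :: nat) ^ m. 0)"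
    unfolding find_prog_def
    by (rule g(2), simp, simp, erule bnd(1), erule bnd(2), erule vars(1), erule vars(2), rule step; assumption)
  then have cost: "cost (exec thin red find_prog s) \<le> cost s" by simp
  obtain S D where SD: "S \<subseteq> R" "D \<subseteq> C" "card S = k" "card D = k" "minor A S D \<noteq> 0" using ex by blast
  then have fSD: "finite S" "finite D" using fin finite_subset by auto
  have "set_encode S < 2 ^ n" "set_encode D < 2 ^ m" using SD R C by (auto intro!: encode_less)
  moreover have "good (set_encode S) (set_encode D)" using SD fSD by (simp add: good_def)
  ultimately have "good (ivars (exec thin red find_prog s) 3) (ivars (exec thin red find_prog s) 4)"
    using P unfolding P_def by blast
  then show ?thesis
    using that[of "set_decode (ivars (exec thin red find_prog s) 3)" "set_decode (ivars (exec thin red find_prog s) 4)"]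
      cost by (simp add: good_def)
qed

section \<open>The full-rank case\<close>

text \<open>The form of \<open>run_grid\<close> for loops that fill one array. Injectivity of the
  two index maps ensures that no later round overwrites a value.\<close>

lemma run_fill:
  fixes P :: "state \<Rightarrow> bool"
  assumes init: "P s" and uv: "u \<noteq> v" "u \<notin> wvars c"
    and inj: "inj_on r {..<N}" "inj_on q {..<M}"
    and bounds: "\<And>s. P s \<Longrightarrow> ival e (ivars s) = N" "\<And>s. P s \<Longrightarrow> ival f (ivars s) = M"
    and vars: "\<And>s i. P s \<Longrightarrow> P (set_ivar u i s)" "\<And>s i. P s \<Longrightarrow> P (set_ivar v i s)"
    and step: "\<And>s i j. P s \<Longrightarrow> i < N \<Longrightarrow> j < M \<Longrightarrow> ivars s u = i \<Longrightarrow> ivars s v = j \<Longrightarrow>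
      P (exec thin red c s) \<and> cost (exec thin red c s) \<le> cost s + t \<and>
      arrays (exec thin red c s) b = (\<lambda>x y. if x = r i \<and> y = q j then w i j else arrays s b x y)"
  shows "P (exec thin red (For u e (For v f c)) s)"
    and "\<And>i j. i < N \<Longrightarrow> j < M \<Longrightarrow> arrays (exec thin red (For u e (For v f c)) s) b (r i) (q j) = w i j"
    and "cost (exec thin red (For u e (For v f c)) s) \<le> cost s + N * M * t"
proof -
  let ?s' = "exec thin red (For u e (For v f c)) s"
  define Q where "Q X s \<longleftrightarrow> P s \<and> X \<subseteq> {..<N} \<times> {..<M} \<and> (\<forall>(i, j)\<in>X. arrays s b (r i) (q j) = w i j)" for X s
  have Qstep: "Q (insert (i, j) X) (exec thin red c s') \<and> cost (exec thin red c s') \<le> cost s' + t"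
    if Q: "Q X s'" and ij: "i < N" "j < M" "ivars s' u = i" "ivars s' v = j" for X s' i j
  proof -
    have P: "P s'" using Q by (simp add: Q_def)
    note st = step[OF P ij]
    have new: "arrays (exec thin red c s') b (r i') (q j') = w i' j'" if X: "(i', j') \<in> insert (i, j) X" for i' j'
    proof (cases "(i', j') = (i, j)")
      case True
      then show ?thesis using st by simp
    next
      case False
      then have "(i', j') \<in> X" using X by auto
      then have *: "i' < N" "j' < M" "arrays s' b (r i') (q j') = w i' j'" using Q by (auto simp: Q_def)
      have "\<not> (r i' = r i \<and> q j' = q j)"
        using inj * ij False by (auto simp: inj_on_def)
      then show ?thesis using st * by auto
    qed
    have "\<forall>(i', j')\<in>insert (i, j) X. arrays (exec thin red c s') b (r i') (q j') = w i' j'"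
      by (intro ballI, unfold split_paired_all prod.case) (rule new)
    moreover have "insert (i, j) X \<subseteq> {..<N} \<times> {..<M}" using Q ij by (simp add: Q_def)
    ultimately show ?thesis using st unfolding Q_def by blast
  qed
  have Qvars: "Q X (set_ivar u i s')" "Q X (set_ivar v i s')" if "Q X s'" for X s' i
    using that vars by (auto simp: Q_def)
  have Qbnd: "ival e (ivars s') = N" "ival f (ivars s') = M" if "Q X s'" for X s'
    using that bounds by (auto simp: Q_def)
  have "Q {} s" using init by (simp add: Q_def)
  note g = run_grid[where P = Q and u = u and v = v and c = c and e = e and N = N and f = f and M = M
      and t = "\<lambda>_ _. t" and thin = thin and red = red, OF this uv]
  have Q: "Q ({..<N} \<times> {..<M}) ?s'"
    by (rule g(1), erule Qbnd(1), erule Qbnd(2), erule Qvars(1), erule Qvars(2), rule Qstep; assumption)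
  have "cost ?s' \<le> cost s + (\<Sum>i<N. \<Sum>j<M. t)"
    by (rule g(2), erule Qbnd(1), erule Qbnd(2), erule Qvars(1), erule Qvars(2), rule Qstep; assumption)
  then show "cost ?s' \<le> cost s + N * M * t" by (simp add: mult.assoc)
  show "P ?s'" using Q by (simp add: Q_def)
  show "\<And>i j. i < N \<Longrightarrow> j < M \<Longrightarrow> arrays ?s' b (r i) (q j) = w i j" using Q by (auto simp: Q_def)
qed

lemma inj_on_pick: "N \<le> card K \<Longrightarrow> inj_on (pick K) {..<N}"
  by (auto simp: inj_on_def pick_eq_iff)

lemma encode_lessThan: "set_encode {..<n} = 2 ^ n - 1"
proof -
  have "set_encode {..<n} + 1 = 2 ^ n" by (induction n) (auto simp: set_encode_def lessThan_Suc)
  then show ?thesis by simp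
qed

lemma initial_simps:
  "ivars (initial n m k M) = (\<lambda>x. 0)(0 := n, 1 := m, 2 := k)"
  "cost (initial n m k M) = 0"
  by (simp_all add: initial_def)

lemma ready_initial:
  assumes A: "A \<in> carrier_mat n m"
  shows "ready n m k A (initial n m k (compound k A))"
proof -
  have "arrays (initial n m k (compound k A)) 0 (lex_rank n K) (lex_rank m L) = minor A K L"
    if "K \<subseteq> {..<n}" "L \<subseteq> {..<m}" "card K = k" "card L = k" for K L
    using compound_minor[OF A that] ktuples_lex_rank(1)[OF that(1,3)] ktuples_lex_rank(1)[OF that(2,4)] A
    by (simp add: initial_def put_block_def put_array_def compound_def)
  then show ?thesis
    unfolding ready_def initial_simps by (simp add: initial_def arrays_put_block_other)
qed

text \<open>The block gets the diagonal \<open>minor A S D\<close>, 1, ..., 1. It has the required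
  determinant and consists of literals and one copied input entry, so it costs nothing.\<close>

definition diag_prog :: prog where
  "diag_prog = For 30 (IVar 2) (For 31 (IVar 2)
    (IfILess (ieq (IVar 30) (IVar 31)) (INum 1)
      (Literal (Ref 1 (ipick (IVar 0) 3 30) (ipick (IVar 1) 4 31)) 0)
      (IfILess (INum 0) (IVar 30)
        (Literal (Ref 1 (ipick (IVar 0) 3 30) (ipick (IVar 1) 4 31)) 1)
        (Copy (Ref 1 (ipick (IVar 0) 3 30) (ipick (IVar 1) 4 31)) (Ref 0 (irank 0 3) (irank 1 4))))))"

lemma writes_diag_prog [simp]: "wvars diag_prog = {30, 31}" "warrays diag_prog = {1}"
  by (auto simp: diag_prog_def)

lemma run_diag_prog:
  assumes s: "ready n m k A s" and S: "S \<subseteq> {..<n}" "card S = k" "ivars s 3 = set_encode S"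
    and D: "D \<subseteq> {..<m}" "card D = k" "ivars s 4 = set_encode D"
  shows "\<And>i j. i < k \<Longrightarrow> j < k \<Longrightarrow> arrays (exec thin red diag_prog s) 1 (pick S i) (pick D j) =
      (if i = j then if i = 0 then minor A S D else 1 else 0)"
    and "cost (exec thin red diag_prog s) \<le> cost s"
proof -
  define P where "P s' \<longleftrightarrow> ready n m k A s' \<and> ivars s' 3 = set_encode S \<and> ivars s' 4 = set_encode D" for s'
  define w where "w i j = (if i = j then if i = 0 then minor A S D else 1 else 0)" for i j :: nat
  let ?ref = "Ref 1 (ipick (IVar 0) 3 30) (ipick (IVar 1) 4 31)"
  let ?body = "IfILess (ieq (IVar 30) (IVar 31)) (INum 1) (Literal ?ref 0)
      (IfILess (INum 0) (IVar 30) (Literal ?ref 1) (Copy ?ref (Ref 0 (irank 0 3) (irank 1 4))))"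
  have step: "P (exec thin red ?body s') \<and> cost (exec thin red ?body s') \<le> cost s' + 0 \<and>
      arrays (exec thin red ?body s') 1 =
        (\<lambda>x y. if x = pick S i \<and> y = pick D j then w i j else arrays s' 1 x y)"
    if P: "P s'" and ij: "i < k" "j < k" "ivars s' 30 = i" "ivars s' 31 = j" for s' i j
  proof -
    have v: "ivars s' 0 = n" "ivars s' 1 = m" using P by (auto simp: P_def ready_def)
    have 1: "ival (ipick (IVar 0) 3 30) (ivars s') = pick S i" "ival (ipick (IVar 1) 4 31) (ivars s') = pick D j"
      using ival_ipick[OF S(1), of "ivars s'" 3 "IVar 0" 30] ival_ipick[OF D(1), of "ivars s'" 4 "IVar 1" 31]
        P v ij S D by (auto simp: P_def)
    have 2: "ival (irank 0 3) (ivars s') = lex_rank n S" "ival (irank 1 4) (ivars s') = lex_rank m D"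
      using ival_irank[OF S(1), of "ivars s'" 3 0] ival_irank[OF D(1), of "ivars s'" 4 1] P v
      by (auto simp: P_def)
    have 3: "arrays s' 0 (lex_rank n S) (lex_rank m D) = minor A S D"
      using P S D by (simp add: P_def ready_def)
    have "exec thin red ?body s' = put ?ref (w i j) s'"
      unfolding exec.simps get.simps 2 3 w_def using ij by auto
    moreover have "P (put ?ref (w i j) s')"
      using P by (simp add: P_def ready_def arrays_put)
    ultimately show ?thesis
      by (simp add: arrays_put fun_eq_iff 1[unfolded One_nat_def])
  qed
  have vars: "P (set_ivar 30 i s')" "P (set_ivar 31 i s')" if "P s'" for s' i
    using that by (auto simp: P_def)
  have bnd: "ival (IVar 2) (ivars s') = k" if "P s'" for s'
    using that by (auto simp: P_def ready_def)
  have "P s" using s S D by (simp add: P_def)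
  note g = run_fill[where P = P and u = 30 and v = 31 and c = ?body and r = "pick S" and q = "pick D"
      and N = k and M = k and e = "IVar 2" and f = "IVar 2" and t = 0 and b = 1 and w = w
      and thin = thin and red = red, OF this]
  have inj: "inj_on (pick S) {..<k}" "inj_on (pick D) {..<k}" using S D by (auto intro: inj_on_pick)
  have "arrays (exec thin red diag_prog s) 1 (pick S i) (pick D j) = w i j" if "i < k" "j < k" for i j
    unfolding diag_prog_def
    by (rule g(2)[OF _ _ inj _ _ _ _ _ that], simp, simp, erule bnd, erule bnd, erule vars(1), erule vars(2),
        rule step; assumption)
  then show "\<And>i j. i < k \<Longrightarrow> j < k \<Longrightarrow> arrays (exec thin red diag_prog s) 1 (pick S i) (pick D j) =
      (if i = j then if i = 0 then minor A S D else 1 else 0)" by (simp add: w_def)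
  have "cost (exec thin red diag_prog s) \<le> cost s + k * k * 0"
    unfolding diag_prog_def
    by (rule g(3)[OF _ _ inj], simp, simp, erule bnd, erule bnd, erule vars(1), erule vars(2), rule step; assumption)
  then show "cost (exec thin red diag_prog s) \<le> cost s" by simp
qed

definition full_rank_prog :: prog where
  "full_rank_prog = Seq (IAssign 5 (ISub (ipow2 (IVar 0)) (INum 1))) (Seq (IAssign 6 (ISub (ipow2 (IVar 1)) (INum 1)))
    (Seq find_prog (Seq diag_prog (Seq complete_prog (IAssign 0 (INum 1))))))"

lemma knows_pickI:
  assumes S: "finite S" "card S = k" and D: "finite D" "card D = l"
    and *: "\<And>i j. i < k \<Longrightarrow> j < l \<Longrightarrow> arrays s 1 (pick S i) (pick D j) = A $$ (pick S i, pick D j)"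
  shows "knows A (S \<times> D) s"
proof -
  have "arrays s 1 x y = A $$ (x, y)" if "x \<in> S" "y \<in> D" for x y
    using *[of "pos S x" "pos D y"] pos_less[OF S(1) that(1)] pos_less[OF D(1) that(2)] that S D
    by (simp add: pick_pos)
  then show ?thesis by (auto simp: knows_def)
qed

lemma get_block_knows:
  assumes "A \<in> carrier_mat n m" "knows A ({..<n} \<times> {..<m}) s"
  shows "get_block 1 n m s = A"
  by (rule eq_matI) (use assms in \<open>auto simp: get_block_def knows_def\<close>)

text \<open>The diagonal block is the block of some \<open>U * T * transpose_mat V\<close> with
  \<open>det T = 1\<close>. This matrix has the compound of \<open>A\<close>, so it is what the
  completion computes, although \<open>U\<close>, \<open>V\<close> and \<open>T\<close> are unknown
  to the program.\<close>

lemma run_full_rank_prog: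
  assumes U: "U \<in> carrier_mat n k" and V: "V \<in> carrier_mat m k" and A: "A = U * transpose_mat V"
    and k: "1 \<le> k" "k \<le> mrank A"
  shows "\<exists>T. T \<in> carrier_mat k k \<and> det T = 1 \<and>
      outputs n m (exec thin red full_rank_prog (initial n m k (compound k A))) = [U * T * transpose_mat V]"
    and "cost (exec thin red full_rank_prog (initial n m k (compound k A))) \<le>
      (if k < max n m then 2 * (n * m * (6 * max n m + 2)) else 0)"
proof -
  let ?run = "exec thin red"
  have Ac: "A \<in> carrier_mat n m" using A U V by simp
  let ?i = "initial n m k (compound k A)"
  define s where "s = set_ivar 6 (set_encode {..<m}) (set_ivar 5 (set_encode {..<n}) ?i)"
  have eq: "?run full_rank_prog ?i = set_ivar 0 1 (?run complete_prog (?run diag_prog (?run find_prog s)))"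
    unfolding full_rank_prog_def s_def
    by (simp add: initial_simps encode_lessThan)
  have s: "ready n m k A s" "ivars s 5 = set_encode {..<n}" "ivars s 6 = set_encode {..<m}"
    using ready_initial[OF Ac] by (auto simp: s_def)
  have "\<exists>S D. S \<subseteq> {..<n} \<and> D \<subseteq> {..<m} \<and> card S = k \<and> card D = k \<and> minor A S D \<noteq> 0"
    using exists_nonzero_minor[OF Ac k(2)] by blast
  then obtain S D where SD: "S \<subseteq> {..<n}" "D \<subseteq> {..<m}" "card S = k" "card D = k" "minor A S D \<noteq> 0"
    "ivars (?run find_prog s) 3 = set_encode S" "ivars (?run find_prog s) 4 = set_encode D"
    "cost (?run find_prog s) \<le> cost s"
    by (rule run_find_prog[OF s(1) order_refl s(2) order_refl s(3)])
  have fin: "finite S" "finite D" using SD finite_subset by auto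
  let ?t = "?run diag_prog (?run find_prog s)"
  have r1: "ready n m k A (?run find_prog s)" using s ready_run[of find_prog n m k A thin red s] by simp
  note dg = run_diag_prog[OF r1 SD(1,3,6) SD(2,4,7), where thin = thin and red = red]
  define E where "E = mat k k (\<lambda>(i, j). if i = j then if i = 0 then minor A S D else 1 else (0 :: real))"
  have "det E = minor A S D"
  proof -
    have "upper_triangular E" by (auto simp: E_def)
    moreover have "E \<in> carrier_mat k k" by (simp add: E_def)
    ultimately have "det E = prod_list (diag_mat E)" by (rule det_upper_triangular)
    also have "\<dots> = (\<Prod>i<k. if i = 0 then minor A S D else 1)"
      by (simp add: prod_list_diag_prod E_def atLeast0LessThan)
    also have "\<dots> = minor A S D" using k(1) by (simp add: prod.delta)
    finally show ?thesis .
  qed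
  moreover have "E \<in> carrier_mat k k" by (simp add: E_def)
  ultimately obtain T where T: "T \<in> carrier_mat k k" "det T = 1" "submatrix (U * T * transpose_mat V) S D = E"
    using exists_factor[OF U V SD(1-4), of E] SD(5) A by metis
  let ?B = "U * T * transpose_mat V"
  have Bc: "?B \<in> carrier_mat n m" using U T V by simp
  have minors: "minor ?B K L = minor A K L" if "K \<subseteq> {..<n}" "L \<subseteq> {..<m}" "card K = k" "card L = k" for K L
    using minor_factor[OF U V T(1) that] T(2) A by simp
  \<comment> \<open>\<open>A\<close> is exchanged for \<open>?B\<close>, which has the same
    \<open>k\<close>-minors.\<close>
  have r2: "ready n m k ?B ?t"
    using r1 minors ready_run[of diag_prog n m k A thin red "?run find_prog s"] by (simp add: ready_def)
  have t: "ivars ?t 3 = set_encode S" "ivars ?t 4 = set_encode D"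
    using SD ivars_run[of _ diag_prog thin red "?run find_prog s"] by auto
  have base: "knows ?B (S \<times> D) ?t"
  proof (rule knows_pickI[OF fin(1) SD(3) fin(2) SD(4)])
    fix i j assume ij: "i < k" "j < k"
    then have "?B $$ (pick S i, pick D j) = E $$ (i, j)"
      using submatrix_nth[OF Bc SD(1,2), of i j] SD T by simp
    then show "arrays ?t 1 (pick S i) (pick D j) = ?B $$ (pick S i, pick D j)"
      using dg(1)[OF ij] ij by (simp add: E_def)
  qed
  have nzB: "minor ?B S D \<noteq> 0" using minors SD by simp
  note cp = run_complete_prog[OF Bc SD(1-4) nzB r2 t base k(1), of thin red]
  have "outputs n m (?run full_rank_prog ?i) = [?B]"
    unfolding eq outputs_def using get_block_knows[OF Bc cp(1)] by (simp add: get_block_def)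
  then show "\<exists>T. T \<in> carrier_mat k k \<and> det T = 1 \<and>
      outputs n m (?run full_rank_prog ?i) = [U * T * transpose_mat V]"
    using T by blast
  have "cost s = 0" by (simp add: s_def initial_simps)
  then show "cost (?run full_rank_prog ?i) \<le> (if k < max n m then 2 * (n * m * (6 * max n m + 2)) else 0)"
    unfolding eq using cp(2) dg(2) SD(8) by simp
qed

section \<open>Searching for a regular submatrix\<close>

definition cof_mat :: "real mat \<Rightarrow> nat \<Rightarrow> nat set \<Rightarrow> nat set \<Rightarrow> real mat" where
  "cof_mat A k R C = mat (Suc k) (Suc k) (\<lambda>(a, b). cof A R (pick R a) C (pick C b))"

definition cof_mat_prog :: prog where
  "cof_mat_prog = For 32 (IAdd (IVar 2) (INum 1)) (For 33 (IAdd (IVar 2) (INum 1))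
    (Seq (IAssign 11 (ipick (IVar 0) 9 32)) (Seq (IAssign 12 (ipick (IVar 1) 10 33))
      (Seq (cof_prog 11 12) (Copy (Ref 6 (IVar 32) (IVar 33)) (cell 4))))))"

lemma writes_cof_mat_prog [simp]: "wvars cof_mat_prog = {11, 12, 21, 22, 32, 33}" "warrays cof_mat_prog = {4, 6}"
  by (auto simp: cof_mat_prog_def cell_def)

lemma run_cof_mat_prog:
  assumes s: "ready n m k A s" and R: "R \<subseteq> {..<n}" "card R = Suc k" "ivars s 9 = set_encode R"
    and C: "C \<subseteq> {..<m}" "card C = Suc k" "ivars s 10 = set_encode C"
  shows "get_block 6 (Suc k) (Suc k) (exec thin red cof_mat_prog s) = cof_mat A k R C"
    and "cost (exec thin red cof_mat_prog s) \<le> cost s + (Suc k)\<^sup>2"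
proof -
  note fin = finite_subset[OF R(1) finite_lessThan] finite_subset[OF C(1) finite_lessThan]
  define P where "P s' \<longleftrightarrow> ready n m k A s' \<and> ivars s' 9 = set_encode R \<and> ivars s' 10 = set_encode C" for s'
  define w where "w a b = cof A R (pick R a) C (pick C b)" for a b
  let ?body = "Seq (IAssign 11 (ipick (IVar 0) 9 32)) (Seq (IAssign 12 (ipick (IVar 1) 10 33))
      (Seq (cof_prog 11 12) (Copy (Ref 6 (IVar 32) (IVar 33)) (cell 4))))"
  have step: "P (exec thin red ?body s') \<and> cost (exec thin red ?body s') \<le> cost s' + 1 \<and>
      arrays (exec thin red ?body s') 6 = (\<lambda>x y. if x = id i \<and> y = id j then w i j else arrays s' 6 x y)"
    if P: "P s'" and ij: "i < Suc k" "j < Suc k" "ivars s' 32 = i" "ivars s' 33 = j" for s' i j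
  proof -
    have v: "ivars s' 0 = n" "ivars s' 1 = m" using P by (auto simp: P_def ready_def)
    have 1: "ival (ipick (IVar 0) 9 32) (ivars s') = pick R i"
      using ival_ipick[OF R(1), of "ivars s'" 9 "IVar 0" 32] P v ij R by (auto simp: P_def)
    let ?s1 = "set_ivar 11 (pick R i) s'"
    have 2: "ival (ipick (IVar 1) 10 33) (ivars ?s1) = pick C j"
      using ival_ipick[OF C(1), of "ivars ?s1" 10 "IVar 1" 33] P v ij C by (auto simp: P_def)
    let ?s2 = "set_ivar 12 (pick C j) ?s1"
    let ?s3 = "exec thin red (cof_prog 11 12) ?s2"
    have r: "ready n m k A ?s2" "ivars ?s2 9 = set_encode R" "ivars ?s2 10 = set_encode C"
      using P by (auto simp: P_def)
    have c: "card (R - {ivars ?s2 11}) = k" "card (C - {ivars ?s2 12}) = k"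
      using pick_in[of i R] pick_in[of j C] R C ij fin by auto
    have 3: "arrays ?s3 4 0 0 = w i j" "cost ?s3 \<le> cost s' + 1"
      using run_cof_prog[OF r(1,2) R(1) r(3) C(1) _ _ c, of thin red] by (simp_all add: w_def)
    have v3: "ivars ?s3 z = ivars ?s2 z" if "z \<notin> {21, 22}" for z
      using ivars_run[of z "cof_prog 11 12" thin red ?s2] that by simp
    have a3: "arrays ?s3 b = arrays s' b" if "b \<noteq> 4" for b
      using arrays_run[of b "cof_prog 11 12" thin red ?s2] that by simp
    have eq: "exec thin red ?body s' = put (Ref 6 (IVar 32) (IVar 33)) (w i j) ?s3"
      unfolding exec.simps(2,3) 1 2 using 3(1) by (simp add: cell_def)
    have "ready n m k A ?s3" using r(1) ready_run[of "cof_prog 11 12" n m k A thin red ?s2] by simp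
    then have "ready n m k A (exec thin red ?body s')"
      unfolding eq by (simp add: ready_def arrays_put)
    then show ?thesis
      using P v3 3(2) ij a3[of 6] unfolding eq by (simp add: P_def arrays_put fun_eq_iff)
  qed
  have vars: "P (set_ivar 32 i s')" "P (set_ivar 33 i s')" if "P s'" for s' i
    using that by (auto simp: P_def)
  have bnd: "ival (IAdd (IVar 2) (INum 1)) (ivars s') = Suc k" if "P s'" for s'
    using that by (auto simp: P_def ready_def)
  have "P s" using s R C by (simp add: P_def)
  note g = run_fill[where P = P and u = 32 and v = 33 and c = ?body and r = id and q = id
      and N = "Suc k" and M = "Suc k" and e = "IAdd (IVar 2) (INum 1)" and f = "IAdd (IVar 2) (INum 1)"
      and t = 1 and b = 6 and w = w and thin = thin and red = red, OF this]
  have "arrays (exec thin red cof_mat_prog s) 6 (id i) (id j) = w i j" if "i < Suc k" "j < Suc k" for i j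
    unfolding cof_mat_prog_def
    by (rule g(2)[OF _ _ _ _ _ _ _ _ _ that], simp, simp, simp, simp, erule bnd, erule bnd, erule vars(1), erule vars(2),
        rule step; assumption)
  then show "get_block 6 (Suc k) (Suc k) (exec thin red cof_mat_prog s) = cof_mat A k R C"
    by (intro eq_matI) (auto simp: get_block_def cof_mat_def w_def)
  have "cost (exec thin red cof_mat_prog s) \<le> cost s + Suc k * Suc k * 1"
    unfolding cof_mat_prog_def
    by (rule g(3), simp, simp, simp, simp, erule bnd, erule bnd, erule vars(1), erule vars(2), rule step; assumption)
  then show "cost (exec thin red cof_mat_prog s) \<le> cost s + (Suc k)\<^sup>2" by (simp add: power2_eq_square)
qed

text \<open>Determinants are taken of leading blocks only, so the submatrix is copied first. Each
  comparison bit skips the deleted line.\<close>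

definition delete_prog :: prog where
  "delete_prog = For 36 (IVar 2) (For 37 (IVar 2) (Copy (Ref 7 (IVar 36) (IVar 37))
    (Ref 6 (IAdd (IVar 36) (ile (IVar 34) (IVar 36))) (IAdd (IVar 37) (ile (IVar 35) (IVar 37))))))"

lemma writes_delete_prog [simp]: "wvars delete_prog = {36, 37}" "warrays delete_prog = {7}"
  by (auto simp: delete_prog_def)

lemma run_delete_prog:
  assumes "ivars s 2 = k" "get_block 6 (Suc k) (Suc k) s = Y" "ivars s 34 = a" "ivars s 35 = b"
  shows "get_block 7 k k (exec thin red delete_prog s) = mat_delete Y a b"
    and "cost (exec thin red delete_prog s) \<le> cost s"
proof -
  define P where "P s' \<longleftrightarrow> ivars s' 2 = k \<and> arrays s' 6 = arrays s 6 \<and> ivars s' 34 = a \<and> ivars s' 35 = b" for s' :: state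
  define w where "w i j = arrays s 6 (if i < a then i else Suc i) (if j < b then j else Suc j)" for i j
  let ?body = "Copy (Ref 7 (IVar 36) (IVar 37))
    (Ref 6 (IAdd (IVar 36) (ile (IVar 34) (IVar 36))) (IAdd (IVar 37) (ile (IVar 35) (IVar 37))))"
  have step: "P (exec thin red ?body s') \<and> cost (exec thin red ?body s') \<le> cost s' + 0 \<and>
      arrays (exec thin red ?body s') 7 = (\<lambda>x y. if x = id i \<and> y = id j then w i j else arrays s' 7 x y)"
    if P: "P s'" and ij: "i < k" "j < k" "ivars s' 36 = i" "ivars s' 37 = j" for s' i j
  proof -
    have "get (Ref 6 (IAdd (IVar 36) (ile (IVar 34) (IVar 36))) (IAdd (IVar 37) (ile (IVar 35) (IVar 37)))) s' = w i j"
      using P ij by (auto simp: P_def w_def not_less)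
    then have eq: "exec thin red ?body s' = put (Ref 7 (IVar 36) (IVar 37)) (w i j) s'"
      by (simp only: exec.simps)
    show ?thesis using P ij unfolding eq by (auto simp: P_def arrays_put fun_eq_iff)
  qed
  have vars: "P (set_ivar 36 i s')" "P (set_ivar 37 i s')" if "P s'" for s' i
    using that by (auto simp: P_def)
  have bnd: "ival (IVar 2) (ivars s') = k" if "P s'" for s'
    using that by (auto simp: P_def)
  have "P s" using assms by (simp add: P_def)
  note g = run_fill[where P = P and u = 36 and v = 37 and c = ?body and r = id and q = id
      and N = k and M = k and e = "IVar 2" and f = "IVar 2"
      and t = 0 and b = 7 and w = w and thin = thin and red = red, OF this]
  have "arrays (exec thin red delete_prog s) 7 (id i) (id j) = w i j" if "i < k" "j < k" for i j
    unfolding delete_prog_def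
    by (rule g(2)[OF _ _ _ _ _ _ _ _ _ that], simp, simp, simp, simp, erule bnd, erule bnd, erule vars(1), erule vars(2),
        rule step; assumption)
  then show "get_block 7 k k (exec thin red delete_prog s) = mat_delete Y a b"
    unfolding assms(2)[symmetric] by (intro eq_matI) (auto simp: get_block_def mat_delete_def w_def)
  have "cost (exec thin red delete_prog s) \<le> cost s + k * k * 0"
    unfolding delete_prog_def
    by (rule g(3), simp, simp, simp, simp, erule bnd, erule bnd, erule vars(1), erule vars(2), rule step; assumption)
  then show "cost (exec thin red delete_prog s) \<le> cost s" by simp
qed

definition block_entry_prog :: prog where
  "block_entry_prog = Seq delete_prog (Seq (Det (cell 4) 7 (IVar 2)) (Seq (Op Mul (cell 4) (cell 4) (cell 9))
    (Seq (IfILess (IMod (IAdd (IVar 34) (IVar 35)) (INum 2)) (INum 1) Skip (Op Sub (cell 4) (cell 5) (cell 4)))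
      (Copy (Ref 1 (ipick (IVar 0) 9 34) (ipick (IVar 1) 10 35)) (cell 4)))))"

definition block_prog :: prog where
  "block_prog = For 34 (IAdd (IVar 2) (INum 1)) (For 35 (IAdd (IVar 2) (INum 1)) block_entry_prog)"

lemma writes_block_entry_prog [simp]: "wvars block_entry_prog = {36, 37}" "warrays block_entry_prog = {1, 4, 7}"
  by (auto simp: block_entry_prog_def cell_def)

lemma writes_block_prog [simp]: "wvars block_prog = {34, 35, 36, 37}" "warrays block_prog = {1, 4, 7}"
  by (auto simp: block_prog_def)

text \<open>Per entry, \<open>k ^ 3\<close> pays for the determinant and 2 for the scaling and the
  sign.\<close>

lemma run_block_prog:
  assumes s: "ready n m k A s" and R: "R \<subseteq> {..<n}" "card R = Suc k" "ivars s 9 = set_encode R"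
    and C: "C \<subseteq> {..<m}" "card C = Suc k" "ivars s 10 = set_encode C"
    and Y: "get_block 6 (Suc k) (Suc k) s = Y"
  shows "\<And>i j. i < Suc k \<Longrightarrow> j < Suc k \<Longrightarrow> arrays (exec thin red block_prog s) 1 (pick R i) (pick C j) =
      cofactor Y i j * arrays s 9 0 0"
    and "cost (exec thin red block_prog s) \<le> cost s + (Suc k)\<^sup>2 * (k ^ 3 + 2)"
proof -
  define P where "P s' \<longleftrightarrow> ready n m k A s' \<and> ivars s' 9 = set_encode R \<and> ivars s' 10 = set_encode C \<and>
    arrays s' 6 = arrays s 6 \<and> arrays s' 9 = arrays s 9" for s'
  define w where "w i j = cofactor Y i j * arrays s 9 0 0" for i j
  have step: "P (exec thin red block_entry_prog s') \<and> cost (exec thin red block_entry_prog s') \<le> cost s' + (k ^ 3 + 2) \<and>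
      arrays (exec thin red block_entry_prog s') 1 = (\<lambda>x y. if x = pick R i \<and> y = pick C j then w i j else arrays s' 1 x y)"
    if P: "P s'" and ij: "i < Suc k" "j < Suc k" "ivars s' 34 = i" "ivars s' 35 = j" for s' i j
  proof -
    have v: "ivars s' 0 = n" "ivars s' 1 = m" "ivars s' 2 = k" "arrays s' 5 0 0 = 0"
      using P by (auto simp: P_def ready_def)
    have Y': "get_block 6 (Suc k) (Suc k) s' = Y" using P Y by (simp add: P_def get_block_def)
    let ?z = "exec thin red delete_prog s'"
    note z = run_delete_prog[OF v(3) Y' ij(3,4), of thin red]
    have zv: "ivars ?z x = ivars s' x" if "x \<notin> {36, 37}" for x
      using ivars_run[of x delete_prog thin red s'] that by simp
    have za: "arrays ?z b = arrays s' b" if "b \<noteq> 7" for b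
      using arrays_run[of b delete_prog thin red s'] that by simp
    let ?d = "det (mat_delete Y i j)"
    let ?s1 = "charge (k ^ 3) (put (cell 4) ?d ?z)"
    let ?s2 = "charge 1 (put (cell 4) (?d * arrays s 9 0 0) ?s1)"
    let ?s3 = "if (i + j) mod 2 < 1 then ?s2 else charge 1 (put (cell 4) (- (?d * arrays s 9 0 0)) ?s2)"
    have 1: "exec thin red (Det (cell 4) 7 (IVar 2)) ?z = ?s1"
      using z(1) zv[of 2] v by (simp add: Let_def)
    have 2: "exec thin red (Op Mul (cell 4) (cell 4) (cell 9)) ?s1 = ?s2"
      using za[of 9] P by (simp add: cell_def arrays_put P_def)
    have 3: "exec thin red (IfILess (IMod (IAdd (IVar 34) (IVar 35)) (INum 2)) (INum 1) Skip
        (Op Sub (cell 4) (cell 5) (cell 4))) ?s2 = ?s3"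
      using zv[of 34] zv[of 35] ij za[of 5] v by (simp add: cell_def arrays_put)
    have v3: "ivars ?s3 x = ivars s' x" if "x \<notin> {36, 37}" for x
      using zv[OF that] by simp
    have a3: "arrays ?s3 b = arrays s' b" if "b \<notin> {4, 7}" for b
      using za[of b] that by (simp add: arrays_put_other cell_def)
    have w3: "arrays ?s3 4 0 0 = w i j"
      by (simp add: cell_def arrays_put w_def cofactor_def neg1_power_mod2)
    have pk: "ival (ipick (IVar 0) 9 34) (ivars ?s3) = pick R i" "ival (ipick (IVar 1) 10 35) (ivars ?s3) = pick C j"
      using ival_ipick[OF R(1), of "ivars ?s3" 9 "IVar 0" 34] ival_ipick[OF C(1), of "ivars ?s3" 10 "IVar 1" 35]
        P ij R C v3[of 9] v3[of 34] v3[of 0] v3[of 10] v3[of 35] v3[of 1] v by (auto simp only: P_def) auto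
    have eq: "exec thin red block_entry_prog s' = put (Ref 1 (ipick (IVar 0) 9 34) (ipick (IVar 1) 10 35)) (w i j) ?s3"
      unfolding block_entry_prog_def exec.simps(2) 1 2 3 using w3 by (simp add: cell_def)
    have c3: "cost ?s3 \<le> cost s' + (k ^ 3 + 2)"
      using z(2) by simp
    have r3: "ready n m k A ?s3"
      using P ready_cong[of ?s3 s' n m k A] v3 a3 by (auto simp: P_def)
    have "P (exec thin red block_entry_prog s')"
      unfolding eq P_def using P r3 v3[of 9] v3[of 10] a3[of 6] a3[of 9]
      by (simp add: ready_def arrays_put_other P_def del: if_split)
    moreover have "arrays (exec thin red block_entry_prog s') 1 =
        (\<lambda>x y. if x = pick R i \<and> y = pick C j then w i j else arrays s' 1 x y)"
      unfolding eq using pk a3[of 1] by (intro ext) (simp only: arrays_put, simp)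
    ultimately show ?thesis using c3 unfolding eq by simp
  qed
  have vars: "P (set_ivar 34 i s')" "P (set_ivar 35 i s')" if "P s'" for s' i
    using that by (auto simp: P_def)
  have bnd: "ival (IAdd (IVar 2) (INum 1)) (ivars s') = Suc k" if "P s'" for s'
    using that by (auto simp: P_def ready_def)
  have "P s" using s R C by (simp add: P_def)
  note g = run_fill[where P = P and u = 34 and v = 35 and c = block_entry_prog and r = "pick R" and q = "pick C"
      and N = "Suc k" and M = "Suc k" and e = "IAdd (IVar 2) (INum 1)" and f = "IAdd (IVar 2) (INum 1)"
      and t = "k ^ 3 + 2" and b = 1 and w = w and thin = thin and red = red, OF this]
  have inj: "inj_on (pick R) {..<Suc k}" "inj_on (pick C) {..<Suc k}" using R C by (auto intro: inj_on_pick)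
  show "\<And>i j. i < Suc k \<Longrightarrow> j < Suc k \<Longrightarrow> arrays (exec thin red block_prog s) 1 (pick R i) (pick C j) =
      cofactor Y i j * arrays s 9 0 0"
    unfolding block_prog_def w_def[symmetric]
    by (rule g(2)[OF _ _ inj], simp, simp, erule bnd, erule bnd, erule vars(1), erule vars(2),
        rule step; assumption)
  have "cost (exec thin red block_prog s) \<le> cost s + Suc k * Suc k * (k ^ 3 + 2)"
    unfolding block_prog_def
    by (rule g(3)[OF _ _ inj], simp, simp, erule bnd, erule bnd, erule vars(1), erule vars(2), rule step; assumption)
  then show "cost (exec thin red block_prog s) \<le> cost s + (Suc k)\<^sup>2 * (k ^ 3 + 2)" by (simp add: power2_eq_square)
qed

text \<open>The test is on \<open>det Y\<close>, since \<open>det X\<close> cannot be read from the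
  compound and both vanish together. The loops do not stop at a hit, so array 6 may end with the
  cofactors of another pair.\<close>

definition search_prog :: prog where
  "search_prog = For 30 (ipow2 (IVar 0)) (For 31 (ipow2 (IVar 1))
    (IfILess (INum 0)
      (IMul (ieq (icount 30 (IVar 0)) (IAdd (IVar 2) (INum 1))) (ieq (icount 31 (IVar 1)) (IAdd (IVar 2) (INum 1))))
      (Seq (IAssign 9 (IVar 30)) (Seq (IAssign 10 (IVar 31)) (Seq cof_mat_prog
        (Seq (Det (cell 8) 6 (IAdd (IVar 2) (INum 1)))
          (IfRLess (cell 8) (cell 5) (Seq (IAssign 5 (IVar 30)) (IAssign 6 (IVar 31)))
            (IfRLess (cell 5) (cell 8) (Seq (IAssign 5 (IVar 30)) (IAssign 6 (IVar 31))) Skip))))))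
      Skip))"

lemma writes_search_prog [simp]: "wvars search_prog = {5, 6, 9, 10, 11, 12, 21, 22, 30, 31, 32, 33}"
  "warrays search_prog = {4, 6, 8}"
  by (auto simp: search_prog_def cell_def)

lemma card_masks: "card {x. x < 2 ^ n \<and> card (set_decode x) = j} = n choose j"
proof -
  have img: "set_decode ` {..<2 ^ n} = Pow {..<n}" and inj: "inj_on set_decode {..<2 ^ n}"
    using bij_betw_decode[of n] by (auto simp: bij_betw_def)
  have "{S. S \<subseteq> {..<n} \<and> card S = j} = {S \<in> set_decode ` {..<2 ^ n}. card S = j}"
    unfolding img by auto
  also have "\<dots> = set_decode ` {x. x < 2 ^ n \<and> card (set_decode x) = j}" by auto
  finally have "n choose j = card (set_decode ` {x. x < 2 ^ n \<and> card (set_decode x) = j})"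
    using n_subsets[of "{..<n}" j] by simp
  also have "\<dots> = card {x. x < 2 ^ n \<and> card (set_decode x) = j}"
    by (rule card_image, rule inj_on_subset[OF inj]) auto
  finally show ?thesis by simp
qed

lemma run_search_prog:
  assumes s: "ready n m k A s"
    and ex: "R0 \<subseteq> {..<n}" "card R0 = Suc k" "C0 \<subseteq> {..<m}" "card C0 = Suc k" "det (cof_mat A k R0 C0) \<noteq> 0"
  obtains R C where "R \<subseteq> {..<n}" "card R = Suc k" "C \<subseteq> {..<m}" "card C = Suc k" "det (cof_mat A k R C) \<noteq> 0"
    "ivars (exec thin red search_prog s) 5 = set_encode R" "ivars (exec thin red search_prog s) 6 = set_encode C"
    "cost (exec thin red search_prog s) \<le> cost s + (n choose Suc k) * (m choose Suc k) * ((Suc k)\<^sup>2 + Suc k ^ 3)"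
proof -
  let ?run = "exec thin red"
  define good where "good x y \<longleftrightarrow> set_decode x \<subseteq> {..<n} \<and> set_decode y \<subseteq> {..<m} \<and> card (set_decode x) = Suc k \<and>
    card (set_decode y) = Suc k \<and> det (cof_mat A k (set_decode x) (set_decode y)) \<noteq> 0" for x y
  define P where "P X s' \<longleftrightarrow> ready n m k A s' \<and> ((\<exists>(x, y)\<in>X. good x y) \<longrightarrow> good (ivars s' 5) (ivars s' 6))" for X s'
  \<comment> \<open>Only pairs of masks of size \<open>k + 1\<close> are charged: the square for the
    signs of the cofactors, the cube for the determinant. The sum over all masks then collapses to a
    product of binomial coefficients.\<close>
  define t where "t x y = of_bool (card (set_decode x) = Suc k) * (of_bool (card (set_decode y) = Suc k) *
    ((Suc k)\<^sup>2 + Suc k ^ 3))" for x y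
  let ?assign = "Seq (IAssign 5 (IVar 30)) (IAssign 6 (IVar 31))"
  let ?test = "IfRLess (cell 8) (cell 5) ?assign (IfRLess (cell 5) (cell 8) ?assign Skip)"
  let ?body = "IfILess (INum 0)
      (IMul (ieq (icount 30 (IVar 0)) (IAdd (IVar 2) (INum 1))) (ieq (icount 31 (IVar 1)) (IAdd (IVar 2) (INum 1))))
      (Seq (IAssign 9 (IVar 30)) (Seq (IAssign 10 (IVar 31)) (Seq cof_mat_prog
        (Seq (Det (cell 8) 6 (IAdd (IVar 2) (INum 1))) ?test)))) Skip"
  have step: "P (insert (x, y) X) (?run ?body s') \<and> cost (?run ?body s') \<le> cost s' + t x y"
    if P: "P X s'" and xy: "x < 2 ^ n" "y < 2 ^ m" "ivars s' 30 = x" "ivars s' 31 = y" for X s' x y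
  proof -
    let ?K = "set_decode x" and ?L = "set_decode y"
    have KL: "?K \<subseteq> {..<n}" "?L \<subseteq> {..<m}" using decode_subset xy by auto
    have i: "ivars s' 0 = n" "ivars s' 1 = m" "ivars s' 2 = k"
      using P by (auto simp: P_def ready_def)
    have e: "ivars s' 30 = set_encode ?K" "ivars s' 31 = set_encode ?L" using xy by auto
    have cnt: "ival (icount 30 (IVar 0)) (ivars s') = card ?K" "ival (icount 31 (IVar 1)) (ivars s') = card ?L"
      using ival_icount[of ?K "ivars s'" 30 "IVar 0"] ival_icount[of ?L "ivars s'" 31 "IVar 1"]
        e i pos_eq_card_of_subset[OF KL(1)] pos_eq_card_of_subset[OF KL(2)] by auto
    show ?thesis
    proof (cases "card ?K = Suc k \<and> card ?L = Suc k")
      case False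
      then have "\<not> good x y" by (auto simp: good_def)
      moreover have "?run ?body s' = s'"
        unfolding exec.simps ival.simps ival_ieq cnt i using False by auto
      ultimately show ?thesis using P by (auto simp: P_def)
    next
      case True
      let ?s1 = "set_ivar 10 y (set_ivar 9 x s')"
      let ?s2 = "?run cof_mat_prog ?s1"
      have r1: "ready n m k A ?s1" "ivars ?s1 9 = set_encode ?K" "ivars ?s1 10 = set_encode ?L"
        using P by (auto simp: P_def)
      note yb = run_cof_mat_prog[OF r1(1) KL(1) conjunct1[OF True] r1(2) KL(2) conjunct2[OF True] r1(3), of thin red]
      have r2: "ready n m k A ?s2" using r1 ready_run[of cof_mat_prog n m k A thin red ?s1] by simp
      have v2: "ivars ?s2 z = ivars s' z" if "z \<notin> {9, 10, 11, 12, 21, 22, 32, 33}" for z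
        using ivars_run[of z cof_mat_prog thin red ?s1] that by simp
      let ?d = "det (cof_mat A k ?K ?L)"
      let ?s3 = "charge (Suc k ^ 3) (put (cell 8) ?d ?s2)"
      have body: "?run ?body s' = ?run ?test ?s3"
        unfolding exec.simps(2,3,5) ival.simps ival_ieq cnt i using True yb(1) v2[of 2] i xy
        by (simp add: Let_def)
      have r3: "ready n m k A ?s3"
        using r2 ready_cong[of ?s3 ?s2 n m k A] by (simp add: arrays_put_other cell_def)
      have "arrays ?s2 5 0 0 = 0" using r2 by (simp add: ready_def)
      then have test: "?run ?test ?s3 = (if good x y then set_ivar 6 y (set_ivar 5 x ?s3) else ?s3)"
        using True KL v2[of 30] v2[of 31] xy by (auto simp: cell_def arrays_put good_def)
      have c: "cost (?run ?body s') \<le> cost s' + t x y"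
        unfolding body test using yb(2) True by (simp add: t_def)
      have "P (insert (x, y) X) (?run ?body s')"
      proof (cases "good x y")
        case True
        then show ?thesis unfolding body test using r3 by (simp add: P_def)
      next
        case False
        then show ?thesis unfolding body test using r3 P v2[of 5] v2[of 6] by (simp add: P_def)
      qed
      then show ?thesis using c by blast
    qed
  qed
  have vars: "P X (set_ivar 30 i s')" "P X (set_ivar 31 i s')" if "P X s'" for X s' i
    using that by (auto simp: P_def)
  have bnd: "ival (ipow2 (IVar 0)) (ivars s') = 2 ^ n" "ival (ipow2 (IVar 1)) (ivars s') = 2 ^ m" if "P X s'" for X s'
    using that by (auto simp: P_def ready_def)
  have "P {} s" using s by (simp add: P_def)
  note g = run_grid[where P = P and u = 30 and v = 31 and c = ?body and e = "ipow2 (IVar 0)" and N = "2 ^ n"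
    and f = "ipow2 (IVar 1)" and M = "2 ^ m" and t = t and thin = thin and red = red, OF this]
  have P: "P ({..<2 ^ n} \<times> {..<2 ^ m}) (?run search_prog s)"
    unfolding search_prog_def
    by (rule g(1), simp, simp add: cell_def, erule bnd(1), erule bnd(2), erule vars(1), erule vars(2), rule step; assumption)
  have "cost (?run search_prog s) \<le> cost s + (\<Sum>i<(2 :: nat) ^ n. \<Sum>j<(2 :: nat) ^ m. t i j)"
    unfolding search_prog_def
    by (rule g(2), simp, simp add: cell_def, erule bnd(1), erule bnd(2), erule vars(1), erule vars(2), rule step; assumption)
  also have "(\<Sum>i<(2 :: nat) ^ n. \<Sum>j<(2 :: nat) ^ m. t i j) =
      (n choose Suc k) * ((m choose Suc k) * ((Suc k)\<^sup>2 + Suc k ^ 3))"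
    unfolding t_def sum_distrib_left[symmetric] sum_distrib_right[symmetric] sum_of_bool card_masks ..
  finally have cost: "cost (?run search_prog s) \<le>
      cost s + (n choose Suc k) * (m choose Suc k) * ((Suc k)\<^sup>2 + Suc k ^ 3)" by (simp add: mult.assoc)
  have "set_encode R0 < 2 ^ n" "set_encode C0 < 2 ^ m" using ex by (auto intro!: encode_less)
  moreover have "good (set_encode R0) (set_encode C0)"
    using ex finite_subset[OF ex(1)] finite_subset[OF ex(3)] by (simp add: good_def)
  ultimately have "good (ivars (?run search_prog s) 5) (ivars (?run search_prog s) 6)"
    using P unfolding P_def by blast
  then show ?thesis
    using that[of "set_decode (ivars (?run search_prog s) 5)" "set_decode (ivars (?run search_prog s) 6)"]
      cost by (simp add: good_def)
qed

section \<open>Reconstruction and its cost\<close>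

text \<open>The entries of a regular matrix are not all zero. This supplies a starting block inside
  the rows \<open>R\<close> and columns \<open>C\<close>, where the entries are already
  recovered.\<close>

lemma exists_nonzero_minor_of_cof_mat:
  assumes R: "R \<subseteq> {..<n}" "card R = Suc k" and C: "C \<subseteq> {..<m}" "card C = Suc k"
    and d: "det (cof_mat A k R C) \<noteq> 0"
  shows "\<exists>S D. S \<subseteq> R \<and> D \<subseteq> C \<and> card S = k \<and> card D = k \<and> minor A S D \<noteq> 0"
proof (rule ccontr)
  assume none: "\<not> ?thesis"
  note fin = finite_subset[OF R(1) finite_lessThan] finite_subset[OF C(1) finite_lessThan]
  have "cof A R (pick R a) C (pick C b) = 0" if "a < Suc k" "b < Suc k" for a b
  proof -
    have "card (R - {pick R a}) = k" "card (C - {pick C b}) = k"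
      using pick_in[of a R] pick_in[of b C] that R C fin by auto
    then have "minor A (R - {pick R a}) (C - {pick C b}) = 0" using none by blast
    then show ?thesis by (simp add: cof_def)
  qed
  then have "cof_mat A k R C = 0 \<cdot>\<^sub>m 1\<^sub>m (Suc k)" by (intro eq_matI) (auto simp: cof_mat_def)
  then show False using d by simp
qed

lemma sign_inverse: "c \<in> {-1, 1} \<Longrightarrow> c * c = (1 :: real)"
  by auto

text \<open>\<open>cof_mat\<close> depends only on the \<open>k\<close>-minors and so is common to
  \<open>A\<close> and \<open>B\<close>. Recovering from it shows that \<open>c\<close> times
  \<open>A\<close> and \<open>c'\<close> times \<open>B\<close> agree on a block, and the block
  determines the rest.\<close>

lemma eq_up_to_sign:
  assumes A: "A \<in> carrier_mat n m" and B: "B \<in> carrier_mat n m" and k: "1 \<le> k" "k < mrank A"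
    and eq: "compound k A = compound k B"
  obtains c where "c \<in> {-1, 1}" "c ^ k = 1" "A = c \<cdot>\<^sub>m B"
proof -
  have minors: "minor A K L = minor B K L" if "K \<subseteq> {..<n}" "L \<subseteq> {..<m}" "card K = k" "card L = k" for K L
    using that eq compound_eq_iff[OF A B] by blast
  obtain R C where RC: "R \<subseteq> {..<n}" "card R = Suc k" "C \<subseteq> {..<m}" "card C = Suc k"
    and d: "det (cof_mat A k R C) \<noteq> 0"
    using exists_regular_cofactor_matrix[OF A k] unfolding cof_mat_def by metis
  note fin = finite_subset[OF RC(1) finite_lessThan] finite_subset[OF RC(3) finite_lessThan]
  have "cof A R (pick R a) C (pick C b) = cof B R (pick R a) C (pick C b)" if "a < Suc k" "b < Suc k" for a b
  proof -
    have "card (R - {pick R a}) = k" "card (C - {pick C b}) = k"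
      using pick_in[of a R] pick_in[of b C] that RC fin by auto
    moreover have "R - {pick R a} \<subseteq> {..<n}" "C - {pick C b} \<subseteq> {..<m}" using RC by auto
    ultimately show ?thesis unfolding cof_def using minors by simp
  qed
  then have YB: "cof_mat A k R C = mat (Suc k) (Suc k) (\<lambda>(a, b). cof B R (pick R a) C (pick C b))"
    unfolding cof_mat_def by (intro eq_matI) auto
  obtain c where c: "c \<in> {-1, 1}" "c ^ k = 1" "\<And>a b. a < Suc k \<Longrightarrow> b < Suc k \<Longrightarrow>
      cofactor (cof_mat A k R C) a b * root k (det (cof_mat A k R C)) / det (cof_mat A k R C) = c * A $$ (pick R a, pick C b)"
    using recover_submatrix[OF A RC k(1) cof_mat_def d] by metis
  obtain c' where c': "c' \<in> {-1, 1}" "c' ^ k = 1" "\<And>a b. a < Suc k \<Longrightarrow> b < Suc k \<Longrightarrow>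
      cofactor (cof_mat A k R C) a b * root k (det (cof_mat A k R C)) / det (cof_mat A k R C) = c' * B $$ (pick R a, pick C b)"
    using recover_submatrix[OF B RC k(1) YB d] by metis
  obtain S D where SD: "S \<subseteq> R" "D \<subseteq> C" "card S = k" "card D = k" "minor A S D \<noteq> 0"
    using exists_nonzero_minor_of_cof_mat[OF RC d] by blast
  have SD': "S \<subseteq> {..<n}" "D \<subseteq> {..<m}" using SD RC by auto
  have "c \<cdot>\<^sub>m A = c' \<cdot>\<^sub>m B"
  proof (rule eq_of_minors_eq[OF _ _ k(1) SD' SD(3,4)])
    show "c \<cdot>\<^sub>m A \<in> carrier_mat n m" "c' \<cdot>\<^sub>m B \<in> carrier_mat n m" using A B by auto
    show "minor (c \<cdot>\<^sub>m A) S D \<noteq> 0" using minor_smult[OF A SD'] SD c by simp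
    \<comment> \<open>Multiplication by a sign with \<open>k\<close>-th power 1 changes no
      \<open>k\<close>-minor.\<close>
    show "minor (c \<cdot>\<^sub>m A) K L = minor (c' \<cdot>\<^sub>m B) K L"
      if "K \<subseteq> {..<n}" "L \<subseteq> {..<m}" "card K = k" "card L = k" for K L
      using minor_smult[OF A that(1,2)] minor_smult[OF B that(1,2)] minors that c c' by simp
    fix x y assume xy: "x \<in> S" "y \<in> D"
    then have xy': "x \<in> R" "y \<in> C" using SD by auto
    then have lt: "x < n" "y < m" using RC by auto
    have p: "pos R x < Suc k" "pos C y < Suc k"
      using pos_less[OF fin(1)] pos_less[OF fin(2)] xy' RC by auto
    show "(c \<cdot>\<^sub>m A) $$ (x, y) = (c' \<cdot>\<^sub>m B) $$ (x, y)"
      using c(3)[OF p] c'(3)[OF p] A B lt xy' by (simp add: pick_pos)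
  qed
  then have cc: "(c \<cdot>\<^sub>m A) $$ (i, j) = (c' \<cdot>\<^sub>m B) $$ (i, j)" for i j by simp
  have "A = (c * c') \<cdot>\<^sub>m B"
  proof (rule eq_matI)
    fix i j assume "i < dim_row ((c * c') \<cdot>\<^sub>m B)" "j < dim_col ((c * c') \<cdot>\<^sub>m B)"
    then have "c * A $$ (i, j) = c' * B $$ (i, j)" using cc[of i j] A B by simp
    then have "c * c * A $$ (i, j) = c * c' * B $$ (i, j)" by (simp add: mult.assoc)
    then show "A $$ (i, j) = ((c * c') \<cdot>\<^sub>m B) $$ (i, j)"
      using \<open>i < _\<close> \<open>j < _\<close> sign_inverse[OF c(1)] by simp
  qed (use A B in auto)
  moreover have "c * c' \<in> {-1, 1}" using c c' by auto
  moreover have "(c * c') ^ k = 1" using c c' by (simp add: power_mult_distrib)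
  ultimately show ?thesis using that by blast
qed

text \<open>For the harder inclusion, a given \<open>B\<close> and a suitable
  \<open>U * T * transpose_mat V\<close> are made to agree on one nonsingular block; having the same
  \<open>k\<close>-minors, they coincide.\<close>

lemma inverse_compounds_full_rank:
  assumes U: "U \<in> carrier_mat n k" and V: "V \<in> carrier_mat m k" and A: "A = U * transpose_mat V"
    and k: "1 \<le> k" "k \<le> mrank A"
  shows "{U * T * transpose_mat V | T. T \<in> carrier_mat k k \<and> det T = 1} = inverse_compounds n m k (compound k A)"
proof (intro equalityI subsetI)
  have Ac: "A \<in> carrier_mat n m" using A U V by simp
  have 1: "compound k (U * T * transpose_mat V) = compound k A" if "T \<in> carrier_mat k k" "det T = 1" for T
  proof -
    have "U * T * transpose_mat V \<in> carrier_mat n m" using U V that by simp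
    then show ?thesis
      using compound_eq_iff[of "U * T * transpose_mat V" n m A k] Ac minor_factor[OF U V that(1)] that(2) A
      by simp
  qed
  {
    fix B assume "B \<in> {U * T * transpose_mat V | T. T \<in> carrier_mat k k \<and> det T = 1}"
    then show "B \<in> inverse_compounds n m k (compound k A)"
      unfolding inverse_compounds_def using 1 U V by auto
  next
    fix B assume "B \<in> inverse_compounds n m k (compound k A)"
    then have B: "B \<in> carrier_mat n m" "compound k B = compound k A" by (auto simp: inverse_compounds_def)
    obtain S D where SD: "S \<subseteq> {..<n}" "D \<subseteq> {..<m}" "card S = k" "card D = k" "minor A S D \<noteq> 0"
      using exists_nonzero_minor[OF Ac k(2)] by blast
    have fin: "finite S" "finite D" using SD finite_subset by auto
    have BA: "minor B S D = minor A S D" using B(2) compound_eq_iff[OF B(1) Ac] SD by blast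
    have "submatrix B S D \<in> carrier_mat k k" using submatrix_dims[OF B(1) SD(1,2)] SD by simp
    moreover have "det (submatrix B S D) = minor (U * transpose_mat V) S D" using BA A by (simp add: minor_def)
    ultimately obtain T where T: "T \<in> carrier_mat k k" "det T = 1"
      "submatrix (U * T * transpose_mat V) S D = submatrix B S D"
      using exists_factor[OF U V SD(1-4)] SD(5) A by metis
    have C: "U * T * transpose_mat V \<in> carrier_mat n m" using U V T by simp
    have "B = U * T * transpose_mat V"
    proof (rule eq_of_minors_eq[OF B(1) C k(1) SD(1-4)])
      show "minor B S D \<noteq> 0" using BA SD by simp
      show "minor B K L = minor (U * T * transpose_mat V) K L"
        if "K \<subseteq> {..<n}" "L \<subseteq> {..<m}" "card K = k" "card L = k" for K L
        using compound_eq_iff[OF B(1) C, of k] 1[OF T(1,2)] B(2) that by metis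
      fix x y assume xy: "x \<in> S" "y \<in> D"
      have p: "pos S x < card S" "pos D y < card D" using pos_less fin xy by auto
      show "B $$ (x, y) = (U * T * transpose_mat V) $$ (x, y)"
        using submatrix_nth[OF B(1) SD(1,2) p] submatrix_nth[OF C SD(1,2) p] T(3) xy by (simp add: pick_pos)
    qed
    then show "B \<in> {U * T * transpose_mat V | T. T \<in> carrier_mat k k \<and> det T = 1}" using T by blast
  }
qed

section \<open>The program for ranks above \<open>k\<close>\<close>

definition negate_prog :: prog where
  "negate_prog = For 30 (IVar 0) (For 31 (IVar 1)
    (Op Sub (Ref 2 (IVar 30) (IVar 31)) (cell 5) (Ref 1 (IVar 30) (IVar 31))))"

lemma writes_negate_prog [simp]: "wvars negate_prog = {30, 31}" "warrays negate_prog = {2}"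
  by (auto simp: negate_prog_def)

lemma run_negate_prog:
  assumes s: "ready n m k A s"
  shows "\<And>i j. i < n \<Longrightarrow> j < m \<Longrightarrow> arrays (exec thin red negate_prog s) 2 i j = - arrays s 1 i j"
    and "cost (exec thin red negate_prog s) \<le> cost s + n * m"
proof -
  define P where "P s' \<longleftrightarrow> ready n m k A s' \<and> arrays s' 1 = arrays s 1" for s'
  define w where "w i j = - arrays s 1 i j" for i j
  let ?body = "Op Sub (Ref 2 (IVar 30) (IVar 31)) (cell 5) (Ref 1 (IVar 30) (IVar 31))"
  have step: "P (exec thin red ?body s') \<and> cost (exec thin red ?body s') \<le> cost s' + 1 \<and>
      arrays (exec thin red ?body s') 2 = (\<lambda>x y. if x = id i \<and> y = id j then w i j else arrays s' 2 x y)"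
    if P: "P s'" and ij: "i < n" "j < m" "ivars s' 30 = i" "ivars s' 31 = j" for s' i j
    using P ij by (simp add: P_def ready_def cell_def w_def arrays_put fun_eq_iff)
  have vars: "P (set_ivar 30 i s')" "P (set_ivar 31 i s')" if "P s'" for s' i
    using that by (auto simp: P_def)
  have bnd: "ival (IVar 0) (ivars s') = n" "ival (IVar 1) (ivars s') = m" if "P s'" for s'
    using that by (auto simp: P_def ready_def)
  have "P s" using s by (simp add: P_def)
  note g = run_fill[where P = P and u = 30 and v = 31 and c = ?body and r = id and q = id
      and N = n and M = m and e = "IVar 0" and f = "IVar 1"
      and t = 1 and b = 2 and w = w and thin = thin and red = red, OF this]
  have "arrays (exec thin red negate_prog s) 2 (id i) (id j) = w i j" if "i < n" "j < m" for i j
    unfolding negate_prog_def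
    by (rule g(2)[OF _ _ _ _ _ _ _ _ _ that], simp, simp, simp, simp, erule bnd(1), erule bnd(2), erule vars(1),
        erule vars(2), rule step; assumption)
  then show "\<And>i j. i < n \<Longrightarrow> j < m \<Longrightarrow> arrays (exec thin red negate_prog s) 2 i j = - arrays s 1 i j"
    by (simp add: w_def)
  have "cost (exec thin red negate_prog s) \<le> cost s + n * m * 1"
    unfolding negate_prog_def
    by (rule g(3), simp, simp, simp, simp, erule bnd(1), erule bnd(2), erule vars(1), erule vars(2), rule step; assumption)
  then show "cost (exec thin red negate_prog s) \<le> cost s + n * m" by simp
qed

text \<open>The cofactor matrix is computed anew because the search ran on after its hit. Cell 9
  receives the factor \<open>root k (det Y) / det Y\<close>. Variable 0 is overwritten last, since
  until then it holds \<open>n\<close>; its final value is 1 for odd and 2 for even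
  \<open>k\<close>.\<close>

definition reconstruct_prog :: prog where
  "reconstruct_prog = Seq search_prog (Seq (IAssign 9 (IVar 5)) (Seq (IAssign 10 (IVar 6)) (Seq cof_mat_prog
    (Seq (Det (cell 8) 6 (IAdd (IVar 2) (INum 1))) (Seq (Root (cell 9) (IVar 2) (cell 8))
    (Seq (Op Div (cell 9) (cell 9) (cell 8)) (Seq block_prog (Seq find_prog (Seq complete_prog (Seq negate_prog
    (IAssign 0 (ISub (INum 2) (IMod (IVar 2) (INum 2))))))))))))))"

lemma signed_multiples:
  assumes c: "c \<in> {-1, 1}" "c ^ k = (1 :: real)"
  shows "set (map (\<lambda>t. if t = 0 then c \<cdot>\<^sub>m A else - c \<cdot>\<^sub>m A) [0..<2 - k mod 2]) =
    {c \<cdot>\<^sub>m A | c. c \<in> {-1, 1} \<and> c ^ k = 1}"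
proof (cases "even k")
  case True
  then have "[0..<2 - k mod 2] = [0, 1]" by (simp add: upt_rec even_iff_mod_2_eq_zero)
  then show ?thesis using True c by auto
next
  case False
  then have "[0..<2 - k mod 2] = [0]" by (simp add: upt_rec odd_iff_mod_2_eq_one)
  moreover have "c = 1" using False c by auto
  ultimately show ?thesis using False by auto
qed

text \<open>The sign \<open>c\<close> comes from the root and stays unknown to the program, but
  after \<open>block_prog\<close> the state is treated as that of a run on \<open>c\<close> times
  \<open>A\<close>. The negated copy supplies the other multiple when \<open>k\<close> is
  even.\<close>

lemma run_reconstruct_prog:
  assumes A: "A \<in> carrier_mat n m" and k: "1 \<le> k" "k < mrank A"
  shows "set (outputs n m (exec thin red reconstruct_prog (initial n m k (compound k A)))) =
      {c \<cdot>\<^sub>m A | c. c \<in> {-1, 1} \<and> c ^ k = 1}"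
    and "cost (exec thin red reconstruct_prog (initial n m k (compound k A))) \<le>
      (n choose Suc k) * (m choose Suc k) * ((Suc k)\<^sup>2 + Suc k ^ 3) + ((Suc k)\<^sup>2 + Suc k ^ 3 + 2)
      + (Suc k)\<^sup>2 * (k ^ 3 + 2) + 2 * (n * m * (6 * max n m + 2)) + n * m"
proof -
  let ?run = "exec thin red"
  let ?s0 = "initial n m k (compound k A)"
  have r0: "ready n m k A ?s0" by (rule ready_initial[OF A])
  obtain R0 C0 where RC0: "R0 \<subseteq> {..<n}" "card R0 = Suc k" "C0 \<subseteq> {..<m}" "card C0 = Suc k"
    "det (cof_mat A k R0 C0) \<noteq> 0"
    using exists_regular_cofactor_matrix[OF A k] unfolding cof_mat_def by metis
  obtain R C where RC: "R \<subseteq> {..<n}" "card R = Suc k" "C \<subseteq> {..<m}" "card C = Suc k"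
    and d: "det (cof_mat A k R C) \<noteq> 0"
    and v5: "ivars (?run search_prog ?s0) 5 = set_encode R" "ivars (?run search_prog ?s0) 6 = set_encode C"
    and c0: "cost (?run search_prog ?s0) \<le>
      cost ?s0 + (n choose Suc k) * (m choose Suc k) * ((Suc k)\<^sup>2 + Suc k ^ 3)"
    by (rule run_search_prog[OF r0 RC0])
  note fin = finite_subset[OF RC(1) finite_lessThan] finite_subset[OF RC(3) finite_lessThan]
  define s1 where "s1 = set_ivar 10 (set_encode C) (set_ivar 9 (set_encode R) (?run search_prog ?s0))"
  have s1_eq: "?run (IAssign 10 (IVar 6)) (?run (IAssign 9 (IVar 5)) (?run search_prog ?s0)) = s1"
    using v5 by (simp add: s1_def)
  have r1: "ready n m k A s1"
    using r0 ready_run[of search_prog n m k A thin red ?s0] by (simp add: s1_def)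
  have v1: "ivars s1 9 = set_encode R" "ivars s1 10 = set_encode C" "ivars s1 5 = set_encode R" "ivars s1 6 = set_encode C"
    using v5 by (simp_all add: s1_def)
  define s2 where "s2 = ?run cof_mat_prog s1"
  note yb = run_cof_mat_prog[OF r1 RC(1,2) v1(1) RC(3,4) v1(2), of thin red, folded s2_def]
  have r2: "ready n m k A s2" using r1 ready_run[of cof_mat_prog n m k A thin red s1] by (simp add: s2_def)
  have v2: "ivars s2 z = ivars s1 z" if "z \<notin> {11, 12, 21, 22, 32, 33}" for z
    using ivars_run[of z cof_mat_prog thin red s1] that by (simp add: s2_def)
  let ?Y = "cof_mat A k R C"
  define s3 where "s3 = charge 1 (put (cell 9) (root k (det ?Y) / det ?Y) (charge 1 (put (cell 9) (root k (det ?Y))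
    (charge (Suc k ^ 3) (put (cell 8) (det ?Y) s2)))))"
  have k2: "ivars s2 2 = k" using r2 by (simp add: ready_def)
  have s3: "?run (Op Div (cell 9) (cell 9) (cell 8)) (?run (Root (cell 9) (IVar 2) (cell 8))
      (?run (Det (cell 8) 6 (IAdd (IVar 2) (INum 1))) s2)) = s3"
    using yb(1) k2 by (simp add: s3_def Let_def cell_def arrays_put)
  have r3: "ready n m k A s3"
    using r2 ready_cong[of s3 s2 n m k A] by (simp add: s3_def arrays_put_other cell_def)
  have v3: "ivars s3 = ivars s2" by (simp add: s3_def)
  have Y3: "get_block 6 (Suc k) (Suc k) s3 = ?Y"
    using yb(1) by (simp add: s3_def get_block_def arrays_put_other cell_def)
  define s4 where "s4 = ?run block_prog s3"
  have v39: "ivars s3 9 = set_encode R" "ivars s3 10 = set_encode C" using v3 v2 v1 by auto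
  note xb = run_block_prog[OF r3 RC(1,2) v39(1) RC(3,4) v39(2) Y3, where thin = thin and red = red, folded s4_def]
  obtain c where c: "c \<in> {-1, 1}" "c ^ k = 1" "\<And>a b. a < Suc k \<Longrightarrow> b < Suc k \<Longrightarrow>
      cofactor ?Y a b * root k (det ?Y) / det ?Y = c * A $$ (pick R a, pick C b)"
    using recover_submatrix[OF A RC k(1) cof_mat_def d] by metis
  let ?B = "c \<cdot>\<^sub>m A"
  have B: "?B \<in> carrier_mat n m" using A by simp
  have minors: "minor ?B K L = minor A K L" if "K \<subseteq> {..<n}" "L \<subseteq> {..<m}" "card K = k" "card L = k" for K L
    using minor_smult[OF A that(1,2)] that c by simp
  \<comment> \<open>As \<open>c ^ k = 1\<close>, the input is also the compound of
    \<open>?B\<close>.\<close>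
  have r4: "ready n m k ?B s4"
    using r3 ready_run[of block_prog n m k A thin red s3] minors by (simp add: s4_def ready_def)
  have v4: "ivars s4 5 = set_encode R" "ivars s4 6 = set_encode C"
    using ivars_run[of _ block_prog thin red s3] v3 v2 v1 by (auto simp: s4_def)
  have s39: "arrays s3 9 0 0 = root k (det ?Y) / det ?Y" by (simp add: s3_def cell_def arrays_put)
  have k4: "knows ?B (R \<times> C) s4"
  proof (rule knows_pickI[OF fin(1) RC(2) fin(2) RC(4)])
    fix i j assume ij: "i < Suc k" "j < Suc k"
    then have "pick R i < n" "pick C j < m" using pick_in[of i R] pick_in[of j C] RC by auto
    then show "arrays s4 1 (pick R i) (pick C j) = ?B $$ (pick R i, pick C j)"
      using xb(1)[OF ij] c(3)[OF ij] A s39 by simp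
  qed
  have "\<exists>S D. S \<subseteq> R \<and> D \<subseteq> C \<and> card S = k \<and> card D = k \<and> minor ?B S D \<noteq> 0"
  proof -
    obtain S D where "S \<subseteq> R" "D \<subseteq> C" "card S = k" "card D = k" "minor A S D \<noteq> 0"
      using exists_nonzero_minor_of_cof_mat[OF RC d] by blast
    then show ?thesis using minors[of S D] RC by (intro exI[of _ S] exI[of _ D]) auto
  qed
  then obtain S D where SD: "S \<subseteq> R" "D \<subseteq> C" "card S = k" "card D = k" "minor ?B S D \<noteq> 0"
    and v5: "ivars (?run find_prog s4) 3 = set_encode S" "ivars (?run find_prog s4) 4 = set_encode D"
    and c5: "cost (?run find_prog s4) \<le> cost s4"
    by (rule run_find_prog[OF r4 RC(1) v4(1) RC(3) v4(2)])
  have SD': "S \<subseteq> {..<n}" "D \<subseteq> {..<m}" using SD RC by auto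
  define s5 where "s5 = ?run find_prog s4"
  have r5: "ready n m k ?B s5" using r4 ready_run[of find_prog n m k ?B thin red s4] by (simp add: s5_def)
  have "arrays s5 1 = arrays s4 1" using arrays_run[of 1 find_prog thin red s4] by (simp add: s5_def)
  then have k5: "knows ?B (S \<times> D) s5" using k4 SD by (auto simp: knows_def)
  note cp = run_complete_prog[OF B SD' SD(3,4,5) r5 v5[folded s5_def] k5 k(1), of thin red]
  define s6 where "s6 = ?run complete_prog s5"
  have r6: "ready n m k ?B s6" using r5 ready_run[of complete_prog n m k ?B thin red s5] by (simp add: s6_def)
  note ng = run_negate_prog[OF r6, where thin = thin and red = red]
  define s7 where "s7 = ?run negate_prog s6"
  have a7: "arrays s7 1 = arrays s6 1" "ivars s7 2 = k"
    using arrays_run[of 1 negate_prog thin red s6] ivars_run[of 2 negate_prog thin red s6] r6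
    by (simp_all add: s7_def ready_def)
  have eq: "?run reconstruct_prog ?s0 = set_ivar 0 (2 - k mod 2) s7"
  proof -
    have "?run (IAssign 0 (ISub (INum 2) (IMod (IVar 2) (INum 2)))) s7 = set_ivar 0 (2 - k mod 2) s7"
      using a7(2) by simp
    then show ?thesis
      unfolding reconstruct_prog_def exec.simps(2) s1_eq s2_def[symmetric] s3 s4_def[symmetric]
        s5_def[symmetric] s6_def[symmetric] s7_def[symmetric] .
  qed
  have kB: "knows ?B ({..<n} \<times> {..<m}) s6" using cp(1) by (simp add: s6_def)
  have out1: "get_block 1 n m (set_ivar 0 i s7) = ?B" for i
    using get_block_knows[OF B kB] a7(1) by (simp add: get_block_def)
  have out2: "get_block 2 n m (set_ivar 0 i s7) = - c \<cdot>\<^sub>m A" for i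
  proof (rule eq_matI)
    fix x y assume "x < dim_row (- c \<cdot>\<^sub>m A)" "y < dim_col (- c \<cdot>\<^sub>m A)"
    then have "x < n" "y < m" using A by auto
    then show "get_block 2 n m (set_ivar 0 i s7) $$ (x, y) = (- c \<cdot>\<^sub>m A) $$ (x, y)"
      using ng(1)[of x y] kB A by (simp add: get_block_def s7_def knows_def)
  qed (use A in \<open>auto simp: get_block_def\<close>)
  have "outputs n m (?run reconstruct_prog ?s0) =
      map (\<lambda>t. if t = 0 then c \<cdot>\<^sub>m A else - c \<cdot>\<^sub>m A) [0..<2 - k mod 2]"
    unfolding eq outputs_def
  proof (rule map_cong)
    fix t assume "t \<in> set [0..<2 - k mod 2]"
    then have "t = 0 \<or> t = 1" by auto
    then show "get_block (Suc t) n m (set_ivar 0 (2 - k mod 2) s7) = (if t = 0 then c \<cdot>\<^sub>m A else - c \<cdot>\<^sub>m A)"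
      using out1 out2 by (auto simp: numeral_2_eq_2)
  qed simp
  then show "set (outputs n m (?run reconstruct_prog ?s0)) = {c \<cdot>\<^sub>m A | c. c \<in> {-1, 1} \<and> c ^ k = 1}"
    using signed_multiples[OF c(1,2)] by simp
  have "cost s1 = cost (?run search_prog ?s0)" "cost s3 = cost s2 + Suc k ^ 3 + 2"
    by (simp_all add: s1_def s3_def)
  moreover have "cost s6 \<le> cost s5 + 2 * (n * m * (6 * max n m + 2))"
    using cp(2) by (auto simp: s6_def split: if_splits)
  moreover have "cost ?s0 = 0" "cost (set_ivar 0 (2 - k mod 2) s7) = cost s7"
    by (simp_all add: initial_simps)
  moreover have "cost s7 \<le> cost s6 + n * m" "cost s5 \<le> cost s4"
    using ng(2) c5 by (simp_all add: s7_def s5_def)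
  ultimately show "cost (?run reconstruct_prog ?s0) \<le>
      (n choose Suc k) * (m choose Suc k) * ((Suc k)\<^sup>2 + Suc k ^ 3) + ((Suc k)\<^sup>2 + Suc k ^ 3 + 2)
      + (Suc k)\<^sup>2 * (k ^ 3 + 2) + 2 * (n * m * (6 * max n m + 2)) + n * m"
    unfolding eq using c0 yb(2) xb(2) by linarith
qed


section \<open>Cost estimates\<close>

lemma le_choose: "1 \<le> k \<Longrightarrow> k < p \<Longrightarrow> p \<le> p choose k"
proof (induction p arbitrary: k)
  case (Suc p)
  then obtain l where l: "k = Suc l" by (cases k) auto
  show ?case
  proof (cases "k = p")
    case True
    then show ?thesis by (simp add: l)
  next
    case False
    then have "p \<le> p choose k" using Suc by simp
    moreover have "1 \<le> p choose l" using Suc.prems l by (simp add: Suc_le_eq)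
    ultimately show ?thesis by (simp add: l)
  qed
qed simp

lemma choose_Suc_times: "(p choose Suc k) * Suc k = (p choose k) * (p - k)"
  using binomial_absorption[of k p] binomial_absorb_comp[of p k] by (simp add: mult.commute)

text \<open>The four parts contribute 3, 4, 3 and 17 times \<open>X\<close>. The search is the
  critical one, since it deals with sets of size \<open>k + 1\<close> while the bound speaks of size
  \<open>k\<close>: two factors \<open>k + 1\<close> from the cost of a pair turn the larger
  binomials into \<open>N * (p - k)\<close>.\<close>

lemma reconstruct_cost_le:
  fixes n m k p :: nat
  assumes "n \<le> p" "m \<le> p" and k: "1 \<le> k" "k < p"
  shows "(n choose Suc k) * (m choose Suc k) * ((Suc k)\<^sup>2 + Suc k ^ 3) + ((Suc k)\<^sup>2 + Suc k ^ 3 + 2)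
      + (Suc k)\<^sup>2 * (k ^ 3 + 2) + 2 * (n * m * (6 * max n m + 2)) + n * m \<le>
      27 * ((p choose k) ^ 3 * p * k)"
proof -
  define N where "N = p choose k"
  define q where "q = p choose Suc k"
  have N: "p \<le> N" unfolding N_def by (rule le_choose[OF k])
  define X where "X = N ^ 3 * p * k"
  have cube: "p ^ 3 \<le> X"
  proof -
    have "p ^ 3 * 1 * 1 \<le> N ^ 3 * p * k" using N k by (intro mult_mono power_mono) auto
    then show ?thesis by (simp add: X_def)
  qed
  have p4: "p ^ 3 * p * k \<le> X"
    unfolding X_def using N by (intro mult_mono power_mono) auto
  have sq: "p\<^sup>2 \<le> p ^ 3" "1 \<le> p ^ 3" using k by (auto intro: power_increasing)
  have 1: "(n choose Suc k) * (m choose Suc k) * ((Suc k)\<^sup>2 + Suc k ^ 3) \<le> 3 * X"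
  proof -
    have "(n choose Suc k) * (m choose Suc k) * ((Suc k)\<^sup>2 + Suc k ^ 3) \<le> q * q * ((Suc k)\<^sup>2 + Suc k ^ 3)"
      unfolding q_def using assms by (intro mult_mono binomial_right_mono) auto
    also have "\<dots> = (q * Suc k) * (q * Suc k) * (k + 2)"
      by (simp add: power2_eq_square power3_eq_cube algebra_simps)
    also have "q * Suc k = N * (p - k)"
      unfolding q_def N_def by (rule choose_Suc_times)
    \<comment> \<open>One factor \<open>p - k\<close> is bounded by \<open>p\<close>, the other by
      \<open>N\<close>, and \<open>k + 2 \<le> 3 * k\<close>.\<close>
    also have "N * (p - k) * (N * (p - k)) * (k + 2) \<le> N * p * (N * N) * (3 * k)"
      using k N by (intro mult_mono) auto
    also have "\<dots> = 3 * X" by (simp add: X_def power3_eq_cube algebra_simps)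
    finally show ?thesis .
  qed
  have 2: "(Suc k)\<^sup>2 + Suc k ^ 3 + 2 \<le> 4 * X"
  proof -
    have "(Suc k)\<^sup>2 \<le> p\<^sup>2" "Suc k ^ 3 \<le> p ^ 3" using k by (auto intro: power_mono)
    then show ?thesis using sq cube by linarith
  qed
  have 3: "(Suc k)\<^sup>2 * (k ^ 3 + 2) \<le> 3 * X"
  proof -
    have "k ^ 3 + 2 \<le> 3 * k ^ 3" using k by simp
    then have "(Suc k)\<^sup>2 * (k ^ 3 + 2) \<le> p\<^sup>2 * (3 * k ^ 3)"
      using k by (intro mult_mono power_mono) auto
    also have "\<dots> = 3 * (p\<^sup>2 * (k * k) * k)" by (simp add: power3_eq_cube algebra_simps)
    also have "\<dots> \<le> 3 * (p\<^sup>2 * (p * p) * k)" using k by (intro mult_mono) auto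
    also have "\<dots> = 3 * (p ^ 3 * p * k)" by (simp add: power2_eq_square power3_eq_cube algebra_simps)
    finally show ?thesis using p4 by linarith
  qed
  have nm: "n * m \<le> p\<^sup>2" using assms by (simp add: power2_eq_square mult_mono)
  have "n * m * (6 * max n m + 2) \<le> p\<^sup>2 * (6 * p + 2 * p)"
    using nm assms k by (intro mult_mono) auto
  also have "\<dots> = 8 * p ^ 3" by (simp add: power2_eq_square power3_eq_cube)
  finally have 4: "2 * (n * m * (6 * max n m + 2)) + n * m \<le> 17 * X"
    using nm sq cube by linarith
  show ?thesis using 1 2 3 4 unfolding X_def N_def by linarith
qed

text \<open>The constant is \<open>2 * 8\<close>, from two phases and
  \<open>6 * p + 2 \<le> 8 * p\<close>. One factor \<open>p\<close> of the cube is absorbed by the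
  binomial coefficient, which is possible because a cost arises only for
  \<open>k < p\<close>.\<close>

lemma full_rank_cost_le:
  fixes n m k p :: nat
  assumes k: "1 \<le> k" and p: "p = max m n"
  shows "(if k < max n m then 2 * (n * m * (6 * max n m + 2)) else 0) \<le> 16 * ((p choose k) * p\<^sup>2)"
proof (cases "k < p")
  case True
  have "n * m * (6 * max n m + 2) \<le> p * p * (6 * p + 2 * p)"
    using p True by (intro mult_mono) auto
  also have "\<dots> = 8 * (p * p\<^sup>2)" by (simp add: power2_eq_square)
  also have "\<dots> \<le> 8 * ((p choose k) * p\<^sup>2)"
    using le_choose[OF k True] by (intro mult_mono) auto
  finally show ?thesis by simp
qed (simp add: p max.commute)

text \<open>The bound \<open>t\<close> is left open so that both ranges of \<open>k\<close> can use
  the lemma with their own bound.\<close>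

lemma reconstruct_returns:
  fixes n m k p :: nat
  assumes A: "A \<in> carrier_mat n m" and k: "1 \<le> k" "k < mrank A" and p: "p = max m n"
    and t: "27 * (real (p choose k) ^ 3 * real p * real k) \<le> t"
  shows "returns reconstruct_prog n m k (compound k A)
    (\<lambda>Bs. set Bs = {c \<cdot>\<^sub>m A | c. c \<in> {-1, 1} \<and> c ^ k = 1}) t"
proof -
  \<comment> \<open>A nonzero minor of size \<open>k + 1\<close> shows \<open>k < n\<close>, hence
    \<open>k < p\<close>.\<close>
  obtain R C where "R \<subseteq> {..<n}" "card R = Suc k"
    using exists_nonzero_minor[OF A, of "Suc k"] k by auto
  then have "Suc k \<le> n" using card_mono[of "{..<n}" R] by simp
  then have kp: "k < p" using p by simp
  have "cost (exec thin red reconstruct_prog (initial n m k (compound k A))) \<le> 27 * ((p choose k) ^ 3 * p * k)"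
    for thin red
    by (rule order_trans[OF run_reconstruct_prog(2)[OF A k] reconstruct_cost_le]) (use kp k p in auto)
  then have "real (cost (exec thin red reconstruct_prog (initial n m k (compound k A)))) \<le>
      real (27 * ((p choose k) ^ 3 * p * k))" for thin red
    by (rule of_nat_mono)
  moreover have "real (27 * ((p choose k) ^ 3 * p * k)) \<le> t" using t by simp
  ultimately have "real (cost (exec thin red reconstruct_prog (initial n m k (compound k A)))) \<le> t" for thin red
    by (rule order_trans)
  then show ?thesis
    using run_reconstruct_prog(1)[OF A k] by (simp add: returns_def Let_def)
qed

lemma full_rank_returns:
  fixes n m k p :: nat
  assumes U: "U \<in> carrier_mat n k" and V: "V \<in> carrier_mat m k" and A: "A = U * transpose_mat V"
    and k: "1 \<le> k" "k \<le> mrank A" and p: "p = max m n"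
  shows "returns full_rank_prog n m k (compound k A)
    (\<lambda>Bs. \<exists>B. Bs = [B] \<and> B \<in> {U * T * transpose_mat V | T. T \<in> carrier_mat k k \<and> det T = 1})
    (16 * (real (p choose k) * real p ^ 2))"
proof -
  have "cost (exec thin red full_rank_prog (initial n m k (compound k A))) \<le> 16 * ((p choose k) * p\<^sup>2)" for thin red
    by (rule order_trans[OF run_full_rank_prog(2)[OF U V A k] full_rank_cost_le[OF k(1) p]])
  then have "real (cost (exec thin red full_rank_prog (initial n m k (compound k A)))) \<le>
      real (16 * ((p choose k) * p\<^sup>2))" for thin red
    by (rule of_nat_mono)
  then show ?thesis
    using run_full_rank_prog(1)[OF U V A k] unfolding returns_def Let_def by fastforce
qed

theorem theorem1:
  shows
   "(\<forall>(n::nat) (m::nat) (k::nat) (A :: real mat) (B :: real mat).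
       A \<in> carrier_mat n m \<and> B \<in> carrier_mat n m \<and> 1 \<le> k \<and> k \<le> min n m \<and>
       k < mrank A \<and> compound k A = compound k B \<longrightarrow>
         (odd k \<longrightarrow> A = B) \<and> (even k \<longrightarrow> A = B \<or> A = - B))
    \<and>
    (\<exists>(P :: prog) (C :: real).
       \<forall>(n::nat) (m::nat) (k::nat) (A :: real mat) (p::nat) (r::nat).
         A \<in> carrier_mat n m \<and> 1 \<le> k \<and> k \<le> min n m \<and> p = max m n \<and> r = mrank A \<and> k < r \<longrightarrow>
           (let returns_within = returns P n m k (compound k A)
                   (\<lambda>Bs. set Bs = {c \<cdot>\<^sub>m A | c. c \<in> {-1, 1} \<and> c ^ k = 1})
            in (int k \<le> \<lceil>real r / 2\<rceil> \<longrightarrow>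
                  returns_within
                    (C * (real (p choose k) ^ 3 * real p * real k + real (r choose k) * 2 ^ r)))
             \<and> (\<lceil>real r / 2\<rceil> < int k \<longrightarrow>
                  returns_within
                    (C * (real (p choose k) ^ 3 * real p * real k + real (r choose k) * 2 ^ r
                          + real (r choose nat \<lceil>real r / 2\<rceil>) ^ 2
                              * real p * real k ^ 2 * log 2 (real r))))))
    \<and>
    (\<forall>(n::nat) (m::nat) (k::nat) (A :: real mat) (r::nat) (U :: real mat) (V :: real mat).
       A \<in> carrier_mat n m \<and> 1 \<le> k \<and> k \<le> min n m \<and> r = mrank A \<and> k = r \<and>
       U \<in> carrier_mat n r \<and> V \<in> carrier_mat m r \<and> mrank U = r \<and> mrank V = r \<and>
       A = U * transpose_mat V \<longrightarrow>
         {U * T * transpose_mat V | T. T \<in> carrier_mat r r \<and> det T = 1}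
           = inverse_compounds n m k (compound k A))
    \<and>
    (\<exists>(P :: prog) (C :: real).
       \<forall>(n::nat) (m::nat) (k::nat) (A :: real mat) (p::nat) (r::nat)
         (U :: real mat) (V :: real mat).
         A \<in> carrier_mat n m \<and> 1 \<le> k \<and> k \<le> min n m \<and> p = max m n \<and> r = mrank A \<and> k = r \<and>
         U \<in> carrier_mat n r \<and> V \<in> carrier_mat m r \<and> mrank U = r \<and> mrank V = r \<and>
         A = U * transpose_mat V \<longrightarrow>
           returns P n m k (compound k A)
             (\<lambda>Bs. \<exists>B. Bs = [B] \<and>
                B \<in> {U * T * transpose_mat V | T. T \<in> carrier_mat r r \<and> det T = 1})
             (C * (real (p choose k) * real p ^ 2)))"
proof (intro conjI, goal_cases)
  case 1
  show ?case
  proof (intro allI impI)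
    fix n m k :: nat and A B :: "real mat"
    assume *: "A \<in> carrier_mat n m \<and> B \<in> carrier_mat n m \<and> 1 \<le> k \<and> k \<le> min n m \<and>
       k < mrank A \<and> compound k A = compound k B"
    then obtain c where c: "c \<in> {-1, 1}" "c ^ k = (1 :: real)" "A = c \<cdot>\<^sub>m B"
      using eq_up_to_sign by metis
    have "1 \<cdot>\<^sub>m B = B" "- 1 \<cdot>\<^sub>m B = - B" by (auto intro: eq_matI)
    then show "(odd k \<longrightarrow> A = B) \<and> (even k \<longrightarrow> A = B \<or> A = - B)"
      using c by auto
  qed
next
  case 2
  show ?case
  proof (intro exI[of _ reconstruct_prog] exI[of _ 27] allI impI)
    fix n m k :: nat and A :: "real mat" and p r :: nat
    assume *: "A \<in> carrier_mat n m \<and> 1 \<le> k \<and> k \<le> min n m \<and> p = max m n \<and> r = mrank A \<and> k < r"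
    then have h: "A \<in> carrier_mat n m" "1 \<le> k" "k < mrank A" "p = max m n" by auto
    \<comment> \<open>\<open>1 \<le> k\<close> and \<open>k < r\<close> give
      \<open>r \<ge> 2\<close>, so the logarithm is not negative.\<close>
    have "0 \<le> log 2 (real r)" using * by simp
    then have z: "0 \<le> real (r choose nat \<lceil>real r / 2\<rceil>) ^ 2 * real p * real k ^ 2 * log 2 (real r)"
      by simp
    have y: "0 \<le> real (r choose k) * 2 ^ r" by simp
    have le: "0 \<le> y \<Longrightarrow> 27 * x \<le> 27 * (x + y)" "0 \<le> y \<Longrightarrow> 0 \<le> z \<Longrightarrow> 27 * x \<le> 27 * (x + y + z)"
      for x y z :: real
      by simp_all
    show "let returns_within = returns reconstruct_prog n m k (compound k A)
                   (\<lambda>Bs. set Bs = {c \<cdot>\<^sub>m A | c. c \<in> {-1, 1} \<and> c ^ k = 1})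
            in (int k \<le> \<lceil>real r / 2\<rceil> \<longrightarrow>
                  returns_within
                    (27 * (real (p choose k) ^ 3 * real p * real k + real (r choose k) * 2 ^ r)))
             \<and> (\<lceil>real r / 2\<rceil> < int k \<longrightarrow>
                  returns_within
                    (27 * (real (p choose k) ^ 3 * real p * real k + real (r choose k) * 2 ^ r
                          + real (r choose nat \<lceil>real r / 2\<rceil>) ^ 2
                              * real p * real k ^ 2 * log 2 (real r))))"
      unfolding Let_def by (intro conjI impI reconstruct_returns[OF h] le(1)[OF y] le(2)[OF y z])
  qed
next
  case 3
  show ?case
  proof (intro allI impI)
    fix n m k :: nat and A :: "real mat" and r :: nat and U V :: "real mat"
    assume "A \<in> carrier_mat n m \<and> 1 \<le> k \<and> k \<le> min n m \<and> r = mrank A \<and> k = r \<and>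
       U \<in> carrier_mat n r \<and> V \<in> carrier_mat m r \<and> mrank U = r \<and> mrank V = r \<and>
       A = U * transpose_mat V"
    then have "U \<in> carrier_mat n r" "V \<in> carrier_mat m r" "A = U * transpose_mat V" "1 \<le> k" "k = r" "r = mrank A"
      by blast+
    with inverse_compounds_full_rank[of U n k V m A]
    show "{U * T * transpose_mat V | T. T \<in> carrier_mat r r \<and> det T = 1}
        = inverse_compounds n m k (compound k A)"
      by (metis order_refl)
  qed
next
  case 4
  show ?case
  proof (intro exI[of _ full_rank_prog] exI[of _ 16] allI impI)
    fix n m k :: nat and A :: "real mat" and p r :: nat and U V :: "real mat"
    assume "A \<in> carrier_mat n m \<and> 1 \<le> k \<and> k \<le> min n m \<and> p = max m n \<and> r = mrank A \<and> k = r \<and>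
       U \<in> carrier_mat n r \<and> V \<in> carrier_mat m r \<and> mrank U = r \<and> mrank V = r \<and>
       A = U * transpose_mat V"
    then have "U \<in> carrier_mat n r" "V \<in> carrier_mat m r" "A = U * transpose_mat V" "1 \<le> k" "k = r" "r = mrank A"
      "p = max m n"
      by blast+
    with full_rank_returns[of U n k V m A p]
    show "returns full_rank_prog n m k (compound k A)
             (\<lambda>Bs. \<exists>B. Bs = [B] \<and>
                B \<in> {U * T * transpose_mat V | T. T \<in> carrier_mat r r \<and> det T = 1})
             (16 * (real (p choose k) * real p ^ 2))"
      by (metis order_refl)
  qed
qed

end
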